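(* For every nonzero $C^1$ vector field $X$ on a closed manifold $M$, the rescaled topological entropy $e^*(X)$ is a nonnegative real number (in particular it is finite), and the following properties hold: (1) If $\mu$ is a Borel probability measure on $M$ with $\mu(Sing(X))=0$, then $e^*_\mu(X)\leq e^*(X)$. (2) $e(X)\leq e^*(X)$. (3) $e(X)=e^*(X)$ if $X$ is nonsingular (i.e. $Sing(X)=\emptyset$). (4) There exists a $C^\infty$ vector field $X$ on the two-torus for which $e^*(X)>0$. In particular, the identity $e(X)=e^*(X)$ is not true in general. (5) If $X$ is rescaled topologically conjugate to another nonzero $C^1$ vector field $Y$ on a closed manifold $N$, then $e^*(X)=e^*(Y)$. (6) If $X$ is rescaling expansive and $Sing(X)$ is dynamically isolated, then $$\limsup_{t\to\infty}\frac{1}{t}\log v(t)\leq e^*(X),$$ where $v(t)$ is the number of periodic orbits of $X$ of period $\leq t$.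
   Context: A closed manifold is a compact connected boundaryless manifold of positive dimension equipped with a Riemannian metric; $\|\cdot\|$ and $d$ denote the induced norm on $TM$ and distance on $M$. All vector fields are $C^1$ and not identically zero; $\varphi_t$ is the flow generated by $X$. $Sing(X)=\{x\in M: X(x)=0\}$, $M^*=M\setminus Sing(X)$, and $M_\epsilon=\{x\in M:\|X(x)\|\ge\epsilon\}$. Topological entropy: $e(X)=h(\varphi_1)$, the classical topological entropy of the time-one map. Rescaled topological entropy: for $t\ge 0$, $x\in M^*$, $y\in M$ put $$d^*_t(x,y)=\sup_{0\le s\le t}\frac{d(\varphi_s(x),\varphi_s(y))}{\|X(\varphi_s(x))\|},\qquad B^*(x,t,\epsilon)=\{y\in M: d_t^*(x,y)<\epsilon\},$$ the latter being called a rescaled dynamical $(t,\epsilon)$-ball. A set $F\subset M^*$ is rescaled $(t,\epsilon)$-spanning if $M_\epsilon\subset\bigcup_{x\in F}B^*(x,t,\epsilon)$; $R^*(t,\epsilon)$ is the minimal cardinality of a rescaled $(t,\epsilon)$-spanning set (it is finite). Define $$e^*(X)=\lim_{\epsilon\to0}\limsup_{t\to\infty}\frac1t\log R^*(t,\epsilon).$$ Rescaled metric entropy: for a Borel probability measure $\mu$ on $M$ with $\mu(Sing(X))=0$, let $N^*_\mu(t,\epsilon,\delta)$ be the minimal number of rescaled dynamical $(t,\epsilon)$-balls needed to cover a subset of $\mu$-measure greater than $1-\delta$, and $$e^*_\mu(X)=\lim_{\delta\to0}\lim_{\epsilon\to0}\limsup_{t\to\infty}\frac1t\log N^*_\mu(t,\epsilon,\delta).$$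 Rescaled conjugacy: let $N$ be a closed manifold with a $C^1$ vector field $Y$. A map $h:N\to M$ is rescaled continuous if for every $\epsilon>0$ there is $\delta>0$ such that $y,y'\in N$ and $d(y,y')\le\delta\|Y(y)\|$ imply $d(h(y),h(y'))\le\epsilon\|X(h(y))\|$ (for maps $M\to N$ the definition is the same with the roles of $X$ and $Y$ exchanged). $h$ is a rescaled homeomorphism if it is bijective and both $h$ and $h^{-1}$ are rescaled continuous. $X$ and $Y$ are rescaled topologically conjugate if there is a rescaled homeomorphism $h:N\to M$ with $\varphi_t\circ h=h\circ\psi_t$ for all $t\in\mathbb R$, where $\psi_t$ is the flow of $Y$. Rescaling expansive: for every $\epsilon>0$ there is $\delta>0$ such that if $x,y\in M$ satisfy $d(\varphi_s(x),\varphi_{h(s)}(y))\le\delta\|X(\varphi_s(x))\|$ for all $s\in\mathbb R$ and some increasing homeomorphism $h:\mathbb R\to\mathbb R$, then $\varphi_{h(0)}(y)=\varphi_{s^*}(x)$ for some $s^*\in[-\epsilon,\epsilon]$. Periodic orbits: $x$ is a periodic point if there is a minimal $t>0$ (its period) with $\varphi_t(x)=x$ (so singularities are not periodic points); a periodic orbit is the orbit of a periodic point, with the same period. $Sing(X)$ is dynamically isolated if there is a neighborhood $U$ of $Sing(X)$ with $\bigcap_{t\in\mathbb R}\varphi_t(U)=Sing(X)$. Convention: $\log 0=-\infty$. *)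

theory Defs
  imports "HOL-Probability.Probability"
begin

section \<open>Differentiability classes on open sets\<close>

primrec Ck_on :: "nat \<Rightarrow> ('e::real_normed_vector \<Rightarrow> 'f::real_normed_vector) \<Rightarrow> 'e set \<Rightarrow> bool" where
  "Ck_on 0 f S \<longleftrightarrow> continuous_on S f"
| "Ck_on (Suc k) f S \<longleftrightarrow>
     (\<forall>x\<in>S. f differentiable (at x)) \<and> (\<forall>v. Ck_on k (\<lambda>x. frechet_derivative f (at x) v) S)"

definition smooth_on :: "('e::real_normed_vector \<Rightarrow> 'f::real_normed_vector) \<Rightarrow> 'e set \<Rightarrow> bool" where
  "smooth_on f S \<longleftrightarrow> (\<forall>k. Ck_on k f S)"

section \<open>Riemannian manifolds\<close>

text \<open>A chart is a pair (domain, coordinate map) with values in a Euclidean model space \<open>'e\<close>;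
  the dimension is \<open>DIM('e)\<close>, hence positive. Tensors are given by their components in each chart of
  the atlas: tangent vectors at \<open>p\<close> in the chart \<open>c\<close> are represented by elements of \<open>'e\<close>, and the
  representations in different charts are related by the derivatives of the transition maps.\<close>

type_synonym ('a, 'e) chart = "'a set \<times> ('a \<Rightarrow> 'e)"

type_synonym ('a, 'e) vector_field = "('a, 'e) chart \<Rightarrow> 'a \<Rightarrow> 'e"

record ('a, 'e) riem_manifold =
  mtop :: "'a topology"
  atlas :: "('a, 'e) chart set"
  riem :: "('a, 'e) chart \<Rightarrow> 'a \<Rightarrow> 'e \<Rightarrow> 'e \<Rightarrow> real"

abbreviation pts :: "('a, 'e) riem_manifold \<Rightarrow> 'a set" where
  "pts M \<equiv> topspace (mtop M)"

definition chart_inv :: "('a, 'e) chart \<Rightarrow> 'e \<Rightarrow> 'a" where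
  "chart_inv c = inv_into (fst c) (snd c)"

definition transition :: "('a, 'e) chart \<Rightarrow> ('a, 'e) chart \<Rightarrow> 'e \<Rightarrow> 'e" where
  "transition c d = snd d \<circ> chart_inv c"

definition coord_change ::
  "('a, 'e::euclidean_space) chart \<Rightarrow> ('a, 'e) chart \<Rightarrow> 'a \<Rightarrow> 'e \<Rightarrow> 'e" where
  "coord_change c d p = frechet_derivative (transition c d) (at (snd c p))"

definition is_chart :: "'a topology \<Rightarrow> ('a, 'e::euclidean_space) chart \<Rightarrow> bool" where
  "is_chart T c \<longleftrightarrow> openin T (fst c) \<and> open (snd c ` fst c) \<and>
     homeomorphic_map (subtopology T (fst c)) (top_of_set (snd c ` fst c)) (snd c)"

definition smooth_atlas :: "'a topology \<Rightarrow> ('a, 'e::euclidean_space) chart set \<Rightarrow> bool" where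
  "smooth_atlas T A \<longleftrightarrow>
     (\<forall>c\<in>A. is_chart T c) \<and> (\<Union>c\<in>A. fst c) = topspace T \<and>
     (\<forall>c\<in>A. \<forall>d\<in>A. smooth_on (transition c d) (snd c ` (fst c \<inter> fst d)))"

definition riemannian_metric :: "('a, 'e::euclidean_space) riem_manifold \<Rightarrow> bool" where
  "riemannian_metric M \<longleftrightarrow>
     (\<forall>c\<in>atlas M. \<forall>p\<in>fst c.
        bilinear (riem M c p) \<and> (\<forall>v w. riem M c p v w = riem M c p w v) \<and>
        (\<forall>v. v \<noteq> 0 \<longrightarrow> riem M c p v v > 0)) \<and>
     (\<forall>c\<in>atlas M. \<forall>v w. smooth_on (\<lambda>z. riem M c (chart_inv c z) v w) (snd c ` fst c)) \<and>
     (\<forall>c\<in>atlas M. \<forall>d\<in>atlas M. \<forall>p\<in>fst c \<inter> fst d. \<forall>v w.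
        riem M d p (coord_change c d p v) (coord_change c d p w) = riem M c p v w)"

text \<open>Second countability is implied by compactness and the existence of charts.\<close>

definition closed_riem_manifold :: "('a, 'e::euclidean_space) riem_manifold \<Rightarrow> bool" where
  "closed_riem_manifold M \<longleftrightarrow>
     Hausdorff_space (mtop M) \<and> compact_space (mtop M) \<and> connected_space (mtop M) \<and>
     pts M \<noteq> {} \<and> smooth_atlas (mtop M) (atlas M) \<and> riemannian_metric M"

definition chart_at :: "('a, 'e) riem_manifold \<Rightarrow> 'a \<Rightarrow> ('a, 'e) chart" where
  "chart_at M p = (SOME c. c \<in> atlas M \<and> p \<in> fst c)"

text \<open>The norm at \<open>p\<close> of the tangent vector with components \<open>v\<close> in the chart \<open>chart_at M p\<close>.\<close>

definition tnorm :: "('a, 'e) riem_manifold \<Rightarrow> 'a \<Rightarrow> 'e \<Rightarrow> real" where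
  "tnorm M p v = sqrt (riem M (chart_at M p) p v v)"

text \<open>Curves, length and Riemannian distance. Derivatives at the endpoints of a closed interval
  are one-sided.\<close>

definition C1_curve_on :: "('a, 'e::euclidean_space) riem_manifold \<Rightarrow> real \<Rightarrow> real \<Rightarrow> (real \<Rightarrow> 'a) \<Rightarrow> bool" where
  "C1_curve_on M a b \<gamma> \<longleftrightarrow>
     continuous_map (top_of_set {a..b}) (mtop M) \<gamma> \<and>
     (\<forall>c\<in>atlas M. \<exists>D. continuous_on {t\<in>{a..b}. \<gamma> t \<in> fst c} D \<and>
        (\<forall>t\<in>{a..b}. \<gamma> t \<in> fst c \<longrightarrow>
           ((snd c \<circ> \<gamma>) has_vector_derivative D t) (at t within {a..b})))"

definition piecewise_C1_curve :: "('a, 'e::euclidean_space) riem_manifold \<Rightarrow> (real \<Rightarrow> 'a) \<Rightarrow> bool" where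
  "piecewise_C1_curve M \<gamma> \<longleftrightarrow>
     (\<exists>S. finite S \<and> {0, 1} \<subseteq> S \<and> S \<subseteq> {0..1} \<and>
        (\<forall>a\<in>S. \<forall>b\<in>S. a < b \<and> {a<..<b} \<inter> S = {} \<longrightarrow> C1_curve_on M a b \<gamma>))"

definition curve_speed :: "('a, 'e::euclidean_space) riem_manifold \<Rightarrow> (real \<Rightarrow> 'a) \<Rightarrow> real \<Rightarrow> real" where
  "curve_speed M \<gamma> t =
     tnorm M (\<gamma> t) (vector_derivative (snd (chart_at M (\<gamma> t)) \<circ> \<gamma>) (at t within {0..1}))"

definition curve_length :: "('a, 'e::euclidean_space) riem_manifold \<Rightarrow> (real \<Rightarrow> 'a) \<Rightarrow> real" where
  "curve_length M \<gamma> = integral {0..1} (curve_speed M \<gamma>)"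

definition mdist :: "('a, 'e::euclidean_space) riem_manifold \<Rightarrow> 'a \<Rightarrow> 'a \<Rightarrow> real" where
  "mdist M p q = Inf {curve_length M \<gamma> |\<gamma>. piecewise_C1_curve M \<gamma> \<and> \<gamma> 0 = p \<and> \<gamma> 1 = q}"

section \<open>Vector fields and flows\<close>

definition tangent_field :: "('a, 'e::euclidean_space) riem_manifold \<Rightarrow> ('a, 'e) vector_field \<Rightarrow> bool" where
  "tangent_field M X \<longleftrightarrow>
     (\<forall>c\<in>atlas M. \<forall>d\<in>atlas M. \<forall>p\<in>fst c \<inter> fst d. X d p = coord_change c d p (X c p))"

definition C1_vector_field :: "('a, 'e::euclidean_space) riem_manifold \<Rightarrow> ('a, 'e) vector_field \<Rightarrow> bool" where
  "C1_vector_field M X \<longleftrightarrow> tangent_field M X \<and>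
     (\<forall>c\<in>atlas M. Ck_on 1 (\<lambda>z. X c (chart_inv c z)) (snd c ` fst c))"

definition smooth_vector_field :: "('a, 'e::euclidean_space) riem_manifold \<Rightarrow> ('a, 'e) vector_field \<Rightarrow> bool" where
  "smooth_vector_field M X \<longleftrightarrow> tangent_field M X \<and>
     (\<forall>c\<in>atlas M. smooth_on (\<lambda>z. X c (chart_inv c z)) (snd c ` fst c))"

definition vf_norm :: "('a, 'e::euclidean_space) riem_manifold \<Rightarrow> ('a, 'e) vector_field \<Rightarrow> 'a \<Rightarrow> real" where
  "vf_norm M X p = tnorm M p (X (chart_at M p) p)"

definition Sing :: "('a, 'e::euclidean_space) riem_manifold \<Rightarrow> ('a, 'e) vector_field \<Rightarrow> 'a set" where
  "Sing M X = {p \<in> pts M. \<forall>c\<in>atlas M. p \<in> fst c \<longrightarrow> X c p = 0}"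

definition nonzero_field :: "('a, 'e::euclidean_space) riem_manifold \<Rightarrow> ('a, 'e) vector_field \<Rightarrow> bool" where
  "nonzero_field M X \<longleftrightarrow> (\<exists>p\<in>pts M. p \<notin> Sing M X)"

definition integral_curve ::
  "('a, 'e::euclidean_space) riem_manifold \<Rightarrow> ('a, 'e) vector_field \<Rightarrow> (real \<Rightarrow> 'a) \<Rightarrow> bool" where
  "integral_curve M X \<gamma> \<longleftrightarrow> continuous_map euclideanreal (mtop M) \<gamma> \<and>
     (\<forall>t. \<forall>c\<in>atlas M. \<gamma> t \<in> fst c \<longrightarrow>
        ((snd c \<circ> \<gamma>) has_vector_derivative X c (\<gamma> t)) (at t))"

text \<open>On a closed manifold every point lies on exactly one integral curve, defined for all time,
  of a \<open>C\<^sup>1\<close> vector field.\<close>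

definition flow ::
  "('a, 'e::euclidean_space) riem_manifold \<Rightarrow> ('a, 'e) vector_field \<Rightarrow> real \<Rightarrow> 'a \<Rightarrow> 'a" where
  "flow M X t x = (THE \<gamma>. integral_curve M X \<gamma> \<and> \<gamma> 0 = x) t"

section \<open>Cardinalities and logarithms with values in the extended numbers\<close>

definition ecard :: "'a set \<Rightarrow> enat" where
  "ecard A = (if finite A then enat (card A) else \<infinity>)"

definition elog :: "enat \<Rightarrow> ereal" where
  "elog n = (case n of enat k \<Rightarrow> if k = 0 then - \<infinity> else ereal (ln (real k)) | \<infinity> \<Rightarrow> \<infinity>)"

section \<open>Topological entropy\<close>

text \<open>Bowen's definition for a map \<open>f\<close> on the compact metric space \<open>(S, d)\<close>.\<close>

definition span_number :: "'a set \<Rightarrow> ('a \<Rightarrow> 'a \<Rightarrow> real) \<Rightarrow> ('a \<Rightarrow> 'a) \<Rightarrow> nat \<Rightarrow> real \<Rightarrow> enat" where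
  "span_number S d f n \<epsilon> =
     (INF F\<in>{F. F \<subseteq> S \<and> (\<forall>y\<in>S. \<exists>x\<in>F. \<forall>i<n. d ((f ^^ i) x) ((f ^^ i) y) < \<epsilon>)}. ecard F)"

definition top_entropy :: "'a set \<Rightarrow> ('a \<Rightarrow> 'a \<Rightarrow> real) \<Rightarrow> ('a \<Rightarrow> 'a) \<Rightarrow> ereal" where
  "top_entropy S d f =
     Lim (at_right 0) (\<lambda>\<epsilon>::real. limsup (\<lambda>n. elog (span_number S d f n \<epsilon>) / ereal (real n)))"

definition flow_entropy :: "('a, 'e::euclidean_space) riem_manifold \<Rightarrow> ('a, 'e) vector_field \<Rightarrow> ereal" where
  "flow_entropy M X = top_entropy (pts M) (mdist M) (flow M X 1)"

section \<open>Rescaled entropies\<close>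

definition regular_pts :: "('a, 'e::euclidean_space) riem_manifold \<Rightarrow> ('a, 'e) vector_field \<Rightarrow> 'a set" where
  "regular_pts M X = pts M - Sing M X"

definition rdist ::
  "('a, 'e::euclidean_space) riem_manifold \<Rightarrow> ('a, 'e) vector_field \<Rightarrow> real \<Rightarrow> 'a \<Rightarrow> 'a \<Rightarrow> real" where
  "rdist M X t x y =
     (SUP s\<in>{0..t}. mdist M (flow M X s x) (flow M X s y) / vf_norm M X (flow M X s x))"

definition rball ::
  "('a, 'e::euclidean_space) riem_manifold \<Rightarrow> ('a, 'e) vector_field \<Rightarrow> 'a \<Rightarrow> real \<Rightarrow> real \<Rightarrow> 'a set" where
  "rball M X x t \<epsilon> = {y \<in> pts M. rdist M X t x y < \<epsilon>}"

definition rescaled_spanning ::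
  "('a, 'e::euclidean_space) riem_manifold \<Rightarrow> ('a, 'e) vector_field \<Rightarrow> real \<Rightarrow> real \<Rightarrow> 'a set \<Rightarrow> bool" where
  "rescaled_spanning M X t \<epsilon> F \<longleftrightarrow> F \<subseteq> regular_pts M X \<and>
     {x \<in> pts M. vf_norm M X x \<ge> \<epsilon>} \<subseteq> (\<Union>x\<in>F. rball M X x t \<epsilon>)"

definition rspan_number ::
  "('a, 'e::euclidean_space) riem_manifold \<Rightarrow> ('a, 'e) vector_field \<Rightarrow> real \<Rightarrow> real \<Rightarrow> enat" where
  "rspan_number M X t \<epsilon> = (INF F\<in>{F. rescaled_spanning M X t \<epsilon> F}. ecard F)"

definition rescaled_entropy :: "('a, 'e::euclidean_space) riem_manifold \<Rightarrow> ('a, 'e) vector_field \<Rightarrow> ereal" where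
  "rescaled_entropy M X =
     Lim (at_right 0) (\<lambda>\<epsilon>::real. Limsup at_top (\<lambda>t::real. elog (rspan_number M X t \<epsilon>) / ereal t))"

definition borel_prob :: "'a topology \<Rightarrow> 'a measure \<Rightarrow> bool" where
  "borel_prob T \<mu> \<longleftrightarrow> space \<mu> = topspace T \<and>
     sets \<mu> = sigma_sets (topspace T) {U. openin T U} \<and> prob_space \<mu>"

definition rcover_number ::
  "('a, 'e::euclidean_space) riem_manifold \<Rightarrow> ('a, 'e) vector_field \<Rightarrow> 'a measure \<Rightarrow>
   real \<Rightarrow> real \<Rightarrow> real \<Rightarrow> enat" where
  "rcover_number M X \<mu> t \<epsilon> \<delta> =
     (INF F\<in>{F. F \<subseteq> regular_pts M X \<and>
              (\<exists>A\<in>sets \<mu>. A \<subseteq> (\<Union>x\<in>F. rball M X x t \<epsilon>) \<and> measure \<mu> A > 1 - \<delta>)}. ecard F)"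

definition rescaled_metric_entropy ::
  "('a, 'e::euclidean_space) riem_manifold \<Rightarrow> ('a, 'e) vector_field \<Rightarrow> 'a measure \<Rightarrow> ereal" where
  "rescaled_metric_entropy M X \<mu> =
     Lim (at_right 0) (\<lambda>\<delta>::real. Lim (at_right 0) (\<lambda>\<epsilon>::real.
       Limsup at_top (\<lambda>t::real. elog (rcover_number M X \<mu> t \<epsilon> \<delta>) / ereal t)))"

section \<open>Rescaled conjugacy and expansivity, periodic orbits\<close>

definition rescaled_continuous ::
  "('b, 'f::euclidean_space) riem_manifold \<Rightarrow> ('b, 'f) vector_field \<Rightarrow>
   ('a, 'e::euclidean_space) riem_manifold \<Rightarrow> ('a, 'e) vector_field \<Rightarrow> ('b \<Rightarrow> 'a) \<Rightarrow> bool" where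
  "rescaled_continuous N Y M X h \<longleftrightarrow>
     (\<forall>\<epsilon>>0. \<exists>\<delta>>0. \<forall>y\<in>pts N. \<forall>y'\<in>pts N.
        mdist N y y' \<le> \<delta> * vf_norm N Y y \<longrightarrow> mdist M (h y) (h y') \<le> \<epsilon> * vf_norm M X (h y))"

definition rescaled_homeomorphism ::
  "('b, 'f::euclidean_space) riem_manifold \<Rightarrow> ('b, 'f) vector_field \<Rightarrow>
   ('a, 'e::euclidean_space) riem_manifold \<Rightarrow> ('a, 'e) vector_field \<Rightarrow> ('b \<Rightarrow> 'a) \<Rightarrow> bool" where
  "rescaled_homeomorphism N Y M X h \<longleftrightarrow> bij_betw h (pts N) (pts M) \<and>
     rescaled_continuous N Y M X h \<and> rescaled_continuous M X N Y (inv_into (pts N) h)"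

definition rescaled_conjugate ::
  "('a, 'e::euclidean_space) riem_manifold \<Rightarrow> ('a, 'e) vector_field \<Rightarrow>
   ('b, 'f::euclidean_space) riem_manifold \<Rightarrow> ('b, 'f) vector_field \<Rightarrow> bool" where
  "rescaled_conjugate M X N Y \<longleftrightarrow>
     (\<exists>h. rescaled_homeomorphism N Y M X h \<and>
        (\<forall>t. \<forall>y\<in>pts N. flow M X t (h y) = h (flow N Y t y)))"

definition rescaling_expansive ::
  "('a, 'e::euclidean_space) riem_manifold \<Rightarrow> ('a, 'e) vector_field \<Rightarrow> bool" where
  "rescaling_expansive M X \<longleftrightarrow>
     (\<forall>\<epsilon>>0. \<exists>\<delta>>0. \<forall>x\<in>pts M. \<forall>y\<in>pts M. \<forall>h::real \<Rightarrow> real.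
        strict_mono h \<and> (\<exists>k. homeomorphism UNIV UNIV h k) \<and>
        (\<forall>s. mdist M (flow M X s x) (flow M X (h s) y) \<le> \<delta> * vf_norm M X (flow M X s x)) \<longrightarrow>
        (\<exists>s\<in>{- \<epsilon>..\<epsilon>}. flow M X (h 0) y = flow M X s x))"

definition dynamically_isolated_Sing ::
  "('a, 'e::euclidean_space) riem_manifold \<Rightarrow> ('a, 'e) vector_field \<Rightarrow> bool" where
  "dynamically_isolated_Sing M X \<longleftrightarrow>
     (\<exists>U V. openin (mtop M) V \<and> Sing M X \<subseteq> V \<and> V \<subseteq> U \<and> U \<subseteq> pts M \<and>
        (\<Inter>t. flow M X t ` U) = Sing M X)"

definition has_period ::
  "('a, 'e::euclidean_space) riem_manifold \<Rightarrow> ('a, 'e) vector_field \<Rightarrow> 'a \<Rightarrow> real \<Rightarrow> bool" where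
  "has_period M X x \<tau> \<longleftrightarrow>
     \<tau> > 0 \<and> flow M X \<tau> x = x \<and> (\<forall>s. 0 < s \<and> s < \<tau> \<longrightarrow> flow M X s x \<noteq> x)"

definition periodic_orbits_upto ::
  "('a, 'e::euclidean_space) riem_manifold \<Rightarrow> ('a, 'e) vector_field \<Rightarrow> real \<Rightarrow> 'a set set" where
  "periodic_orbits_upto M X t =
     {range (\<lambda>s. flow M X s x) |x. x \<in> pts M \<and> (\<exists>\<tau>\<le>t. has_period M X x \<tau>)}"

section \<open>The flat two-torus\<close>

text \<open>The torus is the product of two unit circles in the complex plane, with angular coordinates
  ranging over open squares of side \<open>2\<pi>\<close>. The transition maps are locally translations, so the
  standard inner product in all charts is a Riemannian metric.\<close>

definition angle_box :: "real \<times> real \<Rightarrow> (real \<times> real) set" where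
  "angle_box a = {fst a<..<fst a + 2 * pi} \<times> {snd a<..<snd a + 2 * pi}"

definition torus_param :: "real \<times> real \<Rightarrow> complex \<times> complex" where
  "torus_param z = (cis (fst z), cis (snd z))"

definition torus_chart :: "real \<times> real \<Rightarrow> (complex \<times> complex, real \<times> real) chart" where
  "torus_chart a = (torus_param ` angle_box a, inv_into (angle_box a) torus_param)"

definition torus :: "(complex \<times> complex, real \<times> real) riem_manifold" where
  "torus = \<lparr>mtop = top_of_set (sphere 0 1 \<times> sphere 0 1), atlas = range torus_chart,
            riem = (\<lambda>c p v w. v \<bullet> w)\<rparr>"

section \<open>The torus is a closed Riemannian manifold\<close>

lemma Ck_on_cong:
  assumes "open S" "\<And>x. x \<in> S \<Longrightarrow> f x = g x" "Ck_on k f S"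
  shows "Ck_on k g S"
  using assms(2,3)
proof (induction k arbitrary: f g)
  case 0
  then show ?case using continuous_on_cong[of S S f g] by simp
next
  case (Suc k)
  have d: "(g has_derivative frechet_derivative f (at x)) (at x)" if "x \<in> S" for x
  proof -
    have "(f has_derivative frechet_derivative f (at x)) (at x)"
      using Suc.prems(2) that by (auto simp: frechet_derivative_works)
    then show ?thesis
      by (rule has_derivative_transform_within_open[OF _ assms(1) that]) (use Suc.prems in auto)
  qed
  then have e: "frechet_derivative g (at x) = frechet_derivative f (at x)" if "x \<in> S" for x
    using frechet_derivative_at that by metis
  have "Ck_on k (\<lambda>x. frechet_derivative g (at x) v) S" for v
    by (rule Suc.IH[of "\<lambda>x. frechet_derivative f (at x) v"]) (use e Suc.prems(2) in auto)
  then show ?case using d by (auto simp: differentiable_def)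
qed

lemma smooth_on_const: "smooth_on (\<lambda>_. c) S"
proof -
  have "Ck_on k (\<lambda>_. c) S" for k
    by (induction k arbitrary: c) (auto simp: frechet_derivative_const)
  then show ?thesis by (simp add: smooth_on_def)
qed

definition torus_inv :: "real \<times> real \<Rightarrow> complex \<times> complex \<Rightarrow> real \<times> real" where
  "torus_inv a p = (fst a + pi + Arg (- (fst p * cis (- fst a))), snd a + pi + Arg (- (snd p * cis (- snd a))))"

lemma shift_cis: "- (cis x * cis (- a)) = cis (x - a - pi)"
proof -
  have "cis (x - a - pi) = cis x * cis (- a) * cis (- pi)" by (simp only: cis_mult) simp
  also have "cis (- pi) = -1" by (simp add: complex_eq_iff)
  finally show ?thesis by simp
qed

lemma Arg_shift: "a < x \<Longrightarrow> x < a + 2 * pi \<Longrightarrow> Arg (- (cis x * cis (- a))) = x - a - pi"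
  unfolding shift_cis by (rule cis_Arg_unique) (simp_all add: sgn_eq)

lemma torus_inv_param: "z \<in> angle_box a \<Longrightarrow> torus_inv a (torus_param z) = z"
  by (cases z) (simp add: torus_inv_def torus_param_def angle_box_def mem_Times_iff Arg_shift del: cis_divide)

lemma cis_range:
  assumes "norm z = 1" "z \<noteq> cis a" shows "\<exists>x. a < x \<and> x < a + 2 * pi \<and> z = cis x"
proof -
  define w where "w = - z * cis (- a)"
  have w: "norm w = 1" using assms by (simp add: w_def norm_mult)
  then have "w = cis (Arg w)" by (metis cis_Arg norm_zero sgn_eq div_by_1 zero_neq_one of_real_1)
  moreover have "z = - w * cis a" by (simp add: w_def cis_mult)
  ultimately have z: "z = cis (Arg w + a + pi)" by (metis cis_mult cis_pi mult_minus1_right mult_minus_left mult.assoc)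
  have "Arg w \<noteq> pi"
  proof
    assume "Arg w = pi"
    then have "z = cis (a + 2 * pi)" using z by (simp add: algebra_simps)
    then show False using assms(2) by (simp add: cis_mult[symmetric])
  qed
  then show ?thesis using z Arg_bounded[of w] by (intro exI[of _ "Arg w + a + pi"]) auto
qed

lemma cis_ne: "a < x \<Longrightarrow> x < a + 2 * pi \<Longrightarrow> cis x \<noteq> cis a"
proof
  assume x: "a < x" "x < a + 2 * pi" and e: "cis x = cis a"
  have "Arg (- (cis x * cis (- a))) = x - a - pi" using x by (rule Arg_shift)
  also have "cis x * cis (- a) = 1" unfolding e by (simp add: cis_mult)
  finally have "x - a - pi = pi" using Arg_eq_pi[of "- 1"] by simp
  then show False using x by linarith
qed

lemma torus_dom: "torus_param ` angle_box a =
   sphere 0 1 \<times> sphere 0 1 \<inter> ((- {cis (fst a)}) \<times> (- {cis (snd a)}))"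
proof -
  let ?R = "sphere 0 1 \<times> sphere 0 1 \<inter> ((- {cis (fst a)}) \<times> (- {cis (snd a)}))"
  have "p \<in> torus_param ` angle_box a" if "p \<in> ?R" for p
  proof -
    have n: "norm (fst p) = 1" "norm (snd p) = 1" "fst p \<noteq> cis (fst a)" "snd p \<noteq> cis (snd a)"
      using that by (simp_all add: mem_Times_iff)
    obtain x y where "fst a < x" "x < fst a + 2 * pi" "fst p = cis x"
       "snd a < y" "y < snd a + 2 * pi" "snd p = cis y"
      using cis_range[OF n(1,3)] cis_range[OF n(2,4)] by blast
    then show ?thesis
      by (intro image_eqI[of _ _ "(x,y)"]) (simp_all add: torus_param_def angle_box_def prod_eq_iff)
  qed
  moreover have "torus_param z \<in> ?R" if "z \<in> angle_box a" for z
    using that cis_ne[of "fst a" "fst z"] cis_ne[of "snd a" "snd z"]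
    by (simp add: torus_param_def angle_box_def mem_Times_iff)
  ultimately show ?thesis by blast
qed

lemma cont_torus_inv: "continuous_on (torus_param ` angle_box a) (torus_inv a)"
proof -
  have *: "- (cis x * cis (- b)) \<notin> \<real>\<^sub>\<le>\<^sub>0" if "b < x" "x < b + 2 * pi" for x b
  proof
    assume "- (cis x * cis (- b)) \<in> \<real>\<^sub>\<le>\<^sub>0"
    moreover have "- (cis x * cis (- b)) \<noteq> 0" by simp
    ultimately have "Arg (- (cis x * cis (- b))) = pi"
      by (metis Arg_eq_pi complex_nonpos_Reals_iff complex_eq_iff zero_complex.sel order_less_le)
    with Arg_shift[OF that] that show False by linarith
  qed
  have "- (fst p * cis (- fst a)) \<notin> \<real>\<^sub>\<le>\<^sub>0 \<and> - (snd p * cis (- snd a)) \<notin> \<real>\<^sub>\<le>\<^sub>0"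
    if "p \<in> torus_param ` angle_box a" for p
  proof -
    from that obtain z where "z \<in> angle_box a" "p = torus_param z" by blast
    then show ?thesis using *[of "fst a" "fst z"] *[of "snd a" "snd z"]
      by (simp only: torus_param_def angle_box_def mem_Times_iff greaterThanLessThan_iff fst_conv snd_conv) blast
  qed
  then show ?thesis unfolding torus_inv_def by (intro continuous_intros) blast+
qed

lemma torus_chart_simps:
  "fst (torus_chart a) = torus_param ` angle_box a"
  "z \<in> angle_box a \<Longrightarrow> snd (torus_chart a) (torus_param z) = z"
  "p \<in> torus_param ` angle_box a \<Longrightarrow> snd (torus_chart a) p = torus_inv a p"
  "snd (torus_chart a) ` (torus_param ` angle_box a) = angle_box a"
  "z \<in> angle_box a \<Longrightarrow> chart_inv (torus_chart a) z = torus_param z"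
proof -
  have inj: "inj_on torus_param (angle_box a)" by (metis inj_onI torus_inv_param)
  show "fst (torus_chart a) = torus_param ` angle_box a" by (simp add: torus_chart_def)
  show 2: "snd (torus_chart a) (torus_param z) = z" if "z \<in> angle_box a" for z
    using that inj by (simp add: torus_chart_def)
  show "snd (torus_chart a) p = torus_inv a p" if "p \<in> torus_param ` angle_box a"
    using that by (auto simp: 2 torus_inv_param)
  show "snd (torus_chart a) ` (torus_param ` angle_box a) = angle_box a"
    by (simp add: image_image 2)
  show "chart_inv (torus_chart a) z = torus_param z" if "z \<in> angle_box a"
  proof -
    have "inj_on (snd (torus_chart a)) (torus_param ` angle_box a)"
      using 2 by (auto simp: inj_on_def)
    then have "inv_into (torus_param ` angle_box a) (snd (torus_chart a)) (snd (torus_chart a) (torus_param z)) = torus_param z"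
      using that by (intro inv_into_f_f) auto
    then show ?thesis using 2 that by (simp add: chart_inv_def torus_chart_def)
  qed
qed

lemma open_angle_box: "open (angle_box a)"
  by (simp add: angle_box_def open_Times)

lemma cont_torus_param: "continuous_on S torus_param"
  unfolding torus_param_def by (intro continuous_intros)

lemma is_chart_torus: "is_chart (mtop torus) (torus_chart a)"
proof -
  let ?U = "torus_param ` angle_box a"
  have op: "openin (top_of_set (sphere 0 1 \<times> sphere 0 1)) ?U"
    unfolding torus_dom by (intro openin_open_Int open_Times) auto
  have "homeomorphic_maps (top_of_set ?U) (top_of_set (angle_box a)) (snd (torus_chart a)) torus_param"
    unfolding homeomorphic_maps_def
  proof (intro conjI ballI)
    have "continuous_on ?U (snd (torus_chart a))"
      using cont_torus_inv by (rule continuous_on_eq) (simp add: torus_chart_simps)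
    then show "continuous_map (top_of_set ?U) (top_of_set (angle_box a)) (snd (torus_chart a))"
      using torus_chart_simps(4)[of a] by auto
    show "continuous_map (top_of_set (angle_box a)) (top_of_set ?U) torus_param"
      using cont_torus_param by auto
  qed (auto simp: torus_chart_simps torus_inv_param)
  then have "homeomorphic_map (top_of_set ?U) (top_of_set (angle_box a)) (snd (torus_chart a))"
    by (rule homeomorphic_maps_imp_map)
  moreover have mt: "mtop torus = top_of_set (sphere 0 1 \<times> sphere 0 1)"
    by (simp add: torus_def)
  moreover have "subtopology (mtop torus) ?U = top_of_set ?U"
    using openin_imp_subset[OF op] by (simp only: mt subtopology_subtopology Int_absorb1 topspace_euclidean_subtopology)
  ultimately show ?thesis
    unfolding is_chart_def torus_chart_simps(1,4)
    using op open_angle_box[of a] by metis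
qed

lemma torus_transition:
  fixes a b :: "real \<times> real"
  defines "S \<equiv> snd (torus_chart a) ` (fst (torus_chart a) \<inter> fst (torus_chart b))"
  shows "open S"
    and "z \<in> S \<Longrightarrow> (transition (torus_chart a) (torus_chart b) has_derivative id) (at z)"
proof -
  let ?T = "transition (torus_chart a) (torus_chart b)"
  have S: "S = angle_box a \<inter> torus_param -` (torus_param ` angle_box b)"
  proof (intro equalityI subsetI)
    fix x assume "x \<in> S"
    then obtain y where "y \<in> angle_box a" "torus_param y \<in> torus_param ` angle_box b"
        "x = snd (torus_chart a) (torus_param y)"
      unfolding S_def torus_chart_simps(1) by blast
    then show "x \<in> angle_box a \<inter> torus_param -` (torus_param ` angle_box b)"
      by (simp add: torus_chart_simps(2))
  next
    fix x assume x: "x \<in> angle_box a \<inter> torus_param -` (torus_param ` angle_box b)"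
    then show "x \<in> S"
      unfolding S_def torus_chart_simps(1)
      by (intro image_eqI[of _ _ "torus_param x"]) (auto simp: torus_chart_simps(2))
  qed
  have eq: "torus_param -` (torus_param ` angle_box b) =
      torus_param -` ((- {cis (fst b)}) \<times> (- {cis (snd b)}))"
    unfolding torus_dom by (auto simp: torus_param_def)
  have op: "open (torus_param -` (torus_param ` angle_box b))"
    unfolding eq by (intro open_vimage cont_torus_param open_Times) auto
  show "open S" unfolding S by (rule open_Int[OF open_angle_box op])
  show "(?T has_derivative id) (at z)" if z: "z \<in> S"
  proof -
    from z S obtain w where w: "w \<in> angle_box b" "torus_param z = torus_param w" by auto
    let ?N = "angle_box a \<inter> (\<lambda>x. x + (w - z)) -` angle_box b"
    have N: "open ?N"
      by (intro open_Int open_angle_box open_vimage continuous_intros)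
    have zN: "z \<in> ?N" using z S w by auto
    have sh: "torus_param (x + (w - z)) = torus_param x" for x
    proof -
      have "cis (u + (r - s)) = cis u" if "cis s = cis r" for u r s :: real
      proof -
        have "cis (u + (r - s)) = cis u * (cis r / cis s)" by (simp only: cis_divide cis_mult)
        then show ?thesis using that by simp
      qed
      then show ?thesis using w(2) by (simp add: torus_param_def)
    qed
    have T: "?T x = x + (w - z)" if "x \<in> ?N" for x
    proof -
      have "?T x = snd (torus_chart b) (torus_param (x + (w - z)))"
        using that by (simp only: transition_def o_def torus_chart_simps(5) sh IntD1)
      also have "\<dots> = x + (w - z)" using that by (intro torus_chart_simps(2)) blast
      finally show ?thesis .
    qed
    have "((\<lambda>x. x + (w - z)) has_derivative id) (at z)"
      unfolding id_def by (auto intro!: derivative_eq_intros)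
    then show ?thesis
      by (rule has_derivative_transform_within_open[OF _ N zN]) (rule T[symmetric])
  qed
qed

lemma closed_riem_manifold_torus: "closed_riem_manifold torus"
proof -
  have top: "pts torus = sphere 0 1 \<times> sphere 0 1" by (simp add: torus_def)
  have "compact_space (mtop torus)" "connected_space (mtop torus)" "Hausdorff_space (mtop torus)"
    by (simp_all add: torus_def compact_space_subtopology compact_Times connected_space_subtopology
        connected_Times connected_sphere Hausdorff_space_subtopology)
  moreover have "pts torus \<noteq> {}" by (auto simp: top intro!: exI[of _ 1])
  moreover have "smooth_atlas (mtop torus) (atlas torus)"
    unfolding smooth_atlas_def
  proof (intro conjI ballI)
    show "is_chart (mtop torus) c" if "c \<in> atlas torus" for c
      using that is_chart_torus by (auto simp: torus_def)
    have "p \<in> (\<Union>c\<in>atlas torus. fst c)" if "p \<in> pts torus" for p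
    proof -
      have "norm (fst p) = 1" "norm (snd p) = 1" using that by (auto simp: top)
      then have "cis (Arg (fst p)) = fst p" "cis (Arg (snd p)) = snd p"
        using cis_Arg[of "fst p"] cis_Arg[of "snd p"] by (force simp: sgn_eq)+
      then obtain u v where u: "fst p = cis u" "snd p = cis v" by (metis (no_types))
      then have "p \<in> fst (torus_chart (u - pi, v - pi))"
        unfolding torus_chart_simps(1)
        by (intro image_eqI[of _ _ "(u, v)"]) (auto simp: torus_param_def angle_box_def prod_eq_iff)
      then show ?thesis by (auto simp: torus_def)
    qed
    moreover have "fst c \<subseteq> pts torus" if "c \<in> atlas torus" for c
      using that unfolding top by (auto simp: torus_def torus_chart_simps torus_param_def)
    ultimately show "(\<Union>c\<in>atlas torus. fst c) = pts torus" by blast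
    show "smooth_on (transition c d) (snd c ` (fst c \<inter> fst d))"
      if cd: "c \<in> atlas torus" "d \<in> atlas torus" for c d
    proof -
      obtain a b where ab: "c = torus_chart a" "d = torus_chart b" using cd by (auto simp: torus_def)
      let ?S = "snd c ` (fst c \<inter> fst d)"
      note D = torus_transition[where a = a and b = b, folded ab]
      have f: "frechet_derivative (transition c d) (at z) = id" if "z \<in> ?S" for z
        using frechet_derivative_at[OF D(2)[OF that]] by simp
      have "Ck_on k (transition c d) ?S" for k
      proof (cases k)
        case 0
        have "continuous_on ?S (transition c d)"
          by (rule has_derivative_continuous_on) (rule has_derivative_at_withinI[OF D(2)])
        then show ?thesis using 0 by simp
      next
        case (Suc j)
        have "Ck_on j (\<lambda>z. frechet_derivative (transition c d) (at z) v) ?S" for v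
        proof (rule Ck_on_cong[OF D(1)])
          show "Ck_on j (\<lambda>_. v) ?S" using smooth_on_const[of v ?S] unfolding smooth_on_def by blast
          show "v = frechet_derivative (transition c d) (at z) v" if "z \<in> ?S" for z
            by (simp only: f[OF that] id_apply)
        qed
        moreover have "\<forall>z\<in>?S. transition c d differentiable (at z)"
          using D(2) unfolding differentiable_def by blast
        ultimately show ?thesis using Suc by simp
      qed
      then show ?thesis by (simp add: smooth_on_def)
    qed
  qed
  moreover have "riemannian_metric torus"
    unfolding riemannian_metric_def
  proof (intro conjI ballI allI impI)
    fix c d p v w assume "c \<in> atlas torus" "d \<in> atlas torus" "p \<in> fst c \<inter> fst d"
    then obtain a b where ab: "c = torus_chart a" "d = torus_chart b" by (auto simp: torus_def)
    have "snd c p \<in> snd c ` (fst c \<inter> fst d)" using \<open>p \<in> _\<close> by blast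
    then have "coord_change c d p = id"
      unfolding coord_change_def ab by (intro frechet_derivative_at[symmetric] torus_transition(2))
    then show "riem torus d p (coord_change c d p v) (coord_change c d p w) = riem torus c p v w"
      by (simp add: torus_def)
  qed (simp_all add: torus_def inner_commute smooth_on_const bilinear_conv_bounded_bilinear bounded_bilinear_inner)
  ultimately show ?thesis by (simp add: closed_riem_manifold_def)
qed

end

theory Submission
  imports Defs "HOL-Real_Asymp.Real_Asymp"
begin

text \<open>
  Every statement reduces to a few estimates for the flow, which hold with unspecified constants because \<open>M\<close> is
  compact: over a unit of time the flow is Lipschitz, the speed \<open>V = \<parallel>X\<parallel>\<close> changes at most by a constant factor
  along an orbit, a point \<open>x\<close> moves a distance of at most a constant times \<open>V x\<close>, \<open>V\<close> is Lipschitz up to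
  constants, and the number of \<open>\<eta>\<close>-balls needed to cover \<open>M\<close> is polynomial in \<open>1 / \<eta>\<close>. They are collected in the locale
  \<open>regular_flow\<close>. Their proof (\<open>regular_flow_exists\<close>) needs that charts are locally bi-Lipschitz for the
  Riemannian distance (\<open>mdist_le_chart\<close>, \<open>chart_le_mdist\<close>), and the local theory of ordinary differential equations
  (\<open>picard\<close>, \<open>ode_close\<close>).

  All limits over radii are suprema, because the counting functions are monotone in the radius. Finiteness
  (\<open>rescaled_entropy_real\<close>): distances grow and speeds decay at most exponentially, so an exponentially fine net is
  rescaled spanning. The metric entropy is not larger (\<open>metric_entropy_le\<close>) because the regions where the speed is at
  least \<open>e\<close> exhaust the regular points. Without singularities the speed is bounded below, and rescaled balls are
  comparable with ordinary ones (\<open>nonsingular_entropy_le\<close>).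

  The inequality between topological and rescaled entropy (\<open>entropy_le_rescaled\<close>) is proved by counting. Before an
  orbit first enters the region of speed at least \<open>e\<close> it moves so slowly that few symbols describe it up to a fixed
  error; from then on it is covered by a rescaled ball, which is contained in a small ordinary dynamical ball. The
  rate of the slow part tends to zero with \<open>e\<close>.

  Periodic orbits whose periods lie in a common short interval are separated by rescaled balls: in the same ball a
  linear reparametrization makes them close for all times and expansivity identifies them
  (\<open>periodic_orbit_growth\<close>). A conjugacy maps spanning sets to spanning sets (\<open>conjugate_entropy_le\<close>).

  The example on the torus is \<open>\<theta>' = sin \<theta>, y' = 0\<close>. Its time-one map is monotone in \<open>\<theta>\<close> and constant in \<open>y\<close>, so its
  entropy is zero (\<open>sine_flow_entropy\<close>). Near the circle \<open>\<theta> = \<pi>\<close> the speed decays like \<open>exp (- t)\<close> while differences in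
  \<open>y\<close> persist, so rescaled distances in the direction of \<open>y\<close> grow like \<open>exp t\<close> (\<open>sine_rescaled_entropy\<close>).
\<close>

section \<open>Charts of a closed Riemannian manifold\<close>

locale closed_rmanifold =
  fixes M :: "('a, 'e::euclidean_space) riem_manifold"
  assumes closed: "closed_riem_manifold M"
begin

lemma compact_M: "compact_space (mtop M)" and Hausdorff_M: "Hausdorff_space (mtop M)"
  and connected_M: "connected_space (mtop M)" and pts_nonempty: "pts M \<noteq> {}"
  using closed by (auto simp: closed_riem_manifold_def)

lemma is_chart_atlas: "c \<in> atlas M \<Longrightarrow> is_chart (mtop M) c"
  and atlas_cover: "(\<Union>c\<in>atlas M. fst c) = pts M"
  and transition_smooth: "c \<in> atlas M \<Longrightarrow> d \<in> atlas M \<Longrightarrow> smooth_on (transition c d) (snd c ` (fst c \<inter> fst d))"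
  using closed by (auto simp: closed_riem_manifold_def smooth_atlas_def)

lemma chart_at: assumes "p \<in> pts M" shows "chart_at M p \<in> atlas M" "p \<in> fst (chart_at M p)"
proof -
  have "\<exists>c. c \<in> atlas M \<and> p \<in> fst c" using assms unfolding atlas_cover[symmetric] by blast
  from someI_ex[OF this] show "chart_at M p \<in> atlas M" "p \<in> fst (chart_at M p)"
    by (auto simp: chart_at_def)
qed

lemma chart_dom_open: "c \<in> atlas M \<Longrightarrow> openin (mtop M) (fst c)"
  and chart_range_open: "c \<in> atlas M \<Longrightarrow> open (snd c ` fst c)"
  using is_chart_atlas by (auto simp: is_chart_def)

lemma chart_dom_pts: "c \<in> atlas M \<Longrightarrow> p \<in> fst c \<Longrightarrow> p \<in> pts M"
  using atlas_cover by auto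

lemma chart_inj: "c \<in> atlas M \<Longrightarrow> inj_on (snd c) (fst c)"
proof -
  assume c: "c \<in> atlas M"
  have "topspace (subtopology (mtop M) (fst c)) = fst c"
    using openin_subset[OF chart_dom_open[OF c]] by (simp add: Int_absorb1)
  then show ?thesis
    using homeomorphic_imp_injective_map is_chart_atlas[OF c] unfolding is_chart_def by metis
qed

lemma chart_inv_left [simp]: "c \<in> atlas M \<Longrightarrow> p \<in> fst c \<Longrightarrow> chart_inv c (snd c p) = p"
  by (simp add: chart_inv_def chart_inj)

lemma chart_inv_right [simp]: "z \<in> snd c ` fst c \<Longrightarrow> snd c (chart_inv c z) = z"
  by (simp add: chart_inv_def f_inv_into_f)

lemma chart_inv_dom [simp]: "z \<in> snd c ` fst c \<Longrightarrow> chart_inv c z \<in> fst c"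
  by (simp add: chart_inv_def inv_into_into)

lemma chart_cont: "c \<in> atlas M \<Longrightarrow> continuous_map (subtopology (mtop M) (fst c)) euclidean (snd c)"
  using homeomorphic_imp_continuous_map is_chart_atlas unfolding is_chart_def
  by (metis continuous_map_in_subtopology)

lemma chart_inv_cont: "c \<in> atlas M \<Longrightarrow> continuous_map (top_of_set (snd c ` fst c)) (mtop M) (chart_inv c)"
proof -
  assume c: "c \<in> atlas M"
  have t: "topspace (subtopology (mtop M) (fst c)) = fst c"
    using openin_subset[OF chart_dom_open[OF c]] by (simp add: Int_absorb1)
  obtain g where g: "homeomorphic_maps (subtopology (mtop M) (fst c)) (top_of_set (snd c ` fst c)) (snd c) g"
    using is_chart_atlas[OF c] unfolding is_chart_def homeomorphic_map_maps by auto
  then have e: "g z = chart_inv c z" if "z \<in> snd c ` fst c" for z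
    using that c t by (auto simp: homeomorphic_maps_def)
  have "continuous_map (top_of_set (snd c ` fst c)) (mtop M) g"
    using g by (simp add: homeomorphic_maps_def continuous_map_in_subtopology)
  then show ?thesis by (rule continuous_map_eq) (simp add: e)
qed

lemma chart_preimage_open:
  assumes c: "c \<in> atlas M" and "open U" shows "openin (mtop M) {p \<in> fst c. snd c p \<in> U}"
proof -
  have "openin (subtopology (mtop M) (fst c)) {p \<in> topspace (subtopology (mtop M) (fst c)). snd c p \<in> U}"
    using assms(2) by (intro openin_continuous_map_preimage[OF chart_cont[OF c]]) auto
  moreover have "topspace (subtopology (mtop M) (fst c)) = fst c"
    using openin_subset[OF chart_dom_open[OF c]] by (simp add: Int_absorb1)
  ultimately show ?thesis using openin_trans_full chart_dom_open[OF c] by metis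
qed

lemma chart_closed_preimage:
  assumes c: "c \<in> atlas M" and K: "compact K" "K \<subseteq> snd c ` fst c"
  shows "closedin (mtop M) {p \<in> fst c. snd c p \<in> K}"
proof -
  have "compactin (top_of_set (snd c ` fst c)) K" using K by (simp add: compactin_subtopology)
  then have "compactin (mtop M) (chart_inv c ` K)"
    using image_compactin chart_inv_cont[OF c] by metis
  moreover have "chart_inv c ` K = {p \<in> fst c. snd c p \<in> K}"
  proof (intro equalityI subsetI)
    fix p assume "p \<in> {p \<in> fst c. snd c p \<in> K}"
    then show "p \<in> chart_inv c ` K" using c by (intro image_eqI[of _ _ "snd c p"]) auto
  next
    fix p assume "p \<in> chart_inv c ` K"
    then obtain z where "z \<in> K" "p = chart_inv c z" by blast
    moreover then have "z \<in> snd c ` fst c" using K by blast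
    ultimately show "p \<in> {p \<in> fst c. snd c p \<in> K}" by (simp only: mem_Collect_eq chart_inv_dom chart_inv_right simp_thms)
  qed
  ultimately show ?thesis using compactin_imp_closedin Hausdorff_M by metis
qed

lemma transition_deriv:
  assumes "c \<in> atlas M" "d \<in> atlas M" "p \<in> fst c" "p \<in> fst d"
  shows "(transition c d has_derivative coord_change c d p) (at (snd c p))"
proof -
  have "Ck_on 1 (transition c d) (snd c ` (fst c \<inter> fst d))"
    using transition_smooth[OF assms(1,2)] unfolding smooth_on_def by blast
  then show ?thesis
    using assms unfolding coord_change_def by (auto simp: frechet_derivative_works[symmetric])
qed

lemma riem_change:
  assumes "c \<in> atlas M" "d \<in> atlas M" "p \<in> fst c" "p \<in> fst d"
  shows "riem M d p (coord_change c d p v) (coord_change c d p w) = riem M c p v w"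
  using closed assms unfolding closed_riem_manifold_def riemannian_metric_def by blast

lemma riem_bilinear: "c \<in> atlas M \<Longrightarrow> p \<in> fst c \<Longrightarrow> bilinear (riem M c p)"
  and riem_pos: "c \<in> atlas M \<Longrightarrow> p \<in> fst c \<Longrightarrow> v \<noteq> 0 \<Longrightarrow> riem M c p v v > 0"
  and riem_smooth: "c \<in> atlas M \<Longrightarrow> smooth_on (\<lambda>z. riem M c (chart_inv c z) v w) (snd c ` fst c)"
  using closed unfolding closed_riem_manifold_def riemannian_metric_def by blast+

lemma riem_ge0: "c \<in> atlas M \<Longrightarrow> p \<in> fst c \<Longrightarrow> riem M c p v v \<ge> 0"
  using riem_pos[of c p v] riem_bilinear[of c p] by (cases "v = 0") (auto simp: bilinear_lzero)

text \<open>Smoothness is assumed for fixed vectors only; the expansion in a basis turns it into joint continuity in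
  the point and the vector.\<close>

lemma riem_expand:
  assumes "c \<in> atlas M" "p \<in> fst c"
  shows "riem M c p v w = (\<Sum>i\<in>Basis. \<Sum>j\<in>Basis. (v \<bullet> i) * (w \<bullet> j) * riem M c p i j)"
proof -
  have b: "bilinear (riem M c p)" by (rule riem_bilinear[OF assms])
  have "riem M c p v w = riem M c p (\<Sum>i\<in>Basis. (v \<bullet> i) *\<^sub>R i) (\<Sum>j\<in>Basis. (w \<bullet> j) *\<^sub>R j)"
    by (simp add: euclidean_representation)
  also have "\<dots> = (\<Sum>i\<in>Basis. \<Sum>j\<in>Basis. riem M c p ((v \<bullet> i) *\<^sub>R i) ((w \<bullet> j) *\<^sub>R j))"
    using b by (simp add: bilinear_sum sum.cartesian_product)
  finally show ?thesis using b by (simp add: bilinear_lmul bilinear_rmul mult.assoc)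
qed

lemma riem_chart_cont:
  assumes c: "c \<in> atlas M"
  shows "continuous_on (snd c ` fst c \<times> UNIV) (\<lambda>(z, v). riem M c (chart_inv c z) v v)"
proof -
  have 1: "continuous_on (snd c ` fst c) (\<lambda>z. riem M c (chart_inv c z) i j)" for i j
  proof -
    have "Ck_on 0 (\<lambda>z. riem M c (chart_inv c z) i j) (snd c ` fst c)"
      using riem_smooth[OF c] unfolding smooth_on_def by blast
    then show ?thesis by simp
  qed
  have 2: "continuous_on (snd c ` fst c \<times> UNIV) (\<lambda>x. riem M c (chart_inv c (fst x)) i j)" for i j
    by (rule continuous_on_compose2[OF 1]) (auto intro: continuous_intros)
  have "continuous_on (snd c ` fst c \<times> UNIV)
     (\<lambda>x. \<Sum>i\<in>Basis. \<Sum>j\<in>Basis. (snd x \<bullet> i) * (snd x \<bullet> j) * riem M c (chart_inv c (fst x)) i j)"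
    by (intro continuous_intros 2)
  then show ?thesis
    by (rule continuous_on_eq) (auto simp: riem_expand[OF c] simp del: chart_inv_left)
qed

lemma tnorm_chart:
  assumes "c \<in> atlas M" "p \<in> fst c"
  shows "tnorm M p (coord_change c (chart_at M p) p v) = sqrt (riem M c p v v)"
  unfolding tnorm_def using assms chart_at[OF chart_dom_pts[OF assms]] by (simp add: riem_change)

text \<open>Coordinate balls on which the Riemannian norm and the Euclidean norm of the chart bound each other. All
  later estimates are carried out in such balls.\<close>

definition good_ball :: "('a, 'e) chart \<Rightarrow> 'e \<Rightarrow> real \<Rightarrow> real \<Rightarrow> real \<Rightarrow> bool" where
  "good_ball c z r k C \<longleftrightarrow> c \<in> atlas M \<and> 0 < r \<and> 0 < k \<and> 0 < C \<and> cball z r \<subseteq> snd c ` fst c \<and>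
     (\<forall>w\<in>cball z r. \<forall>v. k * norm v \<le> sqrt (riem M c (chart_inv c w) v v) \<and>
        sqrt (riem M c (chart_inv c w) v v) \<le> C * norm v)"

text \<open>By homogeneity it suffices to bound the metric on unit vectors over a closed coordinate ball, which is a
  compact set.\<close>

lemma good_ball_exists:
  assumes c: "c \<in> atlas M" and p: "p \<in> fst c"
  shows "\<exists>r k C. good_ball c (snd c p) r k C"
proof -
  let ?z = "snd c p"
  obtain r where r: "r > 0" "cball ?z r \<subseteq> snd c ` fst c"
    using chart_range_open[OF c] p open_contains_cball by blast
  let ?S = "cball ?z r \<times> sphere (0::'e) 1"
  let ?f = "\<lambda>x. riem M c (chart_inv c (fst x)) (snd x) (snd x)"
  obtain b :: 'e where b: "b \<in> Basis" using nonempty_Basis by blast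
  have ne: "?S \<noteq> {}" using r b by (auto intro: exI[of _ b])
  have cS: "compact ?S" by (intro compact_Times) auto
  have cf: "continuous_on ?S ?f"
  proof (rule continuous_on_subset)
    show "continuous_on (snd c ` fst c \<times> UNIV) ?f" using riem_chart_cont[OF c] by (simp only: case_prod_unfold)
    show "?S \<subseteq> snd c ` fst c \<times> UNIV" using r by blast
  qed
  obtain x1 where x1: "x1 \<in> ?S" "\<And>x. x \<in> ?S \<Longrightarrow> ?f x1 \<le> ?f x"
    using continuous_attains_inf[OF cS ne cf] by blast
  obtain x2 where x2: "x2 \<in> ?S" "\<And>x. x \<in> ?S \<Longrightarrow> ?f x \<le> ?f x2"
    using continuous_attains_sup[OF cS ne cf] by blast
  have inS: "snd x \<noteq> 0" "fst x \<in> snd c ` fst c" if "x \<in> ?S" for x using that r by auto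
  have pos: "?f x > 0" if "x \<in> ?S" for x
    using inS[OF that] by (intro riem_pos[OF c]) auto
  have sc: "sqrt (riem M c (chart_inv c w) v v) = norm v * sqrt (?f (w, v /\<^sub>R norm v))"
    if "w \<in> cball ?z r" "v \<noteq> 0" for w v
  proof -
    have "w \<in> snd c ` fst c" using that r by auto
    then have bl: "bilinear (riem M c (chart_inv c w))" using c by (intro riem_bilinear) auto
    have "riem M c (chart_inv c w) v v = riem M c (chart_inv c w) (norm v *\<^sub>R (v /\<^sub>R norm v)) (norm v *\<^sub>R (v /\<^sub>R norm v))"
      using that by simp
    also have "\<dots> = (norm v)\<^sup>2 * ?f (w, v /\<^sub>R norm v)"
      using bl by (simp only: bilinear_lmul bilinear_rmul fst_conv snd_conv) (simp add: power2_eq_square)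
    finally show ?thesis by (simp add: real_sqrt_mult)
  qed
  have "good_ball c ?z r (sqrt (?f x1)) (sqrt (?f x2))"
    unfolding good_ball_def
  proof (intro conjI ballI allI)
    fix w v assume w: "w \<in> cball ?z r"
    have wS: "(w, v /\<^sub>R norm v) \<in> ?S" if "v \<noteq> 0" using w that by auto
    show "sqrt (?f x1) * norm v \<le> sqrt (riem M c (chart_inv c w) v v)"
    proof (cases "v = 0")
      case False
      show ?thesis unfolding sc[OF w False] using x1(2)[OF wS[OF False]] by (simp add: mult.commute mult_left_mono)
    qed (use w r c in \<open>auto intro!: riem_ge0\<close>)
    show "sqrt (riem M c (chart_inv c w) v v) \<le> sqrt (?f x2) * norm v"
    proof (cases "v = 0")
      case True
      have "bilinear (riem M c (chart_inv c w))" using w r c by (intro riem_bilinear) auto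
      then show ?thesis using True by (simp add: bilinear_lzero)
    next
      case False
      show ?thesis unfolding sc[OF w False] using x2(2)[OF wS[OF False]] by (simp add: mult.commute mult_left_mono)
    qed
  qed (use r c pos x1 x2 in auto)
  then show ?thesis by blast
qed

end

section \<open>Lengths of piecewise smooth curves\<close>

lemma continuous_map_real_iff:
  fixes \<gamma> :: "real \<Rightarrow> 'a"
  shows "continuous_map (top_of_set I) T \<gamma> \<longleftrightarrow> (\<forall>t\<in>I. limitin T \<gamma> (\<gamma> t) (at t within I))"
proof -
  have "limitin T \<gamma> (\<gamma> t) (atin (top_of_set I) t) \<longleftrightarrow> limitin T \<gamma> (\<gamma> t) (at t within I)" if tI: "t \<in> I" for t
  proof -
    have "eventually P (atin (top_of_set I) t) \<longleftrightarrow> eventually P (at t within I)" for P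
    proof
      assume "eventually P (atin (top_of_set I) t)"
      then obtain U where U: "openin (top_of_set I) U" "t \<in> U" "\<forall>x\<in>U-{t}. P x"
        using tI by (auto simp: eventually_atin)
      then obtain W where W: "open W" "U = I \<inter> W" by (auto simp: openin_open)
      show "eventually P (at t within I)"
        unfolding eventually_at_topological by (intro exI[of _ W]) (use U W in auto)
    next
      assume "eventually P (at t within I)"
      then obtain W where W: "open W" "t \<in> W" "\<forall>x\<in>W. x \<noteq> t \<longrightarrow> x \<in> I \<longrightarrow> P x"
        by (auto simp: eventually_at_topological)
      have "openin (top_of_set I) (I \<inter> W)" using W by auto
      then show "eventually P (atin (top_of_set I) t)"
        unfolding eventually_atin using W tI by (intro disjI2 exI[of _ "I \<inter> W"]) auto
    qed
    then show ?thesis by (simp add: limitin_def)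
  qed
  then show ?thesis by (auto simp: continuous_map_atin)
qed

lemma C1_curve_on_cong:
  assumes "C1_curve_on M a b \<gamma>" "\<And>t. t \<in> {a..b} \<Longrightarrow> \<gamma> t = \<gamma>' t"
  shows "C1_curve_on M a b \<gamma>'"
  unfolding C1_curve_on_def
proof (intro conjI ballI)
  show "continuous_map (top_of_set {a..b}) (mtop M) \<gamma>'"
    using assms unfolding C1_curve_on_def by (auto intro: continuous_map_eq)
  fix c assume "c \<in> atlas M"
  then obtain D where D: "continuous_on {t\<in>{a..b}. \<gamma> t \<in> fst c} D"
    "\<forall>t\<in>{a..b}. \<gamma> t \<in> fst c \<longrightarrow> ((snd c \<circ> \<gamma>) has_vector_derivative D t) (at t within {a..b})"
    using assms(1) unfolding C1_curve_on_def by blast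
  have e: "{t\<in>{a..b}. \<gamma>' t \<in> fst c} = {t\<in>{a..b}. \<gamma> t \<in> fst c}" using assms(2) by auto
  show "\<exists>D. continuous_on {t\<in>{a..b}. \<gamma>' t \<in> fst c} D \<and>
        (\<forall>t\<in>{a..b}. \<gamma>' t \<in> fst c \<longrightarrow> ((snd c \<circ> \<gamma>') has_vector_derivative D t) (at t within {a..b}))"
  proof (intro exI conjI ballI impI)
    show "continuous_on {t\<in>{a..b}. \<gamma>' t \<in> fst c} D" unfolding e by (rule D)
    fix t assume "t \<in> {a..b}" "\<gamma>' t \<in> fst c"
    then have "((snd c \<circ> \<gamma>) has_vector_derivative D t) (at t within {a..b})" using D assms(2) by auto
    then show "((snd c \<circ> \<gamma>') has_vector_derivative D t) (at t within {a..b})"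
      by (rule has_vector_derivative_transform[OF \<open>t \<in> _\<close>, rotated]) (auto simp: assms(2))
  qed
qed

lemma C1_curve_on_affine:
  assumes C: "C1_curve_on M a' b' \<gamma>" and sub: "(\<lambda>t. m * t + q) ` {a..b} \<subseteq> {a'..b'}"
  shows "C1_curve_on M a b (\<lambda>t. \<gamma> (m * t + q))"
  unfolding C1_curve_on_def
proof (intro conjI ballI)
  have ca: "continuous_map (top_of_set {a..b}) (top_of_set {a'..b'}) (\<lambda>t. m * t + q)"
    using sub by (auto intro!: continuous_intros)
  show "continuous_map (top_of_set {a..b}) (mtop M) (\<lambda>t. \<gamma> (m * t + q))"
    using continuous_map_compose[OF ca] C unfolding C1_curve_on_def by (auto simp: o_def)
  fix c assume "c \<in> atlas M"
  then obtain D where D: "continuous_on {t\<in>{a'..b'}. \<gamma> t \<in> fst c} D"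
    "\<forall>t\<in>{a'..b'}. \<gamma> t \<in> fst c \<longrightarrow> ((snd c \<circ> \<gamma>) has_vector_derivative D t) (at t within {a'..b'})"
    using C unfolding C1_curve_on_def by blast
  show "\<exists>D. continuous_on {t\<in>{a..b}. \<gamma> (m * t + q) \<in> fst c} D \<and>
        (\<forall>t\<in>{a..b}. \<gamma> (m * t + q) \<in> fst c \<longrightarrow>
           ((snd c \<circ> (\<lambda>t. \<gamma> (m * t + q))) has_vector_derivative D t) (at t within {a..b}))"
  proof (intro exI[of _ "\<lambda>t. m *\<^sub>R D (m * t + q)"] conjI ballI impI)
    show "continuous_on {t\<in>{a..b}. \<gamma> (m * t + q) \<in> fst c} (\<lambda>t. m *\<^sub>R D (m * t + q))"
      by (intro continuous_intros continuous_on_compose2[OF D(1)]) (use sub in \<open>auto simp: image_subset_iff\<close>)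
    fix t assume t: "t \<in> {a..b}" "\<gamma> (m * t + q) \<in> fst c"
    have 1: "((\<lambda>t. m * t + q) has_vector_derivative m) (at t within {a..b})"
      by (auto intro!: derivative_eq_intros)
    have "((snd c \<circ> \<gamma>) has_vector_derivative D (m * t + q)) (at (m * t + q) within {a'..b'})"
    proof -
      have "m * t + q \<in> {a'..b'}" using sub t(1) by (auto simp: image_subset_iff)
      then show ?thesis using D(2) t(2) by blast
    qed
    then have "((snd c \<circ> \<gamma>) has_vector_derivative D (m * t + q)) (at (m * t + q) within (\<lambda>t. m * t + q) ` {a..b})"
      using sub has_vector_derivative_within_subset by blast
    from vector_diff_chain_within[OF 1 this]
    show "((snd c \<circ> (\<lambda>t. \<gamma> (m * t + q))) has_vector_derivative m *\<^sub>R D (m * t + q)) (at t within {a..b})"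
      by (simp add: o_def)
  qed
qed

lemma C1_curve_on_subset:
  "C1_curve_on M a b \<gamma> \<Longrightarrow> a \<le> a' \<Longrightarrow> b' \<le> b \<Longrightarrow> C1_curve_on M a' b' \<gamma>"
  using C1_curve_on_affine[of M a b \<gamma> 1 0 a' b'] by auto

lemma C1_curve_on_limitin:
  "C1_curve_on M a b \<gamma> \<Longrightarrow> t \<in> {a..b} \<Longrightarrow> limitin (mtop M) \<gamma> (\<gamma> t) (at t within {a..b})"
  unfolding C1_curve_on_def continuous_map_real_iff by blast

lemma piecewise_C1E:
  assumes "piecewise_C1_curve M \<gamma>"
  obtains S where "finite S" "{0, 1} \<subseteq> S" "S \<subseteq> {0..1}"
    "\<And>a b. a\<in>S \<Longrightarrow> b\<in>S \<Longrightarrow> a < b \<Longrightarrow> {a<..<b} \<inter> S = {} \<Longrightarrow> C1_curve_on M a b \<gamma>"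
proof -
  from assms obtain S where S: "finite S \<and> {0, 1} \<subseteq> S \<and> S \<subseteq> {0..1} \<and>
        (\<forall>a\<in>S. \<forall>b\<in>S. a < b \<and> {a<..<b} \<inter> S = {} \<longrightarrow> C1_curve_on M a b \<gamma>)"
    unfolding piecewise_C1_curve_def by (rule exE)
  show thesis by (rule that[of S]) (use S in auto)
qed

lemma piecewise_C1_pieces:
  assumes "piecewise_C1_curve M \<gamma>"
  shows "0 \<le> t \<Longrightarrow> t < 1 \<Longrightarrow> \<exists>b. t < b \<and> b \<le> 1 \<and> C1_curve_on M t b \<gamma>"
    and "0 < t \<Longrightarrow> t \<le> 1 \<Longrightarrow> \<exists>a. 0 \<le> a \<and> a < t \<and> C1_curve_on M a t \<gamma>"
proof -
  obtain S where S: "finite S" "{0, 1} \<subseteq> S" "S \<subseteq> {0..1}"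
    "\<And>a b. a\<in>S \<Longrightarrow> b\<in>S \<Longrightarrow> a < b \<Longrightarrow> {a<..<b} \<inter> S = {} \<Longrightarrow> C1_curve_on M a b \<gamma>"
    by (rule piecewise_C1E[OF assms]) (rule that, assumption+)
  { assume t: "0 \<le> t" "t < 1"
    define a where "a = Max {s\<in>S. s \<le> t}"
    define b where "b = Min {s\<in>S. s > t}"
    have a: "a \<in> {s\<in>S. s \<le> t}" unfolding a_def by (rule Max_in) (use S t in auto)
    have b: "b \<in> {s\<in>S. s > t}" unfolding b_def by (rule Min_in) (use S t in auto)
    have "s \<le> a" if "s \<in> S" "s \<le> t" for s unfolding a_def by (rule Max_ge) (use S that in auto)
    moreover have "b \<le> s" if "s \<in> S" "s > t" for s unfolding b_def by (rule Min_le) (use S that in auto)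
    ultimately have "{a<..<b} \<inter> S = {}" by fastforce
    then have "C1_curve_on M a b \<gamma>" using S(4) a b by auto
    then have "C1_curve_on M t b \<gamma>" by (rule C1_curve_on_subset) (use a in auto)
    then show "\<exists>b. t < b \<and> b \<le> 1 \<and> C1_curve_on M t b \<gamma>" using b S(3) by (intro exI[of _ b]) auto }
  { assume t: "0 < t" "t \<le> 1"
    define a where "a = Max {s\<in>S. s < t}"
    define b where "b = Min {s\<in>S. s \<ge> t}"
    have a: "a \<in> {s\<in>S. s < t}" unfolding a_def by (rule Max_in) (use S t in auto)
    have b: "b \<in> {s\<in>S. s \<ge> t}" unfolding b_def by (rule Min_in) (use S t in auto)
    have "s \<le> a" if "s \<in> S" "s < t" for s unfolding a_def by (rule Max_ge) (use S that in auto)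
    moreover have "b \<le> s" if "s \<in> S" "s \<ge> t" for s unfolding b_def by (rule Min_le) (use S that in auto)
    ultimately have "{a<..<b} \<inter> S = {}" by fastforce
    then have "C1_curve_on M a b \<gamma>" using S(4) a b by auto
    then have "C1_curve_on M a t \<gamma>" by (rule C1_curve_on_subset) (use b in auto)
    then show "\<exists>a. 0 \<le> a \<and> a < t \<and> C1_curve_on M a t \<gamma>" using a S(3) by (intro exI[of _ a]) auto }
qed

lemma piecewise_C1_continuous:
  assumes g: "piecewise_C1_curve M \<gamma>"
  shows "continuous_map (top_of_set {0..1}) (mtop M) \<gamma>"
  unfolding continuous_map_real_iff
proof
  fix t :: real assume t: "t \<in> {0..1}"
  have R: "limitin (mtop M) \<gamma> (\<gamma> t) (at t within {t..1}) \<and> \<gamma> t \<in> pts M" if lt: "t < 1"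
  proof -
    obtain b where b: "t < b" "b \<le> 1" "C1_curve_on M t b \<gamma>" using piecewise_C1_pieces(1)[OF g, of t] t lt by auto
    have "at t within {t..b} = at t within {t..1}"
      by (rule at_within_nhd[of t "{..<b}"]) (use b in auto)
    then show ?thesis using C1_curve_on_limitin[OF b(3), of t] b limitin_topspace by fastforce
  qed
  have L: "limitin (mtop M) \<gamma> (\<gamma> t) (at t within {0..t}) \<and> \<gamma> t \<in> pts M" if lt: "0 < t"
  proof -
    obtain a where a: "0 \<le> a" "a < t" "C1_curve_on M a t \<gamma>" using piecewise_C1_pieces(2)[OF g, of t] t lt by auto
    have "at t within {a..t} = at t within {0..t}"
      by (rule at_within_nhd[of t "{a<..}"]) (use a in auto)
    then show ?thesis using C1_curve_on_limitin[OF a(3), of t] a limitin_topspace by fastforce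
  qed
  have p: "\<gamma> t \<in> pts M" using L R t by fastforce
  have R': "limitin (mtop M) \<gamma> (\<gamma> t) (at t within {t..1})"
    using R t p by (cases "t = 1") (auto simp: limitin_def at_within_def)
  have L': "limitin (mtop M) \<gamma> (\<gamma> t) (at t within {0..t})"
    using L t p by (cases "t = 0") (auto simp: limitin_def at_within_def)
  have "{0..1} = {0..t} \<union> {t..1}" using t by auto
  then have "at t within {0..1} = sup (at t within {0..t}) (at t within {t..1})"
    using at_within_union by metis
  then show "limitin (mtop M) \<gamma> (\<gamma> t) (at t within {0..1})"
    using R' L' by (simp add: limitin_def eventually_sup)
qed

context closed_rmanifold
begin

text \<open>\<open>curve_speed\<close> is computed in the chart chosen by \<open>chart_at\<close>, which changes erratically along the curve.
  Invariance of the metric allows any chart to be used instead.\<close>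

lemma deriv_change:
  assumes lim: "limitin (mtop M) \<gamma> (\<gamma> t) (at t within I)" and cd: "c \<in> atlas M" "d \<in> atlas M"
    and p: "\<gamma> t \<in> fst c" "\<gamma> t \<in> fst d" "t \<in> I"
    and v: "((snd c \<circ> \<gamma>) has_vector_derivative v) (at t within I)"
  shows "((snd d \<circ> \<gamma>) has_vector_derivative coord_change c d (\<gamma> t) v) (at t within I)"
proof -
  have 1: "((transition c d \<circ> (snd c \<circ> \<gamma>)) has_vector_derivative coord_change c d (\<gamma> t) v) (at t within I)"
    by (rule vector_derivative_diff_chain_within[OF v])
      (simp add: transition_deriv[OF cd p(1,2)] has_derivative_at_withinI)
  have "eventually (\<lambda>s. \<gamma> s \<in> fst c) (at t within I)"
    using lim p chart_dom_open[OF cd(1)] unfolding limitin_def by blast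
  then obtain e where e: "e > 0" "\<forall>s\<in>I. s \<noteq> t \<and> dist s t < e \<longrightarrow> \<gamma> s \<in> fst c"
    unfolding eventually_at by blast
  show ?thesis
    by (rule has_vector_derivative_transform_within[OF 1 e(1) p(3)])
      (use e p cd in \<open>force simp: transition_def\<close>)
qed

lemma speed_in_chart:
  assumes "a < b" "t \<in> {a..b}" and lim: "limitin (mtop M) \<gamma> (\<gamma> t) (at t within {a..b})"
    and c: "c \<in> atlas M" "\<gamma> t \<in> fst c"
    and v: "((snd c \<circ> \<gamma>) has_vector_derivative v) (at t within {a..b})"
  shows "tnorm M (\<gamma> t) (vector_derivative (snd (chart_at M (\<gamma> t)) \<circ> \<gamma>) (at t within {a..b})) =
    sqrt (riem M c (\<gamma> t) v v)"
proof -
  note d = chart_at[OF chart_dom_pts[OF c]]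
  have "vector_derivative (snd (chart_at M (\<gamma> t)) \<circ> \<gamma>) (at t within {a..b}) =
      coord_change c (chart_at M (\<gamma> t)) (\<gamma> t) v"
    by (rule vector_derivative_within_closed_interval[OF assms(1,2)])
      (rule deriv_change[OF lim c(1) d(1) c(2) d(2) assms(2) v])
  then show ?thesis by (simp add: tnorm_chart[OF c])
qed

lemma C1_speed_continuous:
  assumes C: "C1_curve_on M a b \<gamma>" and ab: "a < b"
  shows "continuous_on {a..b}
    (\<lambda>t. tnorm M (\<gamma> t) (vector_derivative (snd (chart_at M (\<gamma> t)) \<circ> \<gamma>) (at t within {a..b})))"
    (is "continuous_on _ ?g")
  unfolding continuous_on_eq_continuous_within
proof
  fix t0 assume t0: "t0 \<in> {a..b}"
  have gc: "continuous_map (top_of_set {a..b}) (mtop M) \<gamma>" using C by (simp add: C1_curve_on_def)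
  have p0: "\<gamma> t0 \<in> pts M" using gc t0 by (auto simp: continuous_map_def)
  define c where "c = chart_at M (\<gamma> t0)"
  have c: "c \<in> atlas M" "\<gamma> t0 \<in> fst c" using chart_at[OF p0] by (auto simp: c_def)
  define W where "W = {t\<in>{a..b}. \<gamma> t \<in> fst c}"
  obtain D where D: "continuous_on W D"
    "\<And>t. t\<in>W \<Longrightarrow> ((snd c \<circ> \<gamma>) has_vector_derivative D t) (at t within {a..b})"
    using C c unfolding C1_curve_on_def W_def by blast
  have Wop: "openin (top_of_set {a..b}) W"
    using openin_continuous_map_preimage[OF gc chart_dom_open[OF c(1)]] by (simp add: W_def)
  have cc: "continuous_on W (\<lambda>t. snd c (\<gamma> t))"
    unfolding continuous_on_eq_continuous_within
  proof
    fix t assume "t \<in> W"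
    then have "continuous (at t within {a..b}) (snd c \<circ> \<gamma>)"
      using has_vector_derivative_continuous D(2) by blast
    then show "continuous (at t within W) (\<lambda>t. snd c (\<gamma> t))"
      by (auto simp: o_def W_def intro: continuous_within_subset)
  qed
  have "continuous_on W (\<lambda>t. (\<lambda>(z, v). riem M c (chart_inv c z) v v) (snd c (\<gamma> t), D t))"
  proof (rule continuous_on_compose2[OF riem_chart_cont[OF c(1)]])
    show "continuous_on W (\<lambda>t. (snd c (\<gamma> t), D t))" by (intro continuous_on_Pair cc D(1))
  qed (auto simp: W_def)
  then have "continuous_on W (\<lambda>t. riem M c (\<gamma> t) (D t) (D t))"
    by (rule continuous_on_eq) (use c in \<open>simp add: W_def\<close>)
  then have "continuous_on W (\<lambda>t. sqrt (riem M c (\<gamma> t) (D t) (D t)))"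
    by (rule continuous_on_real_sqrt)
  then have "continuous_on W ?g"
  proof (rule continuous_on_eq)
    fix t assume t: "t \<in> W"
    then have "t \<in> {a..b}" "\<gamma> t \<in> fst c" by (auto simp: W_def)
    then show "sqrt (riem M c (\<gamma> t) (D t) (D t)) = ?g t"
      using speed_in_chart[OF ab _ C1_curve_on_limitin[OF C] c(1) _ D(2)[OF t]] by simp
  qed
  then have 1: "continuous (at t0 within W) ?g"
    using t0 c by (auto simp: continuous_on_eq_continuous_within W_def)
  obtain O' where O: "open O'" "W = {a..b} \<inter> O'" using Wop by (auto simp: openin_open)
  have "at t0 within W = at t0 within {a..b}"
    by (rule at_within_nhd[of t0 O']) (use O t0 c in \<open>auto simp: W_def\<close>)
  then show "continuous (at t0 within {a..b}) ?g" using 1 by (simp add: continuous_within)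
qed

lemma C1_speed_integrable:
  assumes C: "C1_curve_on M a b \<gamma>" and ab: "a \<le> b" "0 \<le> a" "b \<le> 1"
  shows "curve_speed M \<gamma> integrable_on {a..b}"
proof (cases "a = b")
  case False
  then have ab': "a < b" using ab by simp
  show ?thesis
  proof (rule integrable_spike_finite[of "{a,b}"])
    show "(\<lambda>t. tnorm M (\<gamma> t) (vector_derivative (snd (chart_at M (\<gamma> t)) \<circ> \<gamma>) (at t within {a..b}))) integrable_on {a..b}"
      by (rule integrable_continuous_interval[OF C1_speed_continuous[OF C ab']])
    fix t assume "t \<in> {a..b} - {a,b}"
    then have "at t within {a..b} = at t" "at t within {0..1} = at t"
      using ab by (auto intro!: at_within_Icc_at)
    then show "curve_speed M \<gamma> t =
        tnorm M (\<gamma> t) (vector_derivative (snd (chart_at M (\<gamma> t)) \<circ> \<gamma>) (at t within {a..b}))"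
      by (simp add: curve_speed_def)
  qed auto
next
  case True
  then show ?thesis using integrable_on_refl[of "curve_speed M \<gamma>" b] by simp
qed

text \<open>The integral of a function that is not integrable is zero by convention, so this has to be known before a
  length bounds anything.\<close>

lemma curve_speed_integrable:
  assumes g: "piecewise_C1_curve M \<gamma>"
  shows "curve_speed M \<gamma> integrable_on {0..1}"
proof -
  have refl: "curve_speed M \<gamma> integrable_on {u..v}" if "u = v" for u v :: real
    using integrable_on_refl[of "curve_speed M \<gamma>" v] that by simp
  have "\<exists>d>0. \<forall>u v. x \<in> cbox u v \<and> cbox u v \<subseteq> ball x d \<and> cbox u v \<subseteq> cbox 0 1 \<longrightarrow>
      curve_speed M \<gamma> integrable_on cbox u v" if x: "x \<in> {0..1}" for x :: real
  proof -
    have R: "\<exists>d>0. \<forall>v. x \<le> v \<and> v < x + d \<and> v \<le> 1 \<longrightarrow> curve_speed M \<gamma> integrable_on {x..v}"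
    proof (cases "x = 1")
      case False
      then obtain b where b: "x < b" "b \<le> 1" "C1_curve_on M x b \<gamma>"
        using piecewise_C1_pieces(1)[OF g, of x] x False by auto
      show ?thesis
        by (rule exI[of _ "b - x"])
          (use b x in \<open>auto intro!: C1_speed_integrable C1_curve_on_subset[OF b(3)]\<close>)
    qed (auto intro!: exI[of _ 1] refl)
    have L: "\<exists>d>0. \<forall>u. u \<le> x \<and> x - d < u \<and> 0 \<le> u \<longrightarrow> curve_speed M \<gamma> integrable_on {u..x}"
    proof (cases "x = 0")
      case False
      then obtain a where a: "0 \<le> a" "a < x" "C1_curve_on M a x \<gamma>"
        using piecewise_C1_pieces(2)[OF g, of x] x False by auto
      show ?thesis
        by (rule exI[of _ "x - a"])
          (use a x in \<open>auto intro!: C1_speed_integrable C1_curve_on_subset[OF a(3)]\<close>)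
    qed (auto intro!: exI[of _ 1] refl)
    obtain d1 where d1: "d1 > 0" "\<And>v. x \<le> v \<and> v < x + d1 \<and> v \<le> 1 \<Longrightarrow> curve_speed M \<gamma> integrable_on {x..v}"
      using R by blast
    obtain d2 where d2: "d2 > 0" "\<And>u. u \<le> x \<and> x - d2 < u \<and> 0 \<le> u \<Longrightarrow> curve_speed M \<gamma> integrable_on {u..x}"
      using L by blast
    show ?thesis
    proof (intro exI[of _ "min d1 d2"] conjI allI impI)
      fix u v assume H: "x \<in> cbox u v \<and> cbox u v \<subseteq> ball x (min d1 d2) \<and> cbox u v \<subseteq> cbox 0 1"
      then have uv: "u \<le> x" "x \<le> v" by auto
      then have "u \<in> cbox u v" "v \<in> cbox u v" by auto
      then have "u \<in> ball x (min d1 d2)" "v \<in> ball x (min d1 d2)" "u \<in> cbox 0 1" "v \<in> cbox 0 1" using H by blast+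
      then have "x - d2 < u" "0 \<le> u" "v < x + d1" "v \<le> 1" by (auto simp: dist_real_def)
      then show "curve_speed M \<gamma> integrable_on cbox u v"
        using Henstock_Kurzweil_Integration.integrable_combine[OF uv] d1(2)[of v] d2(2)[of u] uv by auto
    qed (use d1 d2 in auto)
  qed
  then have "curve_speed M \<gamma> integrable_on cbox 0 1"
    by (intro integrable_on_little_subintervals) auto
  then show ?thesis by simp
qed

lemma piecewise_C1_deriv:
  assumes g: "piecewise_C1_curve M \<gamma>"
  obtains S where "finite S" "\<And>t c. t \<in> {0<..<1} - S \<Longrightarrow> c \<in> atlas M \<Longrightarrow> \<gamma> t \<in> fst c \<Longrightarrow>
    \<exists>v. ((snd c \<circ> \<gamma>) has_vector_derivative v) (at t) \<and> curve_speed M \<gamma> t = sqrt (riem M c (\<gamma> t) v v)"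
proof -
  obtain S where S: "finite S" "{0, 1} \<subseteq> S" "S \<subseteq> {0..1}"
    "\<And>a b. a\<in>S \<Longrightarrow> b\<in>S \<Longrightarrow> a < b \<Longrightarrow> {a<..<b} \<inter> S = {} \<Longrightarrow> C1_curve_on M a b \<gamma>"
    by (rule piecewise_C1E[OF g]) (rule that, assumption+)
  show thesis
  proof (rule that[OF S(1)])
    fix t c assume t: "t \<in> {0<..<1} - S" and c: "c \<in> atlas M" "\<gamma> t \<in> fst c"
    define a where "a = Max {s\<in>S. s < t}"
    define b where "b = Min {s\<in>S. s \<ge> t}"
    have a: "a \<in> {s\<in>S. s < t}" unfolding a_def by (rule Max_in) (use S t in auto)
    have "b \<in> {s\<in>S. s \<ge> t}" unfolding b_def by (rule Min_in) (use S t in auto)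
    then have b: "b \<in> {s\<in>S. s > t}" using t by (auto simp: order_less_le)
    have "s \<le> a" if "s \<in> S" "s < t" for s unfolding a_def by (rule Max_ge) (use S that in auto)
    moreover have "b \<le> s" if "s \<in> S" "s \<ge> t" for s unfolding b_def by (rule Min_le) (use S that in auto)
    ultimately have "{a<..<b} \<inter> S = {}" by fastforce
    then have C: "C1_curve_on M a b \<gamma>" using S(4) a b by auto
    have "at t within {a..b} = at t" "at t within {0..1} = at t"
      using a b t by (auto intro!: at_within_Icc_at)
    moreover obtain v where "((snd c \<circ> \<gamma>) has_vector_derivative v) (at t within {a..b})"
      using C c a b unfolding C1_curve_on_def by fastforce
    ultimately have v: "((snd c \<circ> \<gamma>) has_vector_derivative v) (at t)"
      "((snd c \<circ> \<gamma>) has_vector_derivative v) (at t within {0..1})" by auto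
    have "limitin (mtop M) \<gamma> (\<gamma> t) (at t within {0..1})"
      using piecewise_C1_continuous[OF g] t unfolding continuous_map_real_iff by auto
    then have "curve_speed M \<gamma> t = sqrt (riem M c (\<gamma> t) v v)"
      unfolding curve_speed_def using speed_in_chart[of 0 1 t \<gamma> c v] c v(2) t by auto
    then show "\<exists>v. ((snd c \<circ> \<gamma>) has_vector_derivative v) (at t) \<and>
        curve_speed M \<gamma> t = sqrt (riem M c (\<gamma> t) v v)" using v by blast
  qed
qed

lemma curve_speed_at:
  assumes g: "continuous_map (top_of_set {0..1}) (mtop M) \<gamma>" and t: "t \<in> {0<..<1}" and c: "c \<in> atlas M" "\<gamma> t \<in> fst c"
    and v: "((snd c \<circ> \<gamma>) has_vector_derivative v) (at t)"
  shows "curve_speed M \<gamma> t = sqrt (riem M c (\<gamma> t) v v)"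
proof -
  have "at t within {0..1} = at t" using t by (auto intro!: at_within_Icc_at)
  moreover have "limitin (mtop M) \<gamma> (\<gamma> t) (at t within {0..1})"
    using g t unfolding continuous_map_real_iff by auto
  ultimately show ?thesis
    unfolding curve_speed_def using speed_in_chart[of 0 1 t \<gamma> c v] c t v by auto
qed

lemma curve_speed_nonneg:
  assumes "piecewise_C1_curve M \<gamma>" "t \<in> {0..1}" shows "0 \<le> curve_speed M \<gamma> t"
proof -
  have "\<gamma> t \<in> pts M" using piecewise_C1_continuous[OF assms(1)] assms(2) by (auto simp: continuous_map_def)
  then show ?thesis unfolding curve_speed_def tnorm_def using riem_ge0 chart_at by simp
qed

lemma curve_length_nonneg: "piecewise_C1_curve M \<gamma> \<Longrightarrow> 0 \<le> curve_length M \<gamma>"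
  unfolding curve_length_def by (rule integral_nonneg[OF curve_speed_integrable]) (auto intro: curve_speed_nonneg)

text \<open>Up to the first time at which the curve leaves the coordinate ball of radius \<open>\<rho>\<close>, the coordinate
  displacement is bounded by the length divided by \<open>k\<close>, hence by a number less than \<open>\<rho>\<close>; therefore that time
  does not exist.\<close>

lemma short_curve_in_ball:
  assumes gb: "good_ball c z r k C" and x: "\<gamma> 0 \<in> fst c" and \<rho>: "0 < \<rho>" "cball (snd c (\<gamma> 0)) \<rho> \<subseteq> cball z r"
    and g: "piecewise_C1_curve M \<gamma>" and len: "curve_length M \<gamma> < k * \<rho>"
  shows "\<gamma> 1 \<in> fst c \<and> k * norm (snd c (\<gamma> 1) - snd c (\<gamma> 0)) \<le> curve_length M \<gamma>"
proof -
  let ?F = "\<lambda>t. snd c (\<gamma> t)"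
  let ?sp = "curve_speed M \<gamma>"
  have c: "c \<in> atlas M" and k: "0 < k" and sub: "cball z r \<subseteq> snd c ` fst c"
    using gb by (auto simp: good_ball_def)
  have gc: "continuous_map (top_of_set {0..1}) (mtop M) \<gamma>" by (rule piecewise_C1_continuous[OF g])
  define G where "G = {p \<in> fst c. snd c p \<in> ball (?F 0) \<rho>}"
  have G_open: "openin (mtop M) G" unfolding G_def by (rule chart_preimage_open[OF c]) auto
  obtain S where S: "finite S" "\<And>t. t \<in> {0<..<1} - S \<Longrightarrow> \<gamma> t \<in> fst c \<Longrightarrow>
    \<exists>v. ((snd c \<circ> \<gamma>) has_vector_derivative v) (at t) \<and> curve_speed M \<gamma> t = sqrt (riem M c (\<gamma> t) v v)"
    using piecewise_C1_deriv[OF g] c by metis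
  have A: "k * norm (?F s - ?F 0) \<le> curve_length M \<gamma>" if s: "s \<in> {0..1}" and inG: "\<forall>t\<in>{0..s}. \<gamma> t \<in> G" for s
  proof -
    define F' where "F' t = (if t \<in> {0<..<s} - S then vector_derivative ?F (at t) else 0)" for t
    have F': "(?F has_vector_derivative F' t) (at t)" "k * norm (F' t) \<le> ?sp t" if tS: "t \<in> {0<..<s} - S" for t
    proof -
      have "\<gamma> t \<in> G" using inG tS by auto
      then have tc: "\<gamma> t \<in> fst c" "?F t \<in> cball (?F 0) \<rho>" by (auto simp: G_def)
      then have tz: "?F t \<in> cball z r" using \<rho>(2) by blast
      obtain v where v: "((snd c \<circ> \<gamma>) has_vector_derivative v) (at t)" "?sp t = sqrt (riem M c (\<gamma> t) v v)"
        using S(2)[of t] tS s tc by auto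
      then have e: "F' t = v" using tS by (simp add: F'_def o_def vector_derivative_at)
      show "(?F has_vector_derivative F' t) (at t)" using v e by (simp add: o_def)
      have "k * norm v \<le> sqrt (riem M c (chart_inv c (?F t)) v v)"
        using gb tz unfolding good_ball_def by blast
      then show "k * norm (F' t) \<le> ?sp t" using v e c tc by simp
    qed
    have "continuous_map (top_of_set {0..s}) (subtopology (mtop M) (fst c)) \<gamma>"
    proof -
      have "continuous_map (top_of_set {0..s}) (mtop M) \<gamma>"
        using continuous_map_from_subtopology_mono[OF gc] s by auto
      then show ?thesis using inG by (auto simp: continuous_map_in_subtopology G_def)
    qed
    from continuous_map_compose[OF this chart_cont[OF c]]
    have cF: "continuous_on {0..s} ?F" by (simp add: o_def)
    have int: "(F' has_integral (?F s - ?F 0)) {0..s}"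
      by (rule fundamental_theorem_of_calculus_interior_strong[OF S(1)]) (use s F' cF in auto)
    have spi: "?sp integrable_on {0..s}"
      by (rule integrable_subinterval_real[OF curve_speed_integrable[OF g]]) (use s in auto)
    have "norm (integral {0..s} F') \<le> integral {0..s} (\<lambda>t. ?sp t / k)"
    proof (rule integral_norm_bound_integral)
      show "F' integrable_on {0..s}" using int by blast
      show "(\<lambda>t. ?sp t / k) integrable_on {0..s}" using integrable_on_divide[OF spi] .
      fix t assume t: "t \<in> {0..s}"
      show "norm (F' t) \<le> ?sp t / k"
      proof (cases "t \<in> {0<..<s} - S")
        case True
        then show ?thesis using F'(2)[OF True] k by (simp add: field_simps)
      next
        case False
        then show ?thesis using curve_speed_nonneg[OF g, of t] t s k by (simp only: F'_def if_False) auto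
      qed
    qed
    then have "k * norm (?F s - ?F 0) \<le> integral {0..s} ?sp"
      using int k by (simp add: integral_unique field_simps)
    also have "\<dots> \<le> integral {0..1} ?sp"
      by (rule integral_subset_le) (use s spi curve_speed_integrable[OF g] curve_speed_nonneg[OF g] in auto)
    finally show ?thesis by (simp add: curve_length_def)
  qed
  have B: "\<gamma> t \<in> G" if "t \<in> {0..1}" for t
  proof (rule ccontr)
    assume "\<gamma> t \<notin> G"
    define Bad where "Bad = {t\<in>{0..1}. \<gamma> t \<notin> G}"
    have "closedin (top_of_set {0..1}) {t\<in>topspace (top_of_set {0..1}). \<gamma> t \<in> pts M - G}"
      by (rule closedin_continuous_map_preimage[OF gc]) (use G_open in auto)
    moreover have "{t\<in>topspace (top_of_set {0..1}). \<gamma> t \<in> pts M - G} = Bad"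
      using gc by (auto simp: Bad_def continuous_map_def)
    ultimately have "closed Bad" by (auto simp: closedin_closed_eq)
    moreover have "bounded Bad" by (rule bounded_subset[of "{0..1}"]) (auto simp: Bad_def)
    ultimately have "compact Bad" by (simp add: compact_eq_bounded_closed)
    moreover have "Bad \<noteq> {}" using that \<open>\<gamma> t \<notin> G\<close> by (auto simp: Bad_def)
    ultimately obtain s where s: "s \<in> Bad" "\<And>t. t \<in> Bad \<Longrightarrow> s \<le> t" using compact_attains_inf by metis
    have s0: "0 < s"
    proof -
      have "\<gamma> 0 \<in> G" using x \<rho> by (simp add: G_def)
      then have "s \<noteq> 0" using s by (auto simp: Bad_def)
      then show ?thesis using s by (auto simp: Bad_def)
    qed
    have s1: "s \<in> {0..1}" "\<gamma> s \<notin> G" using s by (auto simp: Bad_def)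
    define \<rho>' where "\<rho>' = curve_length M \<gamma> / k"
    define K where "K = {p \<in> fst c. snd c p \<in> cball (?F 0) \<rho>'}"
    have \<rho>': "\<rho>' < \<rho>" using len k by (simp add: \<rho>'_def field_simps)
    have Kcl: "closedin (mtop M) K" unfolding K_def
      by (rule chart_closed_preimage[OF c compact_cball]) (use \<rho>' \<rho> sub in force)
    have inK: "t \<in> {t\<in>{0..1}. \<gamma> t \<in> K}" if t: "t \<in> {0..<s}" for t
    proof -
      have "\<forall>u\<in>{0..t}. \<gamma> u \<in> G" using s(2) t s1 by (force simp: Bad_def)
      then have "k * norm (?F t - ?F 0) \<le> curve_length M \<gamma>" "\<gamma> t \<in> fst c"
        using A[of t] t s1 by (auto simp: G_def)
      then show ?thesis using k t s1
        by (auto simp: K_def \<rho>'_def dist_norm norm_minus_commute field_simps)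
    qed
    have "closed {t\<in>{0..1}. \<gamma> t \<in> K}"
      using closedin_continuous_map_preimage[OF gc Kcl] by (auto simp: closedin_closed_eq)
    then have "closure {0..<s} \<subseteq> {t\<in>{0..1}. \<gamma> t \<in> K}"
      by (intro closure_minimal) (use inK in blast)+
    moreover have "s \<in> closure {0..<s}" using s0 by (simp add: closure_atLeastLessThan)
    ultimately have "\<gamma> s \<in> K" by blast
    then have "\<gamma> s \<in> G" using \<rho>' by (auto simp: K_def G_def)
    then show False using s1 by blast
  qed
  show ?thesis using A[of 1] B by (auto simp: G_def)
qed

end

section \<open>The Riemannian distance\<close>

lemma piecewise_C1_join:
  assumes g1: "piecewise_C1_curve M \<gamma>1" and g2: "piecewise_C1_curve M \<gamma>2" and e: "\<gamma>1 1 = \<gamma>2 0"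
  shows "piecewise_C1_curve M (\<lambda>t. if t \<le> 1/2 then \<gamma>1 (2 * t) else \<gamma>2 (2 * t - 1))" (is "piecewise_C1_curve M ?J")
proof -
  obtain S1 where S1: "finite S1" "{0, 1} \<subseteq> S1" "S1 \<subseteq> {0..1}"
    "\<And>a b. a\<in>S1 \<Longrightarrow> b\<in>S1 \<Longrightarrow> a < b \<Longrightarrow> {a<..<b} \<inter> S1 = {} \<Longrightarrow> C1_curve_on M a b \<gamma>1"
    by (rule piecewise_C1E[OF g1]) (rule that, assumption+)
  obtain S2 where S2: "finite S2" "{0, 1} \<subseteq> S2" "S2 \<subseteq> {0..1}"
    "\<And>a b. a\<in>S2 \<Longrightarrow> b\<in>S2 \<Longrightarrow> a < b \<Longrightarrow> {a<..<b} \<inter> S2 = {} \<Longrightarrow> C1_curve_on M a b \<gamma>2"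
    by (rule piecewise_C1E[OF g2]) (rule that, assumption+)
  define S where "S = (\<lambda>s. s / 2) ` S1 \<union> (\<lambda>s. (s + 1) / 2) ` S2"
  have S1I: "s \<in> S1 \<Longrightarrow> s / 2 \<in> S" and S2I: "s \<in> S2 \<Longrightarrow> (s + 1) / 2 \<in> S" for s by (auto simp: S_def)
  have half: "1/2 \<in> S" using S1I[of 1] S1(2) by auto
  have lo: "2 * s \<in> S1" if "s \<in> S" "s \<le> 1/2" for s
  proof -
    from that(1) consider u where "u \<in> S1" "s = u / 2" | u where "u \<in> S2" "s = (u + 1) / 2" by (auto simp: S_def)
    then show ?thesis
    proof cases
      case 1
      then have "2 * s = u" by simp
      then show ?thesis using 1(1) by (simp only:)
    next
      case 2
      then have "u = 0" using S2(3) that(2) by force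
      then have "2 * s = 1" using 2 by simp
      then show ?thesis using S1(2) by simp
    qed
  qed
  have hi: "2 * s - 1 \<in> S2" if "s \<in> S" "1/2 \<le> s" for s
  proof -
    from that(1) consider u where "u \<in> S1" "s = u / 2" | u where "u \<in> S2" "s = (u + 1) / 2" by (auto simp: S_def)
    then show ?thesis
    proof cases
      case 1
      then have "u = 1" using S1(3) that(2) by force
      then have "2 * s - 1 = 0" using 1 by simp
      then show ?thesis using S2(2) by simp
    next
      case 2
      then have "2 * s - 1 = u" by (simp add: field_simps)
      then show ?thesis using 2(1) by (simp only:)
    qed
  qed
  show ?thesis
    unfolding piecewise_C1_curve_def
  proof (intro exI[of _ S] conjI ballI impI)
    show "finite S" using S1 S2 by (auto simp: S_def)
    show "{0, 1} \<subseteq> S" using S1I[of 0] S2I[of 1] S1(2) S2(2) by auto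
    show "S \<subseteq> {0..1}" using S1(3) S2(3) by (auto simp: S_def)
    fix a b assume a: "a \<in> S" and b: "b \<in> S" and ab: "a < b \<and> {a<..<b} \<inter> S = {}"
    then consider "b \<le> 1/2" | "1/2 \<le> a" using half by force
    then show "C1_curve_on M a b ?J"
    proof cases
      case 1
      have "{2*a<..<2*b} \<inter> S1 = {}"
      proof (rule ccontr)
        assume "{2*a<..<2*b} \<inter> S1 \<noteq> {}"
        then obtain s where "s \<in> S1" "2 * a < s" "s < 2 * b" by auto
        then have "s / 2 \<in> {a<..<b} \<inter> S" using S1I by auto
        then show False using ab by blast
      qed
      then have "C1_curve_on M (2*a) (2*b) \<gamma>1"
        using lo[of a] lo[of b] a b ab 1 by (intro S1(4)) auto
      then have "C1_curve_on M a b (\<lambda>t. \<gamma>1 (2 * t + 0))" by (rule C1_curve_on_affine) auto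
      then show ?thesis by (rule C1_curve_on_cong) (use 1 in auto)
    next
      case 2
      have "{2*a-1<..<2*b-1} \<inter> S2 = {}"
      proof (rule ccontr)
        assume "{2*a-1<..<2*b-1} \<inter> S2 \<noteq> {}"
        then obtain s where "s \<in> S2" "2 * a - 1 < s" "s < 2 * b - 1" by auto
        moreover have "a < (s + 1) / 2" "(s + 1) / 2 < b" using calculation by simp_all
        ultimately have "(s + 1) / 2 \<in> {a<..<b} \<inter> S" using S2I[of s] by (simp only: Int_iff greaterThanLessThan_iff simp_thms)
        then show False using ab by blast
      qed
      then have "C1_curve_on M (2*a-1) (2*b-1) \<gamma>2"
        using hi[of a] hi[of b] a b ab 2 by (intro S2(4)) auto
      then have "C1_curve_on M a b (\<lambda>t. \<gamma>2 (2 * t + (-1)))" by (rule C1_curve_on_affine) auto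
      then show ?thesis
      proof (rule C1_curve_on_cong)
        fix t assume "t \<in> {a..b}"
        then consider "t = 1/2" | "t > 1/2" using 2 by force
        then show "\<gamma>2 (2 * t + (-1)) = ?J t"
        proof cases
          case 1
          show ?thesis unfolding 1 using e by simp
        qed auto
      qed
    qed
  qed
qed

lemma piecewise_C1_reverse:
  assumes g: "piecewise_C1_curve M \<gamma>"
  shows "piecewise_C1_curve M (\<lambda>t. \<gamma> (1 - t))"
proof -
  obtain S where S: "finite S" "{0, 1} \<subseteq> S" "S \<subseteq> {0..1}"
    "\<And>a b. a\<in>S \<Longrightarrow> b\<in>S \<Longrightarrow> a < b \<Longrightarrow> {a<..<b} \<inter> S = {} \<Longrightarrow> C1_curve_on M a b \<gamma>"
    by (rule piecewise_C1E[OF g]) (rule that, assumption+)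
  show ?thesis
    unfolding piecewise_C1_curve_def
  proof (intro exI[of _ "(\<lambda>s. 1 - s) ` S"] conjI ballI impI)
    fix a b assume a: "a \<in> (\<lambda>s. 1 - s) ` S" and b: "b \<in> (\<lambda>s. 1 - s) ` S"
      and ab: "a < b \<and> {a<..<b} \<inter> (\<lambda>s. 1 - s) ` S = {}"
    have "{1-b<..<1-a} \<inter> S = {}"
    proof (rule ccontr)
      assume "{1-b<..<1-a} \<inter> S \<noteq> {}"
      then obtain s where "s \<in> S" "1 - b < s" "s < 1 - a" by auto
      then have "1 - s \<in> {a<..<b} \<inter> (\<lambda>s. 1 - s) ` S" by auto
      then show False using ab by blast
    qed
    then have "C1_curve_on M (1-b) (1-a) \<gamma>" using a b ab by (intro S(4)) auto
    then have "C1_curve_on M a b (\<lambda>t. \<gamma> ((-1) * t + 1))" by (rule C1_curve_on_affine) auto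
    then show "C1_curve_on M a b (\<lambda>t. \<gamma> (1 - t))" by simp
  qed (use S in \<open>auto simp: image_iff intro: bexI[of _ 0] bexI[of _ 1]\<close>)
qed

context closed_rmanifold
begin

lemma riem_scale:
  assumes "c \<in> atlas M" "p \<in> fst c"
  shows "sqrt (riem M c p (m *\<^sub>R v) (m *\<^sub>R v)) = \<bar>m\<bar> * sqrt (riem M c p v v)"
proof -
  have "riem M c p (m *\<^sub>R v) (m *\<^sub>R v) = m\<^sup>2 * riem M c p v v"
    using riem_bilinear[OF assms] by (simp add: bilinear_lmul bilinear_rmul power2_eq_square)
  then show ?thesis by (simp add: real_sqrt_mult)
qed

text \<open>On each of their parts the joined and the reversed curve are affine reparametrizations \<open>J\<close> of given curves.
  The formula for the speed can fail at the finitely many images of break points, which the integral ignores.\<close>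

lemma speed_integral_affine:
  assumes g: "piecewise_C1_curve M \<gamma>" and J: "continuous_map (top_of_set {0..1}) (mtop M) J"
    and m: "m \<noteq> 0" and ab: "{a..b} = (\<lambda>x. (1/m) *\<^sub>R x + - ((1/m) *\<^sub>R q)) ` {0..1}" "a \<le> b" "0 \<le> a" "b \<le> 1"
    and in01: "\<And>t. t \<in> {a<..<b} \<Longrightarrow> m * t + q \<in> {0<..<1}"
    and Jg: "\<And>t. t \<in> {a<..<b} \<Longrightarrow> J t = \<gamma> (m * t + q)"
  shows "(curve_speed M J has_integral curve_length M \<gamma>) {a..b}"
proof -
  obtain S where S: "finite S" "\<And>t c. t \<in> {0<..<1} - S \<Longrightarrow> c \<in> atlas M \<Longrightarrow> \<gamma> t \<in> fst c \<Longrightarrow>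
    \<exists>v. ((snd c \<circ> \<gamma>) has_vector_derivative v) (at t) \<and> curve_speed M \<gamma> t = sqrt (riem M c (\<gamma> t) v v)"
    by (rule piecewise_C1_deriv[OF g]) (rule that, assumption+)
  have gc: "continuous_map (top_of_set {0..1}) (mtop M) \<gamma>" by (rule piecewise_C1_continuous[OF g])
  have sp: "curve_speed M J t = \<bar>m\<bar> * curve_speed M \<gamma> (m * t + q)" if t: "t \<in> {a<..<b}" "m * t + q \<notin> S" for t
  proof -
    let ?u = "m * t + q"
    have u: "?u \<in> {0<..<1} - S" using in01 t by auto
    then have p: "\<gamma> ?u \<in> pts M" using gc by (auto simp: continuous_map_def)
    define c where "c = chart_at M (\<gamma> ?u)"
    have c: "c \<in> atlas M" "\<gamma> ?u \<in> fst c" using chart_at[OF p] by (auto simp: c_def)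
    obtain v where v: "((snd c \<circ> \<gamma>) has_vector_derivative v) (at ?u)"
      "curve_speed M \<gamma> ?u = sqrt (riem M c (\<gamma> ?u) v v)" using S(2)[OF u c] by blast
    have "((\<lambda>t. m * t + q) has_vector_derivative m) (at t)" by (auto intro!: derivative_eq_intros)
    from vector_diff_chain_at[OF this v(1)]
    have "((snd c \<circ> \<gamma>) \<circ> (\<lambda>t. m * t + q) has_vector_derivative m *\<^sub>R v) (at t)" by (simp add: o_def)
    then have "((snd c \<circ> J) has_vector_derivative m *\<^sub>R v) (at t)"
      by (rule has_vector_derivative_transform_within_open[where S = "{a<..<b}"]) (use t Jg in auto)
    then have "curve_speed M J t = sqrt (riem M c (J t) (m *\<^sub>R v) (m *\<^sub>R v))"
      using c t Jg ab by (intro curve_speed_at[OF J]) auto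
    then show ?thesis using v(2) riem_scale[OF c] Jg t by simp
  qed
  have "((\<lambda>x. curve_speed M \<gamma> (m *\<^sub>R x + q)) has_integral (1 / \<bar>m\<bar> ^ DIM(real)) *\<^sub>R curve_length M \<gamma>)
     ((\<lambda>x. (1/m) *\<^sub>R x + - ((1/m) *\<^sub>R q)) ` cbox 0 1)"
    by (rule has_integral_affinity) (use m curve_speed_integrable[OF g] in \<open>auto simp: curve_length_def integrable_integral\<close>)
  then have "((\<lambda>x. curve_speed M \<gamma> (m * x + q)) has_integral (1 / \<bar>m\<bar>) * curve_length M \<gamma>) {a..b}"
    using ab by simp
  then have "((\<lambda>x. \<bar>m\<bar> * curve_speed M \<gamma> (m * x + q)) has_integral \<bar>m\<bar> * ((1 / \<bar>m\<bar>) * curve_length M \<gamma>)) {a..b}"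
    by (rule has_integral_mult_right)
  then have "((\<lambda>x. \<bar>m\<bar> * curve_speed M \<gamma> (m * x + q)) has_integral curve_length M \<gamma>) {a..b}" using m by simp
  then show ?thesis
  proof (rule has_integral_spike_finite[rotated 2])
    show "finite ({a, b} \<union> (\<lambda>s. (s - q) / m) ` S)" using S(1) by auto
    fix t assume t: "t \<in> {a..b} - ({a, b} \<union> (\<lambda>s. (s - q) / m) ` S)"
    have "m * t + q \<notin> S"
    proof
      assume "m * t + q \<in> S"
      then have "(m * t + q - q) / m \<in> (\<lambda>s. (s - q) / m) ` S" by blast
      then show False using t m by simp
    qed
    then show "curve_speed M J t = \<bar>m\<bar> * curve_speed M \<gamma> (m * t + q)" using sp[of t] t by auto
  qed
qed

lemma length_join:
  assumes g: "piecewise_C1_curve M \<gamma>1" "piecewise_C1_curve M \<gamma>2" and e: "\<gamma>1 1 = \<gamma>2 0"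
  shows "curve_length M (\<lambda>t. if t \<le> 1/2 then \<gamma>1 (2 * t) else \<gamma>2 (2 * t - 1)) = curve_length M \<gamma>1 + curve_length M \<gamma>2"
    (is "curve_length M ?J = _")
proof -
  have J: "continuous_map (top_of_set {0..1}) (mtop M) ?J"
    by (rule piecewise_C1_continuous[OF piecewise_C1_join[OF g e]])
  have 1: "(curve_speed M ?J has_integral curve_length M \<gamma>1) {0..1/2}"
    by (rule speed_integral_affine[OF g(1) J, of 2 _ _ 0])
      (auto simp: image_affinity_atLeastAtMost)
  have 2: "(curve_speed M ?J has_integral curve_length M \<gamma>2) {1/2..1}"
  proof (rule speed_integral_affine[OF g(2) J, of 2 _ _ "-1"])
    have "x \<in> (\<lambda>x. (1/2) *\<^sub>R x + - ((1/2) *\<^sub>R (-1))) ` {0..1}" if "x \<in> {1/2..1}" for x :: real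
      using that by (intro image_eqI[of _ _ "2 * x - 1"]) (auto simp: field_simps)
    then show "{1/2..1} = (\<lambda>x. (1/2) *\<^sub>R x + - ((1/2) *\<^sub>R (-1))) ` {0..1::real}" by auto
  qed auto
  have "(curve_speed M ?J has_integral curve_length M \<gamma>1 + curve_length M \<gamma>2) {0..1}"
    by (rule has_integral_combine[OF _ _ 1 2]) auto
  then show ?thesis unfolding curve_length_def[of M ?J] by (rule integral_unique)
qed

lemma length_reverse:
  assumes g: "piecewise_C1_curve M \<gamma>"
  shows "curve_length M (\<lambda>t. \<gamma> (1 - t)) = curve_length M \<gamma>"
proof -
  have J: "continuous_map (top_of_set {0..1}) (mtop M) (\<lambda>t. \<gamma> (1 - t))"
    by (rule piecewise_C1_continuous[OF piecewise_C1_reverse[OF g]])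
  have "(curve_speed M (\<lambda>t. \<gamma> (1 - t)) has_integral curve_length M \<gamma>) {0..1}"
    by (rule speed_integral_affine[OF g J, of "-1" _ _ 1])
      (auto simp: image_affinity_atLeastAtMost)
  then show ?thesis unfolding curve_length_def[of M "\<lambda>t. \<gamma> (1 - t)"] by (rule integral_unique)
qed

lemma segment_curve:
  assumes gb: "good_ball c z r k C" and uw: "u \<in> cball z r" "w \<in> cball z r"
  shows "piecewise_C1_curve M (\<lambda>t. chart_inv c (u + t *\<^sub>R (w - u)))" (is "piecewise_C1_curve M ?g")
    and "curve_length M (\<lambda>t. chart_inv c (u + t *\<^sub>R (w - u))) \<le> C * norm (w - u)"
proof -
  have c: "c \<in> atlas M" and sub: "cball z r \<subseteq> snd c ` fst c" and C: "C > 0" using gb by (auto simp: good_ball_def)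
  let ?l = "\<lambda>t. u + t *\<^sub>R (w - u)"
  have lz: "?l t \<in> cball z r" if "t \<in> {0..1}" for t
  proof -
    have "?l t = (1 - t) *\<^sub>R u + t *\<^sub>R w" by (simp add: algebra_simps)
    then show ?thesis using that uw convexD[OF convex_cball[of z r], of u w "1 - t" t] by auto
  qed
  have lr: "?l t \<in> snd c ` fst c" if "t \<in> {0..1}" for t using lz[OF that] sub by blast
  have gdom: "?g t \<in> fst c" "snd c (?g t) = ?l t" if "t \<in> {0..1}" for t
    by (rule chart_inv_dom[OF lr[OF that]], rule chart_inv_right[OF lr[OF that]])
  have "continuous_map (top_of_set {0..1}) (top_of_set (snd c ` fst c)) ?l"
    using lr by (auto intro!: continuous_intros)
  from continuous_map_compose[OF this chart_inv_cont[OF c]]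
  have gc: "continuous_map (top_of_set {0..1}) (mtop M) ?g" by (simp add: o_def)
  have dl: "(?l has_vector_derivative (w - u)) F" for F
    by (auto intro!: derivative_eq_intros simp: has_vector_derivative_def)
  have dc: "((snd c \<circ> ?g) has_vector_derivative (w - u)) (at t within {0..1})" if "t \<in> {0..1}" for t
    by (rule has_vector_derivative_transform[OF that _ dl]) (use gdom in auto)
  have C1: "C1_curve_on M 0 1 ?g"
    unfolding C1_curve_on_def
  proof (intro conjI ballI)
    show "continuous_map (top_of_set {0..1}) (mtop M) ?g" by (rule gc)
    fix d assume d: "d \<in> atlas M"
    show "\<exists>D. continuous_on {t\<in>{0..1}. ?g t \<in> fst d} D \<and>
        (\<forall>t\<in>{0..1}. ?g t \<in> fst d \<longrightarrow> ((snd d \<circ> ?g) has_vector_derivative D t) (at t within {0..1}))"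
    proof (intro exI[of _ "\<lambda>t. coord_change c d (?g t) (w - u)"] conjI ballI impI)
      fix t assume t: "t \<in> {0..1}" "?g t \<in> fst d"
      have "limitin (mtop M) ?g (?g t) (at t within {0..1})"
        using gc t unfolding continuous_map_real_iff by blast
      then show "((snd d \<circ> ?g) has_vector_derivative coord_change c d (?g t) (w - u)) (at t within {0..1})"
        by (rule deriv_change[where \<gamma> = ?g, OF _ c d]) (use gdom t dc in auto)
    next
      have "Ck_on 1 (transition c d) (snd c ` (fst c \<inter> fst d))"
        using transition_smooth[OF c d] unfolding smooth_on_def by blast
      then have "continuous_on (snd c ` (fst c \<inter> fst d)) (\<lambda>z. frechet_derivative (transition c d) (at z) (w - u))"
        by simp
      then have "continuous_on {t\<in>{0..1}. ?g t \<in> fst d} (\<lambda>t. frechet_derivative (transition c d) (at (?l t)) (w - u))"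
      proof (rule continuous_on_compose2)
        show "?l ` {t\<in>{0..1}. ?g t \<in> fst d} \<subseteq> snd c ` (fst c \<inter> fst d)"
        proof
          fix x assume "x \<in> ?l ` {t\<in>{0..1}. ?g t \<in> fst d}"
          then obtain t where "t \<in> {0..1}" "?g t \<in> fst d" "x = ?l t" by blast
          then show "x \<in> snd c ` (fst c \<inter> fst d)" using gdom[of t] by (metis IntI imageI)
        qed
      qed (intro continuous_intros)
      then show "continuous_on {t\<in>{0..1}. ?g t \<in> fst d} (\<lambda>t. coord_change c d (?g t) (w - u))"
        by (rule continuous_on_eq) (use gdom in \<open>auto simp: coord_change_def\<close>)
    qed
  qed
  then show pc: "piecewise_C1_curve M ?g"
    unfolding piecewise_C1_curve_def by (intro exI[of _ "{0, 1}"]) auto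
  have sp: "curve_speed M ?g t \<le> C * norm (w - u)" if "t \<in> {0<..<1}" for t
  proof -
    have t: "t \<in> {0..1}" using that by auto
    have "at t within {0..1} = at t" using that by (auto intro!: at_within_Icc_at)
    then have "((snd c \<circ> ?g) has_vector_derivative (w - u)) (at t)" using dc[OF t] by simp
    then have "curve_speed M ?g t = sqrt (riem M c (?g t) (w - u) (w - u))"
      by (intro curve_speed_at[OF gc that c gdom(1)[OF t]])
    then show ?thesis using gb lz[OF t] unfolding good_ball_def by auto
  qed
  define f where "f t = (if t \<in> {0<..<1} then curve_speed M ?g t else 0)" for t
  have "curve_length M ?g = integral {0..1} f"
    unfolding curve_length_def by (rule integral_spike[of "{0,1}"]) (auto simp: f_def)
  also have "\<dots> \<le> integral {0..1} (\<lambda>_::real. C * norm (w - u))"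
  proof (rule integral_le)
    show "f integrable_on {0..1}"
      by (rule integrable_spike_finite[OF _ _ curve_speed_integrable[OF pc], of "{0,1}"]) (auto simp: f_def)
  qed (use sp C in \<open>auto simp: f_def\<close>)
  finally show "curve_length M ?g \<le> C * norm (w - u)" by simp
qed

lemma mdist_le: "piecewise_C1_curve M \<gamma> \<Longrightarrow> mdist M (\<gamma> 0) (\<gamma> 1) \<le> curve_length M \<gamma>"
  unfolding mdist_def by (rule cInf_lower) (auto intro!: bdd_belowI[of _ 0] curve_length_nonneg)

definition joinable :: "'a \<Rightarrow> 'a \<Rightarrow> bool" where
  "joinable p q \<longleftrightarrow> (\<exists>\<gamma>. piecewise_C1_curve M \<gamma> \<and> \<gamma> 0 = p \<and> \<gamma> 1 = q)"

lemma joinable_trans: "joinable p q \<Longrightarrow> joinable q s \<Longrightarrow> joinable p s"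
proof -
  assume "joinable p q" "joinable q s"
  then obtain \<gamma>1 \<gamma>2 where g: "piecewise_C1_curve M \<gamma>1" "\<gamma>1 0 = p" "\<gamma>1 1 = q"
    "piecewise_C1_curve M \<gamma>2" "\<gamma>2 0 = q" "\<gamma>2 1 = s" by (auto simp: joinable_def)
  have "piecewise_C1_curve M (\<lambda>t. if t \<le> 1/2 then \<gamma>1 (2 * t) else \<gamma>2 (2 * t - 1))"
    by (rule piecewise_C1_join) (use g in auto)
  then show "joinable p s" unfolding joinable_def by (intro exI conjI, assumption) (use g in auto)
qed

lemma joinable_sym: "joinable p q \<Longrightarrow> joinable q p"
proof -
  assume "joinable p q"
  then obtain \<gamma> where g: "piecewise_C1_curve M \<gamma>" "\<gamma> 0 = p" "\<gamma> 1 = q" by (auto simp: joinable_def)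
  show "joinable q p" unfolding joinable_def using piecewise_C1_reverse[OF g(1)] by (intro exI conjI, assumption) (use g in auto)
qed

lemma joinable_ball:
  assumes "good_ball c z r k C" "x \<in> fst c" "y \<in> fst c" "snd c x \<in> cball z r" "snd c y \<in> cball z r"
  shows "joinable x y" and mdist_le_chart: "mdist M x y \<le> C * norm (snd c y - snd c x)"
proof -
  have c: "c \<in> atlas M" using assms by (auto simp: good_ball_def)
  note s = segment_curve[OF assms(1,4,5)]
  have e: "chart_inv c (snd c x + 0 *\<^sub>R (snd c y - snd c x)) = x" "chart_inv c (snd c x + 1 *\<^sub>R (snd c y - snd c x)) = y"
    using assms c by auto
  then show "joinable x y" using s(1) unfolding joinable_def by blast
  show "mdist M x y \<le> C * norm (snd c y - snd c x)" using mdist_le[OF s(1)] s(2) e by simp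
qed

lemma good_ball_at: "p \<in> pts M \<Longrightarrow> \<exists>c r k C. good_ball c (snd c p) r k C \<and> p \<in> fst c"
  using good_ball_exists chart_at by metis

text \<open>\<open>mdist\<close> is an infimum of real numbers, which is arbitrary for the empty set. So connectedness enters before
  any property of the distance: the points that can be joined to \<open>p\<close> form an open and closed set.\<close>

lemma all_joinable: assumes p: "p \<in> pts M" and q: "q \<in> pts M" shows "joinable p q"
proof -
  have nb: "\<exists>W. openin (mtop M) W \<and> x \<in> W \<and> (\<forall>y\<in>W. joinable x y)" if x: "x \<in> pts M" for x
  proof -
    obtain c r k C where gb: "good_ball c (snd c x) r k C" "x \<in> fst c" using good_ball_at[OF x] by blast
    then have "c \<in> atlas M" "r > 0" by (auto simp: good_ball_def)
    then show ?thesis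
      using gb chart_preimage_open[of c "ball (snd c x) r"]
      by (intro exI[of _ "{y\<in>fst c. snd c y \<in> ball (snd c x) r}"])
        (auto intro!: joinable_ball(1)[OF gb(1)])
  qed
  let ?J = "{x \<in> pts M. joinable p x}"
  have o1: "openin (mtop M) ?J"
  proof (subst openin_subopen, intro ballI)
    fix x assume x: "x \<in> ?J"
    then obtain W where W: "openin (mtop M) W" "x \<in> W" "\<forall>y\<in>W. joinable x y" using nb by blast
    then have "W \<subseteq> ?J" using x openin_subset[OF W(1)] joinable_trans by blast
    then show "\<exists>T. openin (mtop M) T \<and> x \<in> T \<and> T \<subseteq> ?J" using W by blast
  qed
  have o2: "openin (mtop M) (pts M - ?J)"
  proof (subst openin_subopen, intro ballI)
    fix x assume x: "x \<in> pts M - ?J"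
    then obtain W where W: "openin (mtop M) W" "x \<in> W" "\<forall>y\<in>W. joinable x y" using nb by blast
    then have "W \<subseteq> pts M - ?J" using x openin_subset[OF W(1)] joinable_trans joinable_sym by blast
    then show "\<exists>T. openin (mtop M) T \<and> x \<in> T \<and> T \<subseteq> pts M - ?J" using W by blast
  qed
  have "closedin (mtop M) ?J" using o2 by (auto simp: closedin_def)
  then have "?J = {} \<or> ?J = pts M" using o1 connected_M by (auto simp: connected_space_clopen_in)
  moreover have "p \<in> ?J" using nb[OF p] p by blast
  ultimately show ?thesis using q by blast
qed

lemma mdist_nonneg: "p \<in> pts M \<Longrightarrow> q \<in> pts M \<Longrightarrow> 0 \<le> mdist M p q"
  unfolding mdist_def using all_joinable[of p q]
  by (intro cInf_greatest) (auto simp: joinable_def intro: curve_length_nonneg)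

lemma mdist_curve:
  assumes "p \<in> pts M" "q \<in> pts M" "mdist M p q < e"
  obtains \<gamma> where "piecewise_C1_curve M \<gamma>" "\<gamma> 0 = p" "\<gamma> 1 = q" "curve_length M \<gamma> < e"
proof -
  have "{curve_length M \<gamma> |\<gamma>. piecewise_C1_curve M \<gamma> \<and> \<gamma> 0 = p \<and> \<gamma> 1 = q} \<noteq> {}"
    using all_joinable[OF assms(1,2)] by (auto simp: joinable_def)
  from cInf_lessD[OF this assms(3)[unfolded mdist_def]] show thesis using that by blast
qed

lemma mdist_self: assumes "p \<in> pts M" shows "mdist M p p = 0"
proof -
  obtain c r k C where gb: "good_ball c (snd c p) r k C" "p \<in> fst c" using good_ball_at[OF assms] by blast
  then have "mdist M p p \<le> 0" using mdist_le_chart[OF gb(1,2,2)] by (auto simp: good_ball_def)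
  then show ?thesis using mdist_nonneg[OF assms assms] by simp
qed

lemma mdist_sym: assumes "p \<in> pts M" "q \<in> pts M" shows "mdist M p q = mdist M q p"
proof -
  have "mdist M q p \<le> mdist M p q" if "p \<in> pts M" "q \<in> pts M" for p q
  proof (rule field_le_epsilon)
    fix e :: real assume "0 < e"
    then have "mdist M p q < mdist M p q + e" by simp
    from mdist_curve[OF that this] obtain \<gamma>
      where g: "piecewise_C1_curve M \<gamma>" "\<gamma> 0 = p" "\<gamma> 1 = q" "curve_length M \<gamma> < mdist M p q + e" by blast
    show "mdist M q p \<le> mdist M p q + e"
      using mdist_le[OF piecewise_C1_reverse[OF g(1)]] length_reverse[OF g(1)] g by simp
  qed
  then show ?thesis using assms by (meson order_antisym)
qed

lemma mdist_triangle:
  assumes "p \<in> pts M" "q \<in> pts M" "s \<in> pts M" shows "mdist M p s \<le> mdist M p q + mdist M q s"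
proof (rule field_le_epsilon)
  fix e :: real assume "0 < e"
  then have "mdist M p q < mdist M p q + e/2" "mdist M q s < mdist M q s + e/2" by simp_all
  then obtain \<gamma>1 \<gamma>2 where g: "piecewise_C1_curve M \<gamma>1" "\<gamma>1 0 = p" "\<gamma>1 1 = q" "curve_length M \<gamma>1 < mdist M p q + e/2"
    "piecewise_C1_curve M \<gamma>2" "\<gamma>2 0 = q" "\<gamma>2 1 = s" "curve_length M \<gamma>2 < mdist M q s + e/2"
    using mdist_curve assms by metis
  have e: "\<gamma>1 1 = \<gamma>2 0" using g by simp
  show "mdist M p s \<le> mdist M p q + mdist M q s + e"
    using mdist_le[OF piecewise_C1_join[OF g(1,5) e]] length_join[OF g(1,5) e] g by simp
qed

text \<open>Together with \<open>mdist_le_chart\<close>: charts are locally bi-Lipschitz for the Riemannian distance.\<close>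

lemma chart_le_mdist:
  assumes gb: "good_ball c z r k C" and x: "x \<in> fst c" and \<rho>: "0 < \<rho>" "cball (snd c x) \<rho> \<subseteq> cball z r"
    and y: "y \<in> pts M" and len: "mdist M x y < k * \<rho>"
  shows "y \<in> fst c" "k * norm (snd c y - snd c x) \<le> mdist M x y"
proof -
  have "c \<in> atlas M" using gb by (simp add: good_ball_def)
  then have xp: "x \<in> pts M" using x chart_dom_pts by blast
  have *: "y \<in> fst c \<and> k * norm (snd c y - snd c x) < e" if e: "mdist M x y < e" "e \<le> k * \<rho>" for e
  proof -
    from mdist_curve[OF xp y e(1)] obtain \<gamma>
      where g: "piecewise_C1_curve M \<gamma>" "\<gamma> 0 = x" "\<gamma> 1 = y" "curve_length M \<gamma> < e" by blast
    have "\<gamma> 1 \<in> fst c \<and> k * norm (snd c (\<gamma> 1) - snd c (\<gamma> 0)) \<le> curve_length M \<gamma>"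
      by (rule short_curve_in_ball[OF gb _ \<rho>(1) _ g(1)]) (use x \<rho> g e in auto)
    then show ?thesis using g by auto
  qed
  show "y \<in> fst c" using *[of "k * \<rho>"] len by simp
  show "k * norm (snd c y - snd c x) \<le> mdist M x y"
  proof (rule dense_ge_bounded[OF len])
    fix e assume "mdist M x y < e" "e < k * \<rho>"
    then show "k * norm (snd c y - snd c x) \<le> e" using *[of e] by simp
  qed
qed

end

section \<open>Finite families of charts and covering numbers\<close>

lemma few_codes:
  assumes "finite K" "code ` S \<subseteq> K"
  obtains F where "F \<subseteq> S" "finite F" "card F \<le> card K" "\<And>x. x \<in> S \<Longrightarrow> \<exists>y\<in>F. code y = code x"
proof -
  define rep where "rep k = (SOME x. x \<in> S \<and> code x = k)" for k
  have rep: "rep (code x) \<in> S \<and> code (rep (code x)) = code x" if "x \<in> S" for x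
    unfolding rep_def by (rule someI[of "\<lambda>y. y \<in> S \<and> code y = code x" x]) (use that in simp)
  have f: "finite (code ` S)" using assms finite_subset by blast
  show thesis
  proof (rule that[of "rep ` code ` S"])
    show "card (rep ` code ` S) \<le> card K"
      using card_image_le[OF f, of rep] card_mono[OF assms] by linarith
  qed (use rep f in auto)
qed

lemma finite_bound: "finite A \<Longrightarrow> \<exists>B::real. 0 < B \<and> (\<forall>a\<in>A. f a \<le> B)"
proof -
  assume "finite A"
  then have "f a \<le> (\<Sum>a\<in>A. \<bar>f a\<bar>)" if "a \<in> A" for a
    using member_le_sum[of a A "\<lambda>a. \<bar>f a\<bar>"] that by force
  moreover have "0 \<le> (\<Sum>a\<in>A. \<bar>f a\<bar>)" by (rule sum_nonneg) simp
  ultimately show ?thesis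
    by (intro exI[of _ "(\<Sum>a\<in>A. \<bar>f a\<bar>) + 1"] conjI ballI) (linarith, meson add_increasing2 zero_le_one)
qed

lemma C1_local_lipschitz:
  fixes f :: "'e::euclidean_space \<Rightarrow> 'f::real_normed_vector"
  assumes f: "Ck_on 1 f S" and sub: "cball z r \<subseteq> S"
  shows "\<exists>L>0. \<forall>x\<in>cball z r. \<forall>y\<in>cball z r. norm (f x - f y) \<le> L * norm (x - y)"
proof -
  let ?D = "\<lambda>x. frechet_derivative f (at x)"
  have D: "(f has_derivative ?D x) (at x)" if "x \<in> S" for x
    using f that by (simp add: frechet_derivative_works)
  have "\<exists>B>0. \<forall>x\<in>cball z r. norm (?D x b) \<le> B" for b
  proof -
    have "continuous_on S (\<lambda>x. ?D x b)" using f by simp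
    then have "continuous_on (cball z r) (\<lambda>x. ?D x b)" by (rule continuous_on_subset[OF _ sub])
    then have "bounded ((\<lambda>x. ?D x b) ` cball z r)"
      by (intro compact_imp_bounded compact_continuous_image) auto
    then show ?thesis by (auto simp: bounded_pos)
  qed
  then obtain B where B: "\<And>b. B b > 0" "\<And>b x. x \<in> cball z r \<Longrightarrow> norm (?D x b) \<le> B b" by metis
  define L where "L = (\<Sum>b\<in>(Basis::'e set). B b)"
  have L: "L > 0" unfolding L_def by (rule sum_pos) (auto simp: B)
  have on: "onorm (?D x) \<le> L" if x: "x \<in> cball z r" for x
  proof (rule onorm_le)
    fix v
    have lin: "linear (?D x)" using D[of x] x sub has_derivative_linear by blast
    have "?D x v = ?D x (\<Sum>b\<in>Basis. (v \<bullet> b) *\<^sub>R b)" by (simp add: euclidean_representation)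
    also have "\<dots> = (\<Sum>b\<in>Basis. (v \<bullet> b) *\<^sub>R ?D x b)" using lin by (simp add: linear_sum linear_scale)
    also have "norm \<dots> \<le> (\<Sum>b\<in>Basis. norm v * B b)"
      by (rule sum_norm_le) (use x B in \<open>auto intro!: mult_mono Basis_le_norm\<close>)
    also have "\<dots> = L * norm v" unfolding L_def sum_distrib_left[symmetric] by (rule mult.commute)
    finally show "norm (?D x v) \<le> L * norm v" .
  qed
  have "norm (f x - f y) \<le> L * norm (x - y)" if "x \<in> cball z r" "y \<in> cball z r" for x y
    by (rule differentiable_bound[OF convex_cball _ on that(2) that(1), simplified norm_minus_commute])
      (use D sub has_derivative_at_withinI in blast)+
  then show ?thesis using L by blast
qed

context closed_rmanifold
begin

lemma good_ball_mono:
  "good_ball c z r k C \<Longrightarrow> 0 < k' \<Longrightarrow> k' \<le> k \<Longrightarrow> C \<le> C' \<Longrightarrow> 0 < r' \<Longrightarrow> r' \<le> r \<Longrightarrow> good_ball c z r' k' C'"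
proof -
  assume gb: "good_ball c z r k C" and k: "0 < k'" "k' \<le> k" "C \<le> C'" and r: "0 < r'" "r' \<le> r"
  have sub: "cball z r' \<subseteq> cball z r" using r by auto
  show ?thesis
    unfolding good_ball_def
  proof (intro conjI ballI allI)
    fix w v assume "w \<in> cball z r'"
    then have w: "k * norm v \<le> sqrt (riem M c (chart_inv c w) v v)" "sqrt (riem M c (chart_inv c w) v v) \<le> C * norm v"
      using gb sub unfolding good_ball_def by blast+
    show "k' * norm v \<le> sqrt (riem M c (chart_inv c w) v v)" 
      using w(1) mult_right_mono[OF k(2) norm_ge_zero[of v]] by linarith
    show "sqrt (riem M c (chart_inv c w) v v) \<le> C' * norm v"
      using w(2) mult_right_mono[OF k(3) norm_ge_zero[of v]] by linarith
  qed (use gb k r sub in \<open>auto simp: good_ball_def\<close>)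
qed

text \<open>Here \<open>r0\<close> is a Lebesgue number of the cover by half balls: points at distance less than \<open>r0\<close> lie in a
  common ball of the finite family, with constants \<open>k\<close> and \<open>C\<close> that serve all balls.\<close>

lemma finite_charts:
  assumes Q: "\<And>p. p \<in> pts M \<Longrightarrow> \<exists>c z r k C. good_ball c z r k C \<and> p \<in> fst c \<and> snd c p = z \<and> Q c z r"
  obtains F r0 k C where "finite F" "r0 > 0" "k > 0" "C > 0"
    "\<And>c z r. (c, z, r) \<in> F \<Longrightarrow> good_ball c z r k C \<and> Q c z r"
    "\<And>x. x \<in> pts M \<Longrightarrow> \<exists>c z r. (c, z, r) \<in> F \<and> x \<in> fst c \<and> snd c x \<in> ball z (r/2) \<and>
       (\<forall>y\<in>pts M. mdist M x y < r0 \<longrightarrow> y \<in> fst c \<and> snd c y \<in> ball z r \<and>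
          k * norm (snd c y - snd c x) \<le> mdist M x y)"
proof -
  have "\<forall>p\<in>pts M. \<exists>c z r k C. good_ball c z r k C \<and> p \<in> fst c \<and> snd c p = z \<and> Q c z r" using Q by blast
  from this[unfolded bchoice_iff] obtain c z r k C where
    P: "\<And>p. p \<in> pts M \<Longrightarrow> good_ball (c p) (z p) (r p) (k p) (C p) \<and> p \<in> fst (c p) \<and> snd (c p) p = z p \<and> Q (c p) (z p) (r p)"
    unfolding bchoice_iff by blast
  have pos: "c p \<in> atlas M" "0 < r p" "0 < k p" "0 < C p" if "p \<in> pts M" for p
    using P[OF that] by (auto simp: good_ball_def)
  define G where "G p = {q\<in>fst (c p). snd (c p) q \<in> ball (z p) (r p/2)}" for p
  have "\<exists>\<F>. finite \<F> \<and> \<F> \<subseteq> G ` pts M \<and> pts M \<subseteq> \<Union>\<F>"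
  proof (rule compactinD)
    show "compactin (mtop M) (pts M)" using compact_M by (simp add: compact_space_def)
    show "openin (mtop M) U" if "U \<in> G ` pts M" for U
    proof -
      obtain p where p: "p \<in> pts M" "U = G p" using \<open>U \<in> G ` pts M\<close> by blast
      show ?thesis unfolding p(2) G_def by (rule chart_preimage_open[OF pos(1)[OF p(1)] open_ball])
    qed
    show "pts M \<subseteq> \<Union>(G ` pts M)" using P pos by (auto simp: G_def intro!: bexI)
  qed
  then obtain P0 where P0: "finite P0" "P0 \<subseteq> pts M" "pts M \<subseteq> \<Union>(G ` P0)" by (metis finite_subset_image)
  then have ne: "P0 \<noteq> {}" using pts_nonempty by auto
  define k0 where "k0 = Min (k ` P0)"
  define C0 where "C0 = Max (C ` P0)"
  define r0 where "r0 = Min ((\<lambda>p. k0 * (r p / 2)) ` P0)"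
  have k0: "k0 > 0" "\<And>p. p \<in> P0 \<Longrightarrow> k0 \<le> k p"
    using P0 ne pos by (auto simp: k0_def)
  have C0: "\<And>p. p \<in> P0 \<Longrightarrow> C p \<le> C0" using P0 ne by (auto simp: C0_def)
  have "k0 * (r p / 2) > 0" if "p \<in> P0" for p using that P0 pos(2)[of p] k0 by auto
  then have r0: "r0 > 0" "\<And>p. p \<in> P0 \<Longrightarrow> r0 \<le> k0 * (r p / 2)"
    unfolding r0_def using P0 ne by (simp add: Min_gr_iff, intro Min_le) auto
  have gb: "good_ball (c p) (z p) (r p) k0 C0" if "p \<in> P0" for p
  proof -
    have "p \<in> pts M" using that P0 by blast
    then show ?thesis using P[of p] pos(2)[of p] k0 C0[OF that] that
      by (auto intro: good_ball_mono[of "c p" "z p" "r p" "k p" "C p" k0 C0 "r p"])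
  qed
  show thesis
  proof (rule that[of "(\<lambda>p. (c p, z p, r p)) ` P0" r0 k0 C0])
    show "C0 > 0" using ne gb by (auto simp: good_ball_def)
    show "good_ball c' z' r' k0 C0 \<and> Q c' z' r'" if "(c', z', r') \<in> (\<lambda>p. (c p, z p, r p)) ` P0" for c' z' r'
      using that gb P P0 by auto
    fix x assume "x \<in> pts M"
    then obtain p where p: "p \<in> P0" "x \<in> fst (c p)" "snd (c p) x \<in> ball (z p) (r p/2)"
      using P0 by (auto simp: G_def)
    have rp: "r p > 0" using pos p P0 by blast
    have sub: "cball (snd (c p) x) (r p/2) \<subseteq> cball (z p) (r p)"
    proof
      fix y assume "y \<in> cball (snd (c p) x) (r p/2)"
      then show "y \<in> cball (z p) (r p)" using p(3) dist_triangle[of "z p" y "snd (c p) x"] by auto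
    qed
    have "y \<in> fst (c p) \<and> snd (c p) y \<in> ball (z p) (r p) \<and> k0 * norm (snd (c p) y - snd (c p) x) \<le> mdist M x y"
      if y: "y \<in> pts M" "mdist M x y < r0" for y
    proof -
      have l: "mdist M x y < k0 * (r p/2)" using y r0(2)[OF p(1)] by simp
      note m = chart_le_mdist[OF gb[OF p(1)] p(2) _ sub y(1) l]
      have "k0 * norm (snd (c p) y - snd (c p) x) < k0 * (r p/2)" using m(2) l rp by simp
      then have "dist (snd (c p) x) (snd (c p) y) < r p/2" using k0 by (simp add: dist_norm norm_minus_commute)
      then have "snd (c p) y \<in> ball (z p) (r p)"
        using p(3) dist_triangle[of "z p" "snd (c p) y" "snd (c p) x"] by auto
      then show ?thesis using m rp by simp
    qed
    then show "\<exists>c' z' r'. (c', z', r') \<in> (\<lambda>p. (c p, z p, r p)) ` P0 \<and> x \<in> fst c' \<and> snd c' x \<in> ball z' (r'/2) \<and>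
       (\<forall>y\<in>pts M. mdist M x y < r0 \<longrightarrow> y \<in> fst c' \<and> snd c' y \<in> ball z' r' \<and>
          k0 * norm (snd c' y - snd c' x) \<le> mdist M x y)"
      using p by (intro exI[of _ "c p"] exI[of _ "z p"] exI[of _ "r p"]) auto
  qed (use P0 r0 k0 in auto)
qed

lemma finite_charts_plain:
  obtains F k C where "finite F" "k > 0" "C > 0"
    "\<And>c z r. (c, z, r) \<in> F \<Longrightarrow> good_ball c z r k C"
    "\<And>x. x \<in> pts M \<Longrightarrow> \<exists>c z r. (c, z, r) \<in> F \<and> x \<in> fst c \<and> snd c x \<in> ball z (r/2)"
proof (rule finite_charts[of "\<lambda>_ _ _. True"])
  fix p assume "p \<in> pts M"
  then show "\<exists>c z r k C. good_ball c z r k C \<and> p \<in> fst c \<and> snd c p = z \<and> True" using good_ball_at by blast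
next
  fix F and r0 k C :: real
  assume "finite F" "r0 > 0" "k > 0" "C > 0"
    "\<And>c z r. (c, z, r) \<in> F \<Longrightarrow> good_ball c z r k C \<and> True"
    "\<And>x. x \<in> pts M \<Longrightarrow> \<exists>c z r. (c, z, r) \<in> F \<and> x \<in> fst c \<and> snd c x \<in> ball z (r/2) \<and>
       (\<forall>y\<in>pts M. mdist M x y < r0 \<longrightarrow> y \<in> fst c \<and> snd c y \<in> ball z r \<and>
          k * norm (snd c y - snd c x) \<le> mdist M x y)"
  then show thesis by (intro that[of F k C]) blast+
qed

lemma diameter_bound: obtains D where "D > 0" "\<And>x y. x \<in> pts M \<Longrightarrow> y \<in> pts M \<Longrightarrow> mdist M x y \<le> D"
proof -
  obtain F k C where F: "finite F" "k > 0" "C > 0"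
    "\<And>c z r. (c, z, r) \<in> F \<Longrightarrow> good_ball c z r k C"
    "\<And>x. x \<in> pts M \<Longrightarrow> \<exists>c z r. (c, z, r) \<in> F \<and> x \<in> fst c \<and> snd c x \<in> ball z (r/2)"
    by (rule finite_charts_plain) (rule that, assumption+)
  define e where "e f = (case f of (c, z, r) \<Rightarrow> chart_inv c z)" for f :: "('a, 'e) chart \<times> 'e \<times> real"
  obtain R where R: "R > 0" "\<forall>f\<in>F. (case f of (c, z, r) \<Rightarrow> r) \<le> R" using finite_bound[OF F(1)] by metis
  obtain E where E: "E > 0" "\<forall>f\<in>F \<times> F. mdist M (e (fst f)) (e (snd f)) \<le> E"
    using finite_bound[of "F \<times> F" "\<lambda>f. mdist M (e (fst f)) (e (snd f))"] F(1) by auto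
  have near: "\<exists>f\<in>F. mdist M x (e f) \<le> C * R \<and> e f \<in> pts M" if x: "x \<in> pts M" for x
  proof -
    obtain c z r where f: "(c, z, r) \<in> F" "x \<in> fst c" "snd c x \<in> ball z (r/2)" using F(5)[OF x] by blast
    note gb = F(4)[OF f(1)]
    have r: "r > 0" "cball z r \<subseteq> snd c ` fst c" "c \<in> atlas M" using gb by (auto simp: good_ball_def)
    have "r \<le> R" using R(2) f(1) by fastforce
    have z: "z \<in> snd c ` fst c" using r by auto
    have e: "e (c, z, r) \<in> fst c" "snd c (e (c, z, r)) = z"
      using chart_inv_dom[OF z] chart_inv_right[OF z] by (auto simp: e_def)
    have "mdist M x (e (c,z,r)) \<le> C * norm (snd c (e (c,z,r)) - snd c x)"
      by (rule mdist_le_chart[OF gb f(2) e(1)]) (use f r e in auto)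
    also have "\<dots> \<le> C * R" using e f(3) r \<open>r \<le> R\<close> F(3) by (intro mult_left_mono) (auto simp: dist_norm)
    finally show ?thesis using f(1) e(1) r chart_dom_pts by blast
  qed
  have "mdist M x y \<le> C * R + E + C * R" if xy: "x \<in> pts M" "y \<in> pts M" for x y
  proof -
    obtain f where f: "f \<in> F" "mdist M x (e f) \<le> C * R" "e f \<in> pts M" using near[OF xy(1)] by blast
    obtain g where g: "g \<in> F" "mdist M y (e g) \<le> C * R" "e g \<in> pts M" using near[OF xy(2)] by blast
    have "mdist M (e f) (e g) \<le> E" using E(2) f g by auto
    then show ?thesis
      using mdist_triangle[OF xy(1) f(3) xy(2)] mdist_triangle[OF f(3) g(3) xy(2)] mdist_sym[OF xy(2) g(3)] f g by linarith
  qed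
  then show thesis using that[of "C * R + E + C * R"] F(3) R E by (simp add: add_pos_pos)
qed

text \<open>Points with equal integer parts of their chart coordinates, scaled by \<open>N\<close>, are close, and there are
  polynomially many combinations of integer parts.\<close>

lemma covering_number:
  obtains B where "B > 0" "\<And>\<eta>. 0 < \<eta> \<Longrightarrow> \<eta> \<le> 1 \<Longrightarrow> \<exists>P. P \<subseteq> pts M \<and> finite P \<and>
     real (card P) \<le> B * (1/\<eta>) ^ DIM('e) \<and> (\<forall>x\<in>pts M. \<exists>y\<in>P. mdist M x y < \<eta>)"
proof -
  obtain F k C where F: "finite F" "k > 0" "C > 0"
    "\<And>c z r. (c, z, r) \<in> F \<Longrightarrow> good_ball c z r k C"
    "\<And>x. x \<in> pts M \<Longrightarrow> \<exists>c z r. (c, z, r) \<in> F \<and> x \<in> fst c \<and> snd c x \<in> ball z (r/2)"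
    by (rule finite_charts_plain) (rule that, assumption+)
  have Fne: "F \<noteq> {}" using F(5) pts_nonempty by blast
  obtain R where R: "R > 0" "\<forall>f\<in>F. (case f of (c, z, r) \<Rightarrow> norm z + r) \<le> R" using finite_bound[OF F(1)] by metis
  have "\<forall>x. \<exists>f. x \<in> pts M \<longrightarrow> f \<in> F \<and> x \<in> fst (fst f) \<and> snd (fst f) x \<in> ball (fst (snd f)) (snd (snd f)/2)"
    using F(5) by fastforce
  then obtain g where g: "\<And>x. x \<in> pts M \<Longrightarrow> g x \<in> F \<and> x \<in> fst (fst (g x)) \<and>
      snd (fst (g x)) x \<in> ball (fst (snd (g x))) (snd (snd (g x))/2)" by metis
  define d where "d = real DIM('e)"
  define a where "a = C * d + 1"
  have a: "a \<ge> 1" using F by (simp add: a_def d_def)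
  define B where "B = card F * (2 * a * R + 3) ^ DIM('e)"
  show thesis
  proof (rule that[of B])
    show "B > 0" using Fne F(1) R a by (auto simp: B_def card_gt_0_iff intro!: mult_pos_pos zero_less_power add_pos_pos)
    fix \<eta> :: real assume \<eta>: "0 < \<eta>" "\<eta> \<le> 1"
    define N where "N = a / \<eta>"
    have N: "N > 0" using a \<eta> by (simp add: N_def)
    define Z where "Z = \<lceil>N * R\<rceil>"
    define code where "code x = (g x, \<lambda>b\<in>Basis. \<lfloor>N * (snd (fst (g x)) x \<bullet> b)\<rfloor>)" for x
    let ?K = "F \<times> (PiE (Basis::'e set) (\<lambda>_. {-Z..Z}))"
    have fin: "finite ?K" using F(1) by (intro finite_cartesian_product finite_PiE) auto
    have sub: "code ` pts M \<subseteq> ?K"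
    proof
      fix q assume "q \<in> code ` pts M"
      then obtain x where x: "x \<in> pts M" "q = code x" by blast
      obtain c z r where f: "g x = (c, z, r)" using prod_cases3 by blast
      then have xs: "(c, z, r) \<in> F" "snd c x \<in> ball z (r/2)" using g[OF x(1)] by auto
      then have "r > 0" using F(4) by (auto simp: good_ball_def)
      have "norm z + r \<le> R" using R(2) xs(1) by fastforce
      moreover have "norm (snd c x) \<le> norm z + r"
        using xs(2) \<open>r > 0\<close> norm_triangle_ineq2[of "snd c x" z] by (auto simp: dist_norm norm_minus_commute)
      ultimately have nR: "norm (snd c x) \<le> R" by linarith
      have "\<lfloor>N * (snd c x \<bullet> b)\<rfloor> \<in> {-Z..Z}" if "b \<in> Basis" for b
      proof -
        have "\<bar>snd c x \<bullet> b\<bar> \<le> R" using Basis_le_norm[OF that, of "snd c x"] nR by linarith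
        then have "\<bar>N * (snd c x \<bullet> b)\<bar> \<le> N * R" using N by (simp add: abs_mult)
        moreover have "N * R \<le> of_int Z" unfolding Z_def by simp
        ultimately have "N * (snd c x \<bullet> b) \<le> of_int Z" "of_int (-Z) \<le> N * (snd c x \<bullet> b)" by auto
        then show ?thesis by (auto simp: le_floor_iff floor_le_iff)
      qed
      then show "q \<in> ?K" using x(2) xs(1) f by (auto simp: code_def)
    qed
    obtain P where P: "P \<subseteq> pts M" "finite P" "card P \<le> card ?K" "\<And>x. x \<in> pts M \<Longrightarrow> \<exists>y\<in>P. code y = code x"
      by (rule few_codes[OF fin sub]) (rule that, assumption+)
    have Z0: "Z \<ge> 0" using mult_pos_pos[OF N R(1)] by (simp add: Z_def)
    have "real (card ?K) = real (card F) * (2 * real_of_int Z + 1) ^ DIM('e)"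
      using Z0 by (simp add: card_cartesian_product card_PiE algebra_simps)
    also have "\<dots> \<le> card F * ((2 * a * R + 3) * (1/\<eta>)) ^ DIM('e)"
    proof (intro mult_left_mono power_mono)
      have "real_of_int Z \<le> N * R + 1" unfolding Z_def using of_int_ceiling_le_add_one by blast
      then have "2 * real_of_int Z + 1 \<le> 2 * (N * R) + 3" by linarith
      also have "\<dots> \<le> 2 * (N * R) + 3 / \<eta>" using \<eta> by (simp add: field_simps)
      also have "\<dots> = (2 * a * R + 3) * (1/\<eta>)" by (simp add: N_def add_divide_distrib)
      finally show "2 * real_of_int Z + 1 \<le> (2 * a * R + 3) * (1/\<eta>)" .
    qed (use Z0 in auto)
    also have "\<dots> = B * (1/\<eta>) ^ DIM('e)" unfolding B_def power_mult_distrib by simp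
    finally have "real (card P) \<le> B * (1/\<eta>) ^ DIM('e)" using P(3) by linarith
    moreover have "\<exists>y\<in>P. mdist M x y < \<eta>" if x: "x \<in> pts M" for x
    proof -
      obtain y where y: "y \<in> P" "code y = code x" using P(4)[OF x] by blast
      then have yp: "y \<in> pts M" using P by blast
      obtain c z r where f: "g x = (c, z, r)" using prod_cases3 by blast
      have gy: "g y = (c, z, r)" using y f by (simp add: code_def)
      have xs: "(c, z, r) \<in> F" "x \<in> fst c" "snd c x \<in> ball z (r/2)" "y \<in> fst c" "snd c y \<in> ball z (r/2)"
        using g[OF x] g[OF yp] f gy by auto
      have r: "r > 0" using F(4)[OF xs(1)] by (auto simp: good_ball_def)
      have "norm (snd c y - snd c x) \<le> (\<Sum>b\<in>Basis. \<bar>(snd c y - snd c x) \<bullet> b\<bar>)" by (rule norm_le_l1)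
      also have "\<dots> \<le> (\<Sum>b\<in>(Basis::'e set). 1 / N)"
      proof (rule sum_mono)
        fix b :: 'e assume b: "b \<in> Basis"
        have "snd (code y) b = snd (code x) b" using y by simp
        then have "\<lfloor>N * (snd c y \<bullet> b)\<rfloor> = \<lfloor>N * (snd c x \<bullet> b)\<rfloor>" using b f gy by (simp add: code_def)
        then have "\<bar>N * (snd c y \<bullet> b) - N * (snd c x \<bullet> b)\<bar> \<le> 1" by linarith
        then have "N * \<bar>(snd c y - snd c x) \<bullet> b\<bar> \<le> 1" using N
          by (simp add: inner_diff_left abs_mult right_diff_distrib[symmetric])
        then show "\<bar>(snd c y - snd c x) \<bullet> b\<bar> \<le> 1 / N" using N by (simp add: field_simps)
      qed
      also have "\<dots> = d / N" by (simp add: d_def)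
      finally have n: "norm (snd c y - snd c x) \<le> d / N" .
      have "mdist M x y \<le> C * norm (snd c y - snd c x)"
        by (rule mdist_le_chart[OF F(4)[OF xs(1)]]) (use xs r in auto)
      also have "\<dots> \<le> C * (d / N)" using n F(3) by (intro mult_left_mono) auto
      also have "\<dots> < \<eta>"
      proof -
        have "C * d * \<eta> < a * \<eta>" using \<eta> by (simp add: a_def)
        then show ?thesis using a \<eta> by (simp add: N_def field_simps)
      qed
      finally show ?thesis using y by blast
    qed
    ultimately show "\<exists>P. P \<subseteq> pts M \<and> finite P \<and>
     real (card P) \<le> B * (1/\<eta>) ^ DIM('e) \<and> (\<forall>x\<in>pts M. \<exists>y\<in>P. mdist M x y < \<eta>)" using P by blast
  qed
qed

end

section \<open>Local solutions and uniqueness of integral curves\<close>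

lemma vector_derivative_bound:
  fixes G :: "real \<Rightarrow> 'e::real_normed_vector"
  assumes d: "\<And>t. t \<in> {a..b} \<Longrightarrow> (G has_vector_derivative g t) (at t within {a..b})"
    and g: "\<And>t. t \<in> {a..b} \<Longrightarrow> norm (g t) \<le> B" and st: "s \<in> {a..b}" "t \<in> {a..b}"
  shows "norm (G s - G t) \<le> B * \<bar>s - t\<bar>"
proof -
  have "norm (G s - G t) \<le> B * norm (s - t)"
  proof (rule differentiable_bound[of "{a..b}" G "\<lambda>x h. h *\<^sub>R g x"])
    show "(G has_derivative (\<lambda>h. h *\<^sub>R g x)) (at x within {a..b})" if "x \<in> {a..b}" for x
      using d[OF that] by (simp add: has_vector_derivative_def)
    show "onorm (\<lambda>h. h *\<^sub>R g x) \<le> B" if "x \<in> {a..b}" for x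
    proof (rule onorm_le)
      show "norm (h *\<^sub>R g x) \<le> B * norm h" for h
        using mult_left_mono[OF g[OF that] norm_ge_zero[of h]] by (simp add: mult.commute)
    qed
  qed (use st in auto)
  then show ?thesis by simp
qed

lemma Ck1_continuous: "Ck_on 1 f S \<Longrightarrow> continuous_on S f"
  by (rule differentiable_imp_continuous_on)
    (simp add: differentiable_on_def differentiable_at_withinI)

text \<open>Composing \<open>f\<close> with the nearest-point projection onto the ball makes it globally Lipschitz and bounded, so the
  integral operator contracts a space of bounded functions on the whole line; time is clipped to the interval.
  The solution cannot leave the ball, where \<open>f\<close> is unchanged. Integrals start at \<open>- \<tau>\<close> to avoid oriented
  integrals.\<close>

lemma picard:
  fixes f :: "'e::euclidean_space \<Rightarrow> 'e"
  assumes lip: "\<And>x y. x \<in> cball z0 (2*r) \<Longrightarrow> y \<in> cball z0 (2*r) \<Longrightarrow> norm (f x - f y) \<le> L * norm (x - y)"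
    and bd: "\<And>x. x \<in> cball z0 (2*r) \<Longrightarrow> norm (f x) \<le> B"
    and \<tau>: "0 < \<tau>" "B * \<tau> \<le> r" "L * \<tau> \<le> 1/2" and pos: "0 < r" "0 < L" "0 < B" and z: "z \<in> cball z0 r"
  obtains u where "u 0 = z" "\<And>t. t \<in> {-\<tau>..\<tau>} \<Longrightarrow> u t \<in> cball z0 (2*r)"
    "\<And>t. t \<in> {-\<tau>..\<tau>} \<Longrightarrow> (u has_vector_derivative f (u t)) (at t within {-\<tau>..\<tau>})"
proof -
  let ?K = "cball z0 (2*r)"
  let ?I = "{-\<tau>..\<tau>}"
  have K: "convex ?K" "closed ?K" "?K \<noteq> {}" using pos by auto
  define F where "F w = f (closest_point ?K w)" for w
  have inK: "closest_point ?K w \<in> ?K" for w by (rule closest_point_in_set[OF K(2,3)])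
  have Flip: "norm (F v - F w) \<le> L * norm (v - w)" for v w
  proof -
    have "norm (F v - F w) \<le> L * norm (closest_point ?K v - closest_point ?K w)"
      unfolding F_def by (rule lip[OF inK inK])
    also have "\<dots> \<le> L * norm (v - w)"
      using closest_point_lipschitz[OF K, of v w] pos by (intro mult_left_mono) (auto simp: dist_norm)
    finally show ?thesis .
  qed
  have Fbd: "norm (F w) \<le> B" for w unfolding F_def by (rule bd[OF inK])
  have Fcont: "continuous_on UNIV F"
    by (rule lipschitz_on_continuous_on[of L]) (use Flip pos in \<open>auto simp: lipschitz_on_def dist_norm\<close>)
  define clip where "clip t = max (-\<tau>) (min \<tau> t)" for t :: real
  have clip: "clip t \<in> ?I" "continuous_on UNIV clip" for t
    using \<tau> by (auto simp: clip_def[abs_def] intro!: continuous_intros)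
  have clip_id: "clip t = t" if "t \<in> ?I" for t using that by (auto simp: clip_def)
  define G where "G u t = integral {-\<tau>..t} (\<lambda>s. F (apply_bcontfun u s))" for u :: "real \<Rightarrow>\<^sub>C 'e" and t
  have Gd: "(G u has_vector_derivative F (apply_bcontfun u t)) (at t within ?I)" if "t \<in> ?I" for u t
    unfolding G_def
    by (rule integral_has_vector_derivative[OF _ that])
      (intro continuous_on_compose2[OF Fcont] continuous_on_apply_bcontfun, auto)
  have I0: "0 \<in> ?I" using \<tau> by auto
  define p where "p u t = z + (G u (clip t) - G u 0)" for u t
  have pz: "norm (p u t - z) \<le> B * \<tau>" for u t
  proof -
    have "norm (G u (clip t) - G u 0) \<le> B * \<bar>clip t - 0\<bar>"
      by (rule vector_derivative_bound[OF Gd Fbd clip(1) I0])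
    also have "\<dots> \<le> B * \<tau>" using clip(1)[of t] pos by (intro mult_left_mono) auto
    finally show ?thesis by (simp add: p_def)
  qed
  have pb: "p u \<in> bcontfun" for u
  proof (rule bcontfun_normI)
    have "continuous_on ?I (G u)"
      using Gd by (intro continuous_on_vector_derivative)
    then have "continuous_on UNIV (\<lambda>t. G u (clip t))"
      by (rule continuous_on_compose2[OF _ clip(2)]) (use clip in auto)
    then show "continuous_on UNIV (p u)" unfolding p_def by (intro continuous_intros)
    show "norm (p u t) \<le> norm z + B * \<tau>" for t
      using pz[of u t] norm_triangle_sub[of "p u t" z] by linarith
  qed
  have pc: "dist (Bcontfun (p u)) (Bcontfun (p w)) \<le> 1/2 * dist u w" for u w
  proof (rule dist_bound)
    fix t
    have "norm ((G u (clip t) - G w (clip t)) - (G u 0 - G w 0)) \<le> (L * dist u w) * \<bar>clip t - 0\<bar>"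
    proof (rule vector_derivative_bound[OF _ _ clip(1) I0])
      fix s assume s: "s \<in> ?I"
      show "((\<lambda>t. G u t - G w t) has_vector_derivative F (apply_bcontfun u s) - F (apply_bcontfun w s)) (at s within ?I)"
        by (intro has_vector_derivative_diff Gd s)
      have "norm (F (apply_bcontfun u s) - F (apply_bcontfun w s)) \<le> L * norm (apply_bcontfun u s - apply_bcontfun w s)" by (rule Flip)
      also have "\<dots> \<le> L * dist u w"
        using dist_bounded[of u s w] pos by (intro mult_left_mono) (auto simp: dist_norm)
      finally show "norm (F (apply_bcontfun u s) - F (apply_bcontfun w s)) \<le> L * dist u w" .
    qed
    also have "\<dots> \<le> (L * dist u w) * \<tau>" using clip(1)[of t] pos by (intro mult_left_mono) auto
    also have "\<dots> = (L * \<tau>) * dist u w" by simp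
    also have "\<dots> \<le> 1/2 * dist u w" by (rule mult_right_mono[OF \<tau>(3)]) simp
    finally show "dist (apply_bcontfun (Bcontfun (p u)) t) (apply_bcontfun (Bcontfun (p w)) t) \<le> 1/2 * dist u w"
      by (simp add: Bcontfun_inverse[OF pb] p_def dist_norm algebra_simps)
  qed
  have "\<exists>!u. Bcontfun (p u) = u"
    by (rule banach_fix_type[of "1/2"]) (use pc in auto)
  then obtain u where u: "Bcontfun (p u) = u" by blast
  have ut: "apply_bcontfun u t = p u t" for t using Bcontfun_inverse[OF pb, of u] u by simp
  have uz: "norm (apply_bcontfun u t - z) \<le> r" for t using pz[of u t] \<tau>(2) ut by simp
  have uK: "apply_bcontfun u t \<in> ?K" for t
    using uz[of t] z dist_triangle[of z0 "apply_bcontfun u t" z] by (auto simp: dist_norm norm_minus_commute)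
  show thesis
  proof (rule that[of "apply_bcontfun u"])
    show "apply_bcontfun u 0 = z" using clip_id[OF I0] by (simp add: ut p_def)
    show "apply_bcontfun u t \<in> ?K" for t by (rule uK)
    fix t assume t: "t \<in> ?I"
    have "((\<lambda>t. z + (G u t - G u 0)) has_vector_derivative F (apply_bcontfun u t)) (at t within ?I)"
      by (auto intro!: derivative_eq_intros Gd t)
    then have "(apply_bcontfun u has_vector_derivative F (apply_bcontfun u t)) (at t within ?I)"
      by (rule has_vector_derivative_transform[OF t, rotated]) (simp add: ut p_def clip_id)
    then show "(apply_bcontfun u has_vector_derivative f (apply_bcontfun u t)) (at t within ?I)"
      by (simp add: F_def closest_point_self[OF uK])
  qed
qed

text \<open>On a time interval so short that \<open>L \<sigma> \<le> 1/2\<close>, comparing with the maximum over the interval replaces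
  Gronwall's inequality.\<close>

lemma ode_close:
  fixes u :: "real \<Rightarrow> 'e::real_normed_vector"
  assumes u: "\<And>t. t \<in> {-\<sigma>..\<sigma>} \<Longrightarrow> (u has_vector_derivative u' t) (at t within {-\<sigma>..\<sigma>})"
    and u': "\<And>t. t \<in> {-\<sigma>..\<sigma>} \<Longrightarrow> norm (u' t) \<le> L * norm (u t) + a"
    and \<sigma>: "0 \<le> \<sigma>" "0 \<le> L" "L * \<sigma> \<le> 1/2" and t: "t \<in> {-\<sigma>..\<sigma>}"
  shows "norm (u t) \<le> 2 * norm (u 0) + 2 * a * \<sigma>"
proof -
  have "continuous_on {-\<sigma>..\<sigma>} u" using u by (intro continuous_on_vector_derivative)
  then have "continuous_on {-\<sigma>..\<sigma>} (\<lambda>t. norm (u t))" by (intro continuous_intros)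
  then obtain m where m: "m \<in> {-\<sigma>..\<sigma>}" "\<And>t. t \<in> {-\<sigma>..\<sigma>} \<Longrightarrow> norm (u t) \<le> norm (u m)"
    using continuous_attains_sup[of "{-\<sigma>..\<sigma>}" "\<lambda>t. norm (u t)"] t by (metis compact_Icc empty_iff)
  have a: "0 \<le> L * norm (u m) + a" using order_trans[OF norm_ge_zero u'[OF m(1)]] .
  have "norm (u m - u 0) \<le> (L * norm (u m) + a) * \<bar>m - 0\<bar>"
  proof (rule vector_derivative_bound[OF u])
    fix s assume s: "s \<in> {-\<sigma>..\<sigma>}"
    show "norm (u' s) \<le> L * norm (u m) + a"
      using u'[OF s] mult_left_mono[OF m(2)[OF s] \<sigma>(2)] by linarith
  qed (use m \<sigma> in auto)
  also have "\<dots> \<le> (L * norm (u m) + a) * \<sigma>" using m(1) \<sigma> a by (intro mult_left_mono) auto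
  also have "\<dots> = (L * \<sigma>) * norm (u m) + a * \<sigma>" by (simp add: algebra_simps)
  also have "\<dots> \<le> 1/2 * norm (u m) + a * \<sigma>" using mult_right_mono[OF \<sigma>(3), of "norm (u m)"] by simp
  finally have "norm (u m) \<le> 2 * norm (u 0) + 2 * a * \<sigma>" using norm_triangle_sub[of "u m" "u 0"] by linarith
  then show ?thesis using m(2)[OF t] by linarith
qed

locale closed_rmanifold_field = closed_rmanifold M for M :: "('a, 'e::euclidean_space) riem_manifold" +
  fixes X :: "('a, 'e) vector_field"
  assumes C1: "C1_vector_field M X"
begin

abbreviation V where "V \<equiv> vf_norm M X"

lemma tangent: "c \<in> atlas M \<Longrightarrow> d \<in> atlas M \<Longrightarrow> p \<in> fst c \<Longrightarrow> p \<in> fst d \<Longrightarrow> X d p = coord_change c d p (X c p)"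
  using C1 unfolding C1_vector_field_def tangent_field_def by blast

lemma field_C1: "c \<in> atlas M \<Longrightarrow> Ck_on 1 (\<lambda>z. X c (chart_inv c z)) (snd c ` fst c)"
  using C1 unfolding C1_vector_field_def by blast

lemma vf_norm_chart:
  assumes "c \<in> atlas M" "p \<in> fst c" shows "V p = sqrt (riem M c p (X c p) (X c p))"
  unfolding vf_norm_def using tangent[OF assms(1) chart_at(1) assms(2) chart_at(2)] chart_dom_pts[OF assms]
  by (simp add: tnorm_chart[OF assms])

lemma vf_norm_nonneg: "p \<in> pts M \<Longrightarrow> 0 \<le> V p"
  using vf_norm_chart[OF chart_at] riem_ge0[OF chart_at] by simp

lemma vf_norm_zero_iff:
  assumes "c \<in> atlas M" "p \<in> fst c" shows "V p = 0 \<longleftrightarrow> X c p = 0"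
  using vf_norm_chart[OF assms] riem_pos[OF assms, of "X c p"] riem_bilinear[OF assms]
  by (cases "X c p = 0") (auto simp: bilinear_lzero)

lemma Sing_iff: "p \<in> pts M \<Longrightarrow> p \<in> Sing M X \<longleftrightarrow> V p = 0"
  using vf_norm_zero_iff chart_at unfolding Sing_def by blast

lemma vf_norm_continuous: "continuous_map (mtop M) euclideanreal V"
proof (rule pasting_lemma[where I = "atlas M" and T = fst and f = "\<lambda>_. V"])
  fix c assume c: "c \<in> atlas M"
  show "openin (mtop M) (fst c)" by (rule chart_dom_open[OF c])
  have "continuous_on (snd c ` fst c) (\<lambda>z. X c (chart_inv c z))"
    by (rule Ck1_continuous[OF field_C1[OF c]])
  then have "continuous_on (snd c ` fst c) (\<lambda>z. (\<lambda>(z, v). riem M c (chart_inv c z) v v) (z, X c (chart_inv c z)))"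
    by (intro continuous_on_compose2[OF riem_chart_cont[OF c]] continuous_on_Pair continuous_on_id) auto
  then have "continuous_on (snd c ` fst c) (\<lambda>z. sqrt (riem M c (chart_inv c z) (X c (chart_inv c z)) (X c (chart_inv c z))))"
    by (intro continuous_on_real_sqrt) (simp only: case_prod_conv)
  then have "continuous_map (top_of_set (snd c ` fst c)) euclideanreal
    (\<lambda>z. sqrt (riem M c (chart_inv c z) (X c (chart_inv c z)) (X c (chart_inv c z))))" by simp
  moreover have "continuous_map (subtopology (mtop M) (fst c)) (top_of_set (snd c ` fst c)) (snd c)"
    using chart_cont[OF c] by (auto simp: continuous_map_in_subtopology)
  ultimately have "continuous_map (subtopology (mtop M) (fst c)) euclideanreal
    ((\<lambda>z. sqrt (riem M c (chart_inv c z) (X c (chart_inv c z)) (X c (chart_inv c z)))) \<circ> snd c)"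
    using continuous_map_compose by blast
  then show "continuous_map (subtopology (mtop M) (fst c)) euclideanreal V"
    by (rule continuous_map_eq) (auto simp: c vf_norm_chart[OF c])
next
  fix x assume "x \<in> pts M"
  then show "\<exists>j. j \<in> atlas M \<and> x \<in> fst j \<and> V x = V x" using chart_at by blast
qed auto

text \<open>Being an integral curve, as a condition at one time, so that it can be localized and glued.\<close>

definition ic_at :: "(real \<Rightarrow> 'a) \<Rightarrow> real \<Rightarrow> bool" where
  "ic_at \<gamma> t \<longleftrightarrow> limitin (mtop M) \<gamma> (\<gamma> t) (at t) \<and>
     (\<forall>c\<in>atlas M. \<gamma> t \<in> fst c \<longrightarrow> ((snd c \<circ> \<gamma>) has_vector_derivative X c (\<gamma> t)) (at t))"

lemma integral_curve_iff: "integral_curve M X \<gamma> \<longleftrightarrow> (\<forall>t. ic_at \<gamma> t)"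
  using continuous_map_real_iff[of UNIV "mtop M" \<gamma>] by (auto simp: integral_curve_def ic_at_def)

lemma ic_at_pts: "ic_at \<gamma> t \<Longrightarrow> \<gamma> t \<in> pts M"
  by (auto simp: ic_at_def limitin_topspace)

lemma ic_at_transform:
  assumes ic: "ic_at \<gamma>' t" and U: "open U" "t \<in> U" "\<And>s. s \<in> U \<Longrightarrow> \<gamma>' s = \<gamma> s"
  shows "ic_at \<gamma> t"
  unfolding ic_at_def
proof (intro conjI ballI impI)
  have e: "\<gamma> t = \<gamma>' t" using U by simp
  have ev: "eventually (\<lambda>s. s \<in> U) (at t)" using U by (simp add: eventually_at_topological) blast
  show "limitin (mtop M) \<gamma> (\<gamma> t) (at t)"
    unfolding limitin_def
  proof (intro conjI allI impI)
    show "\<gamma> t \<in> pts M" using ic_at_pts[OF ic] e by simp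
    fix W assume "openin (mtop M) W \<and> \<gamma> t \<in> W"
    then have "eventually (\<lambda>s. \<gamma>' s \<in> W) (at t)" using ic e by (auto simp: ic_at_def limitin_def)
    then show "eventually (\<lambda>s. \<gamma> s \<in> W) (at t)" using ev by eventually_elim (use U in simp)
  qed
  fix c assume "c \<in> atlas M" "\<gamma> t \<in> fst c"
  then have "((snd c \<circ> \<gamma>') has_vector_derivative X c (\<gamma> t)) (at t)" using ic e by (auto simp: ic_at_def)
  then show "((snd c \<circ> \<gamma>) has_vector_derivative X c (\<gamma> t)) (at t)"
    by (rule has_vector_derivative_transform_within_open[OF _ U(1,2)]) (use U in simp)
qed

lemma ic_at_shift:
  assumes ic: "ic_at \<gamma> (s + t)" shows "ic_at (\<lambda>t. \<gamma> (s + t)) t"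
  unfolding ic_at_def
proof (intro conjI ballI impI)
  show "limitin (mtop M) (\<lambda>t. \<gamma> (s + t)) (\<gamma> (s + t)) (at t)"
    unfolding limitin_def
  proof (intro conjI allI impI)
    show "\<gamma> (s + t) \<in> pts M" by (rule ic_at_pts[OF ic])
    fix W assume "openin (mtop M) W \<and> \<gamma> (s + t) \<in> W"
    then have "eventually (\<lambda>x. \<gamma> x \<in> W) (at (s + t))" using ic by (auto simp: ic_at_def limitin_def)
    then obtain d where d: "d > 0" "\<And>x. x \<noteq> s + t \<Longrightarrow> dist x (s + t) < d \<Longrightarrow> \<gamma> x \<in> W"
      unfolding eventually_at by auto
    show "eventually (\<lambda>x. \<gamma> (s + x) \<in> W) (at t)"
      unfolding eventually_at using d by (intro exI[of _ d]) (auto simp: dist_real_def)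
  qed
  fix c assume "c \<in> atlas M" "\<gamma> (s + t) \<in> fst c"
  then have "((snd c \<circ> \<gamma>) has_vector_derivative X c (\<gamma> (s + t))) (at (s + t))" using ic by (auto simp: ic_at_def)
  moreover have "((\<lambda>t. s + t) has_vector_derivative 1) (at t)" by (auto intro!: derivative_eq_intros)
  ultimately show "((snd c \<circ> (\<lambda>t. \<gamma> (s + t))) has_vector_derivative X c (\<gamma> (s + t))) (at t)"
    using vector_diff_chain_at[of "\<lambda>t. s + t" 1 t "snd c \<circ> \<gamma>"] by (simp add: o_def)
qed

lemma ic_at_chart_curve:
  assumes c: "c \<in> atlas M" and J: "open J" "t \<in> J" and u: "\<And>s. s \<in> J \<Longrightarrow> u s \<in> snd c ` fst c"
    and d: "\<And>s. s \<in> J \<Longrightarrow> (u has_vector_derivative X c (chart_inv c (u s))) (at s)"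
  shows "ic_at (\<lambda>t. chart_inv c (u t)) t"
proof -
  let ?g = "\<lambda>t. chart_inv c (u t)"
  have g: "?g s \<in> fst c" "snd c (?g s) = u s" if "s \<in> J" for s
    by (rule chart_inv_dom[OF u[OF that]], rule chart_inv_right[OF u[OF that]])
  have cu: "continuous_on J u"
    using has_vector_derivative_continuous[OF d] continuous_at_imp_continuous_on by blast
  have "continuous_map (top_of_set J) (top_of_set (snd c ` fst c)) u" using u cu by auto
  from continuous_map_compose[OF this chart_inv_cont[OF c]]
  have "continuous_map (top_of_set J) (mtop M) ?g" by (simp add: o_def)
  then have lim: "limitin (mtop M) ?g (?g t) (at t)"
    using J at_within_open[OF J(2,1)] unfolding continuous_map_real_iff by metis
  have dc: "((snd c \<circ> ?g) has_vector_derivative X c (?g t)) (at t)"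
    by (rule has_vector_derivative_transform_within_open[OF d[OF J(2)] J]) (use g in simp)
  have "((snd e \<circ> ?g) has_vector_derivative X e (?g t)) (at t)" if e: "e \<in> atlas M" "?g t \<in> fst e" for e
    using deriv_change[OF lim c e(1) g(1)[OF J(2)] e(2) UNIV_I dc] tangent[OF c e(1) g(1)[OF J(2)] e(2)] by simp
  then show ?thesis using lim by (simp add: ic_at_def)
qed

lemma ic_unique_local:
  assumes J: "open J" "t0 \<in> J" and ic: "\<And>t. t \<in> J \<Longrightarrow> ic_at \<gamma>1 t" "\<And>t. t \<in> J \<Longrightarrow> ic_at \<gamma>2 t"
    and eq: "\<gamma>1 t0 = \<gamma>2 t0"
  shows "\<exists>e>0. \<forall>t. \<bar>t - t0\<bar> < e \<longrightarrow> \<gamma>1 t = \<gamma>2 t"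
proof -
  let ?p = "\<gamma>1 t0"
  have p: "?p \<in> pts M" using ic_at_pts[OF ic(1)] J by blast
  define c where "c = chart_at M ?p"
  have c: "c \<in> atlas M" "?p \<in> fst c" using chart_at[OF p] by (auto simp: c_def)
  define z where "z = snd c ?p"
  obtain r where r: "r > 0" "cball z r \<subseteq> snd c ` fst c"
    using chart_range_open[OF c(1)] c open_contains_cball unfolding z_def by blast
  obtain L where L: "L > 0" "\<And>x y. x \<in> cball z r \<Longrightarrow> y \<in> cball z r \<Longrightarrow>
     norm (X c (chart_inv c x) - X c (chart_inv c y)) \<le> L * norm (x - y)"
    using C1_local_lipschitz[OF field_C1[OF c(1)] r(2)] by blast
  define W where "W = {q \<in> fst c. snd c q \<in> ball z r}"
  have W: "openin (mtop M) W" "?p \<in> W" using c r chart_preimage_open[OF c(1), of "ball z r"] by (auto simp: W_def z_def)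
  have "\<exists>d>0. \<forall>t. \<bar>t - t0\<bar> < d \<longrightarrow> \<gamma> t \<in> W" if "ic_at \<gamma> t0" "\<gamma> t0 = ?p" for \<gamma>
  proof -
    have "eventually (\<lambda>t. \<gamma> t \<in> W) (at t0)" using that W by (auto simp: ic_at_def limitin_def)
    then obtain d where "d > 0" "\<And>t. t \<noteq> t0 \<Longrightarrow> dist t t0 < d \<Longrightarrow> \<gamma> t \<in> W" by (auto simp: eventually_at)
    then show ?thesis using W that by (intro exI[of _ d]) (auto simp: dist_real_def, metis)
  qed
  note near = this
  obtain d1 where d1: "d1 > 0" "\<And>t. \<bar>t - t0\<bar> < d1 \<Longrightarrow> \<gamma>1 t \<in> W" using near[OF ic(1)[OF J(2)]] by blast
  obtain d2 where d2: "d2 > 0" "\<And>t. \<bar>t - t0\<bar> < d2 \<Longrightarrow> \<gamma>2 t \<in> W" using near[OF ic(2)[OF J(2)]] eq by metis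
  obtain d3 where d3: "d3 > 0" "\<And>t. \<bar>t - t0\<bar> < d3 \<Longrightarrow> t \<in> J"
    using J open_dist[of J] by (metis dist_real_def)
  define \<sigma> where "\<sigma> = min (min d1 d2) (min d3 (1/L)) / 2"
  have \<sigma>: "\<sigma> > 0" "\<sigma> < d1" "\<sigma> < d2" "\<sigma> < d3" using d1 d2 d3 L by (auto simp: \<sigma>_def)
  have "\<sigma> \<le> (1/L) / 2" by (simp add: \<sigma>_def)
  then have L\<sigma>: "L * \<sigma> \<le> 1/2" using L by (simp add: field_simps)
  have deriv: "((\<lambda>s. snd c (\<gamma> (t0 + s))) has_vector_derivative X c (\<gamma> (t0 + s))) (at s)"
    if "ic_at \<gamma> (t0 + s)" "\<gamma> (t0 + s) \<in> fst c" for \<gamma> s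
    using ic_at_shift[OF that(1)] c that(2) by (auto simp: ic_at_def o_def)
  have "\<gamma>1 t = \<gamma>2 t" if t: "\<bar>t - t0\<bar> < \<sigma>" for t
  proof -
    let ?u = "\<lambda>s. snd c (\<gamma>1 (t0 + s)) - snd c (\<gamma>2 (t0 + s))"
    have inW: "\<gamma>1 (t0 + s) \<in> W" "\<gamma>2 (t0 + s) \<in> W" "t0 + s \<in> J" if "s \<in> {-\<sigma>..\<sigma>}" for s
      using that \<sigma> by (auto intro!: d1 d2 d3)
    have "norm (?u (t - t0)) \<le> 2 * norm (?u 0) + 2 * 0 * \<sigma>"
    proof (rule ode_close[where L = L and \<sigma> = \<sigma>])
      fix s assume s: "s \<in> {-\<sigma>..\<sigma>}"
      note w = inW[OF s]
      have w': "\<gamma>1 (t0 + s) \<in> fst c" "\<gamma>2 (t0 + s) \<in> fst c" using w by (auto simp: W_def)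
      show "(?u has_vector_derivative (X c (\<gamma>1 (t0 + s)) - X c (\<gamma>2 (t0 + s)))) (at s within {-\<sigma>..\<sigma>})"
        by (rule has_vector_derivative_at_within[OF has_vector_derivative_diff[OF
              deriv[OF ic(1)[OF w(3)] w'(1)] deriv[OF ic(2)[OF w(3)] w'(2)]]])
      have "norm (X c (chart_inv c (snd c (\<gamma>1 (t0 + s)))) - X c (chart_inv c (snd c (\<gamma>2 (t0 + s))))) \<le> L * norm (?u s)"
        by (rule L(2)) (use w in \<open>auto simp: W_def\<close>)
      then show "norm (X c (\<gamma>1 (t0 + s)) - X c (\<gamma>2 (t0 + s))) \<le> L * norm (?u s) + 0"
        using w' c by simp
    qed (use \<sigma> L L\<sigma> t in auto)
    then have "snd c (\<gamma>1 t) = snd c (\<gamma>2 t)" using eq by simp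
    moreover have "\<gamma>1 t \<in> fst c" "\<gamma>2 t \<in> fst c" 
    proof -
      have "t - t0 \<in> {-\<sigma>..\<sigma>}" using t by auto
      then show "\<gamma>1 t \<in> fst c" "\<gamma>2 t \<in> fst c" using inW[of "t - t0"] by (auto simp: W_def)
    qed
    ultimately show ?thesis using chart_inj[OF c(1)] by (auto dest: inj_onD)
  qed
  then show ?thesis using \<sigma> by blast
qed

text \<open>Two integral curves agree on a set of times that is closed because the manifold is a Hausdorff space, and open
  by local uniqueness.\<close>

lemma ic_unique:
  assumes J: "open J" "connected J" "t0 \<in> J" and ic: "\<And>t. t \<in> J \<Longrightarrow> ic_at \<gamma>1 t" "\<And>t. t \<in> J \<Longrightarrow> ic_at \<gamma>2 t"
    and eq: "\<gamma>1 t0 = \<gamma>2 t0" and t: "t \<in> J"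
  shows "\<gamma>1 t = \<gamma>2 t"
proof -
  let ?A = "{t\<in>J. \<gamma>1 t = \<gamma>2 t}"
  have cm: "continuous_map (top_of_set J) (mtop M) \<gamma>" if "\<And>t. t \<in> J \<Longrightarrow> ic_at \<gamma> t" for \<gamma>
    unfolding continuous_map_real_iff using that at_within_open[OF _ J(1)] by (auto simp: ic_at_def)
  have "closedin (top_of_set J) {t \<in> topspace (top_of_set J). \<gamma>1 t = \<gamma>2 t}"
    by (rule closedin_continuous_maps_eq[OF Hausdorff_M cm cm]) (use ic in auto)
  then have cl: "closedin (top_of_set J) ?A" by simp
  have "open ?A"
    unfolding open_dist
  proof
    fix s assume s: "s \<in> ?A"
    then obtain e where e: "e > 0" "\<And>t. \<bar>t - s\<bar> < e \<Longrightarrow> \<gamma>1 t = \<gamma>2 t"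
      using ic_unique_local[OF J(1) _ ic, of s] by auto
    obtain e' where e': "e' > 0" "\<And>t. dist t s < e' \<Longrightarrow> t \<in> J" using J(1) s open_dist[of J] by blast
    show "\<exists>e>0. \<forall>y. dist y s < e \<longrightarrow> y \<in> ?A"
      using e e' by (intro exI[of _ "min e e'"]) (auto simp: dist_real_def)
  qed
  then have op: "openin (top_of_set J) ?A" by (auto intro: open_subset)
  have "?A = {} \<or> ?A = J" using J(2) op cl unfolding connected_clopen by blast
  then show ?thesis using eq J(3) t by blast
qed

end

section \<open>The flow and its short-time estimates\<close>

context closed_rmanifold_field
begin

text \<open>Integral curves that start in the ball of radius \<open>r\<close> stay in the one of radius \<open>2 * r\<close> up to time \<open>\<tau>\<close>.\<close>

definition flow_chart :: "('a, 'e) chart \<Rightarrow> 'e \<Rightarrow> real \<Rightarrow> real \<Rightarrow> real \<Rightarrow> real \<Rightarrow> real \<Rightarrow> real \<Rightarrow> bool" where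
  "flow_chart c z r k C L B \<tau> \<longleftrightarrow> 0 < L \<and> 0 < B \<and> 0 < \<tau> \<and> B * \<tau> \<le> r \<and> L * \<tau> \<le> 1/2 \<and>
     good_ball c z r k C \<and> (\<exists>k'. good_ball c z (2*r) k' C) \<and>
     (\<forall>x\<in>cball z (2*r). norm (X c (chart_inv c x)) \<le> B) \<and>
     (\<forall>x\<in>cball z (2*r). \<forall>y\<in>cball z (2*r). norm (X c (chart_inv c x) - X c (chart_inv c y)) \<le> L * norm (x - y))"

lemma flow_charts:
  obtains F r0 k C L B \<tau> where "r0 > 0"
    "\<And>c z r. (c, z, r) \<in> F \<Longrightarrow> flow_chart c z r k C L B \<tau>"
    "\<And>x. x \<in> pts M \<Longrightarrow> \<exists>c z r. (c, z, r) \<in> F \<and> x \<in> fst c \<and> snd c x \<in> cball z r \<and>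
       (\<forall>y\<in>pts M. mdist M x y < r0 \<longrightarrow> y \<in> fst c \<and> snd c y \<in> cball z r \<and>
          k * norm (snd c y - snd c x) \<le> mdist M x y)"
proof -
  define P where "P f C L B \<longleftrightarrow> (case f of (c, z, r) \<Rightarrow> 0 < C \<and> 0 < L \<and> 0 < B \<and> (\<exists>k'. good_ball c z (2*r) k' C) \<and>
     (\<forall>x\<in>cball z (2*r). norm (X c (chart_inv c x)) \<le> B) \<and>
     (\<forall>x\<in>cball z (2*r). \<forall>y\<in>cball z (2*r). norm (X c (chart_inv c x) - X c (chart_inv c y)) \<le> L * norm (x - y)))"
    for f :: "('a, 'e) chart \<times> 'e \<times> real" and C L B :: real
  obtain F r0 k C where F: "finite F" "r0 > 0" "k > 0" "C > 0"
    "\<And>c z r. (c, z, r) \<in> F \<Longrightarrow> good_ball c z r k C \<and> (\<exists>C L B. P (c, z, r) C L B)"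
    "\<And>x. x \<in> pts M \<Longrightarrow> \<exists>c z r. (c, z, r) \<in> F \<and> x \<in> fst c \<and> snd c x \<in> ball z (r/2) \<and>
       (\<forall>y\<in>pts M. mdist M x y < r0 \<longrightarrow> y \<in> fst c \<and> snd c y \<in> ball z r \<and>
          k * norm (snd c y - snd c x) \<le> mdist M x y)"
  proof (rule finite_charts[of "\<lambda>c z r. \<exists>C L B. P (c, z, r) C L B"])
    fix p assume "p \<in> pts M"
    then obtain c r k C where gb: "good_ball c (snd c p) r k C" "p \<in> fst c" using good_ball_at by blast
    let ?z = "snd c p"
    have c: "c \<in> atlas M" "r > 0" "C > 0" "k > 0" and sub: "cball ?z r \<subseteq> snd c ` fst c" using gb by (auto simp: good_ball_def)
    obtain L where L: "L > 0" "\<And>x y. x \<in> cball ?z r \<Longrightarrow> y \<in> cball ?z r \<Longrightarrow>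
       norm (X c (chart_inv c x) - X c (chart_inv c y)) \<le> L * norm (x - y)"
      using C1_local_lipschitz[OF field_C1[OF c(1)] sub] by blast
    define B where "B = norm (X c (chart_inv c ?z)) + L * r + 1"
    have B: "norm (X c (chart_inv c x)) \<le> B" if "x \<in> cball ?z r" for x
    proof -
      have "norm (X c (chart_inv c x) - X c (chart_inv c ?z)) \<le> L * norm (x - ?z)" by (rule L(2)) (use that c in auto)
      also have "\<dots> \<le> L * r" using that L by (intro mult_left_mono) (auto simp: dist_norm norm_minus_commute)
      finally show ?thesis
        using norm_triangle_sub[of "X c (chart_inv c x)" "X c (chart_inv c ?z)"] by (simp add: B_def)
    qed
    have "B > 0" using L c by (simp add: B_def add_nonneg_pos)
    then have "P (c, ?z, r/2) C L B" using L B c gb by (auto simp: P_def)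
    moreover have "good_ball c ?z (r/2) k C" by (rule good_ball_mono[OF gb(1)]) (use c in auto)
    ultimately show "\<exists>c z r k C. good_ball c z r k C \<and> p \<in> fst c \<and> snd c p = z \<and> (\<exists>C L B. P (c, z, r) C L B)"
      using gb(2) by blast
  qed (rule that, assumption+)
  have "\<forall>f\<in>F. \<exists>C L B. P f C L B" using F(5) by fastforce
  from this[unfolded bchoice_iff] obtain C' L' B' where P: "\<And>f. f \<in> F \<Longrightarrow> P f (C' f) (L' f) (B' f)"
    unfolding bchoice_iff by blast
  obtain C1 where C1: "C1 > 0" "\<forall>f\<in>F. C' f \<le> C1" using finite_bound[OF F(1), of C'] by blast
  obtain L1 where L1: "L1 > 0" "\<forall>f\<in>F. L' f \<le> L1" using finite_bound[OF F(1), of L'] by blast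
  obtain B1 where B1: "B1 > 0" "\<forall>f\<in>F. B' f \<le> B1" using finite_bound[OF F(1), of B'] by blast
  obtain R where R: "R > 0" "\<forall>f\<in>F. 1 / snd (snd f) \<le> R" using finite_bound[OF F(1), of "\<lambda>f. 1 / snd (snd f)"] by blast
  define \<tau> where "\<tau> = min (1 / (R * B1)) (1 / (2 * L1))"
  have \<tau>: "\<tau> > 0" "L1 * \<tau> \<le> 1/2" "B1 * \<tau> \<le> 1 / R"
  proof -
    show "\<tau> > 0" using R B1 L1 by (simp add: \<tau>_def)
    have "L1 * \<tau> \<le> L1 * (1 / (2 * L1))" using L1 by (intro mult_left_mono) (auto simp: \<tau>_def)
    then show "L1 * \<tau> \<le> 1/2" using L1 by simp
    have "B1 * \<tau> \<le> B1 * (1 / (R * B1))" using B1 by (intro mult_left_mono) (auto simp: \<tau>_def)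
    then show "B1 * \<tau> \<le> 1/R" using B1 by simp
  qed
  show thesis
  proof (rule that[of r0 F k "max C C1" L1 B1 \<tau>])
    fix c z r assume f: "(c, z, r) \<in> F"
    have gb: "good_ball c z r k C" using F(5)[OF f] by blast
    then have r: "r > 0" "C > 0" by (auto simp: good_ball_def)
    have "1 / r \<le> R" using R(2) f by force
    then have "1 / R \<le> r" using r R(1) by (simp add: field_simps)
    then have Br: "B1 * \<tau> \<le> r" using \<tau> by linarith
    have p: "P (c, z, r) (C' (c,z,r)) (L' (c,z,r)) (B' (c,z,r))" by (rule P[OF f])
    then obtain k' where k': "good_ball c z (2*r) k' (C' (c,z,r))" by (auto simp: P_def)
    have g1: "good_ball c z (2*r) k' (max C C1)"
      by (rule good_ball_mono[OF k']) (use k' r C1(2) f in \<open>auto simp: good_ball_def le_max_iff_disj\<close>)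
    have g2: "good_ball c z r k (max C C1)"
      by (rule good_ball_mono[OF gb]) (use r F in auto)
    have b: "norm (X c (chart_inv c x)) \<le> B1" if "x \<in> cball z (2*r)" for x
    proof -
      have "norm (X c (chart_inv c x)) \<le> B' (c,z,r)" using p that unfolding P_def by blast
      then show ?thesis using B1(2) f by force
    qed
    have l: "norm (X c (chart_inv c x) - X c (chart_inv c y)) \<le> L1 * norm (x - y)"
      if "x \<in> cball z (2*r)" "y \<in> cball z (2*r)" for x y
    proof -
      have "norm (X c (chart_inv c x) - X c (chart_inv c y)) \<le> L' (c,z,r) * norm (x - y)"
        using p that unfolding P_def by blast
      also have "\<dots> \<le> L1 * norm (x - y)" using L1(2) f by (intro mult_right_mono) auto
      finally show ?thesis .
    qed
    show "flow_chart c z r k (max C C1) L1 B1 \<tau>"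
      unfolding flow_chart_def using g1 g2 b l \<tau> Br L1 B1 by blast
  next
    fix x assume "x \<in> pts M"
    from F(6)[OF this] obtain c z r where n: "(c, z, r) \<in> F" "x \<in> fst c" "snd c x \<in> ball z (r/2)"
       "\<forall>y\<in>pts M. mdist M x y < r0 \<longrightarrow> y \<in> fst c \<and> snd c y \<in> ball z r \<and>
          k * norm (snd c y - snd c x) \<le> mdist M x y" by blast
    have "r > 0" using F(5)[OF n(1)] by (auto simp: good_ball_def)
    then show "\<exists>c z r. (c, z, r) \<in> F \<and> x \<in> fst c \<and> snd c x \<in> cball z r \<and>
       (\<forall>y\<in>pts M. mdist M x y < r0 \<longrightarrow> y \<in> fst c \<and> snd c y \<in> cball z r \<and>
          k * norm (snd c y - snd c x) \<le> mdist M x y)"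
      using n by (intro exI[of _ c] exI[of _ z] exI[of _ r]) auto
  qed (use F in auto)
qed

lemma local_solution:
  assumes fc: "flow_chart c z r k C L B \<tau>" and x: "x \<in> fst c" "snd c x \<in> cball z r"
  shows "\<exists>\<gamma>. \<gamma> 0 = x \<and> (\<forall>t\<in>{-\<tau><..<\<tau>}. ic_at \<gamma> t \<and> \<gamma> t \<in> fst c \<and> snd c (\<gamma> t) \<in> cball z (2*r))"
proof -
  have c: "c \<in> atlas M" "r > 0" and sub: "cball z (2*r) \<subseteq> snd c ` fst c"
    using fc by (auto simp: flow_chart_def good_ball_def)
  obtain u where u: "u 0 = snd c x" "\<And>t. t \<in> {-\<tau>..\<tau>} \<Longrightarrow> u t \<in> cball z (2*r)"
    "\<And>t. t \<in> {-\<tau>..\<tau>} \<Longrightarrow> (u has_vector_derivative X c (chart_inv c (u t))) (at t within {-\<tau>..\<tau>})"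
    by (rule picard[where f = "\<lambda>w. X c (chart_inv c w)" and ?z0.0 = z and r = r and L = L and B = B and \<tau> = \<tau> and z = "snd c x"])
      (use fc x c in \<open>auto simp: flow_chart_def\<close>)
  have d: "(u has_vector_derivative X c (chart_inv c (u t))) (at t)" if "t \<in> {-\<tau><..<\<tau>}" for t
    using u(3)[of t] that by (simp add: at_within_Icc_at)
  have ur: "u t \<in> snd c ` fst c" if "t \<in> {-\<tau><..<\<tau>}" for t using u(2)[of t] that sub by auto
  show ?thesis
  proof (intro exI[of _ "\<lambda>t. chart_inv c (u t)"] conjI ballI)
    show "chart_inv c (u 0) = x" using u(1) x c by simp
    fix t assume t: "t \<in> {-\<tau><..<\<tau>}"
    show "ic_at (\<lambda>t. chart_inv c (u t)) t"
      by (rule ic_at_chart_curve[OF c(1) open_greaterThanLessThan t ur d])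
    show "chart_inv c (u t) \<in> fst c" by (rule chart_inv_dom[OF ur[OF t]])
    show "snd c (chart_inv c (u t)) \<in> cball z (2*r)"
      using u(2)[of t] t chart_inv_right[OF ur[OF t]] by simp
  qed
qed

text \<open>Local solutions \<open>l x\<close> exist on a common interval of length \<open>2 * \<tau>\<close>. Iterating the time-\<open>h\<close> map gives points
  \<open>xs k\<close> for all integers \<open>k\<close>, and with \<open>2 * h < \<tau>\<close> each local solution reaches over the next grid time, so the
  pieces \<open>{h * k..h * (k + 1)}\<close> fit together.\<close>

lemma integral_curve_exists:
  assumes x0: "x0 \<in> pts M" shows "\<exists>\<gamma>. integral_curve M X \<gamma> \<and> \<gamma> 0 = x0"
proof -
  obtain F r0 k C L B \<tau> where F: "r0 > 0"
    "\<And>c z r. (c, z, r) \<in> F \<Longrightarrow> flow_chart c z r k C L B \<tau>"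
    "\<And>x. x \<in> pts M \<Longrightarrow> \<exists>c z r. (c, z, r) \<in> F \<and> x \<in> fst c \<and> snd c x \<in> cball z r \<and>
       (\<forall>y\<in>pts M. mdist M x y < r0 \<longrightarrow> y \<in> fst c \<and> snd c y \<in> cball z r \<and>
          k * norm (snd c y - snd c x) \<le> mdist M x y)"
    by (rule flow_charts) (rule that, assumption+)
  have "\<tau> > 0" using F(2) F(3)[OF x0] by (auto simp: flow_chart_def)
  have "\<exists>\<gamma>. \<gamma> 0 = x \<and> (\<forall>t\<in>{-\<tau><..<\<tau>}. ic_at \<gamma> t)" if "x \<in> pts M" for x
    using F(3)[OF that] F(2) local_solution by blast
  then obtain l where l: "\<And>x. x \<in> pts M \<Longrightarrow> l x 0 = x" "\<And>x t. x \<in> pts M \<Longrightarrow> t \<in> {-\<tau><..<\<tau>} \<Longrightarrow> ic_at (l x) t"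
    by metis
  have lp: "l x t \<in> pts M" if "x \<in> pts M" "t \<in> {-\<tau><..<\<tau>}" for x t using ic_at_pts l(2) that by blast
  have l_add: "l (l x s) t = l x (s + t)" if x: "x \<in> pts M" and s: "s \<in> {-\<tau><..<\<tau>}" "t \<in> {-\<tau><..<\<tau>}" "s + t \<in> {-\<tau><..<\<tau>}" for x s t
  proof (rule ic_unique[where J = "{max (-\<tau>) (-\<tau>-s)<..<min \<tau> (\<tau>-s)}" and ?t0.0 = 0
        and ?\<gamma>1.0 = "l (l x s)" and ?\<gamma>2.0 = "\<lambda>t. l x (s + t)"])
    show "ic_at (l (l x s)) t" if "t \<in> {max (-\<tau>) (-\<tau>-s)<..<min \<tau> (\<tau>-s)}" for t
      using that by (intro l(2) lp x s) auto
    show "ic_at (\<lambda>t. l x (s + t)) t" if "t \<in> {max (-\<tau>) (-\<tau>-s)<..<min \<tau> (\<tau>-s)}" for t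
      using that by (intro ic_at_shift l(2) x) auto
    show "l (l x s) 0 = l x (s + 0)" using l(1)[OF lp[OF x s(1)]] by simp
  qed (use s \<open>\<tau> > 0\<close> in auto)
  define h where "h = \<tau> / 3"
  have h: "0 < h" "h \<in> {-\<tau><..<\<tau>}" "-h \<in> {-\<tau><..<\<tau>}" "2 * h < \<tau>" using \<open>\<tau> > 0\<close> by (auto simp: h_def)
  define g where "g x = l x h" for x
  define g' where "g' x = l x (-h)" for x
  have g: "g x \<in> pts M" "g' x \<in> pts M" "g (g' x) = x" if "x \<in> pts M" for x
    using that lp h l_add[OF that h(3) h(2)] l(1) \<open>\<tau> > 0\<close> by (auto simp: g_def g'_def)
  define xs where "xs k = (if k \<ge> 0 then (g ^^ nat k) x0 else (g' ^^ nat (-k)) x0)" for k :: int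
  have gp: "(g ^^ n) x0 \<in> pts M" "(g' ^^ n) x0 \<in> pts M" for n by (induction n) (auto simp: x0 g)
  then have xp: "xs k \<in> pts M" for k by (simp add: xs_def)
  have xs_Suc: "xs (k + 1) = g (xs k)" for k
  proof (cases "k \<ge> 0")
    case True
    then have "nat (k + 1) = Suc (nat k)" by simp
    then show ?thesis using True by (simp add: xs_def)
  next
    case False
    then have e: "nat (-k) = Suc (nat (-(k+1)))" by simp
    have "xs k = g' (xs (k+1))"
    proof (cases "k + 1 = 0")
      case True
      then show ?thesis using e False by (simp add: xs_def)
    next
      case k: False
      then show ?thesis using e False by (simp add: xs_def)
    qed
    then show ?thesis using g(3)[OF xp] by simp
  qed
  define \<gamma> where "\<gamma> t = l (xs \<lfloor>t/h\<rfloor>) (t - h * \<lfloor>t/h\<rfloor>)" for t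
  have local: "\<gamma> t = l (xs (k - 1)) (t - h * (k - 1))" if t: "h * (k - 1) < t" "t < h * (k + 1)" for t and k :: int
  proof -
    have "real_of_int (k - 1) < t/h" "t/h < real_of_int (k + 1)" using t h by (auto simp: field_simps)
    then have "\<lfloor>t/h\<rfloor> = k - 1 \<or> \<lfloor>t/h\<rfloor> = k" by linarith
    then show ?thesis
    proof
      assume "\<lfloor>t/h\<rfloor> = k - 1"
      then show ?thesis by (simp add: \<gamma>_def)
    next
      assume k: "\<lfloor>t/h\<rfloor> = k"
      have "real_of_int k \<le> t/h" using k by linarith
      then have kt: "h * k \<le> t" using h by (simp add: field_simps)
      have "xs k = l (xs (k - 1)) h" using xs_Suc[of "k - 1"] by (simp add: g_def)
      then have "\<gamma> t = l (l (xs (k - 1)) h) (t - h * k)" by (simp add: \<gamma>_def k)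
      also have "\<dots> = l (xs (k - 1)) (h + (t - h * k))"
        by (rule l_add[OF xp h(2)]) (use t kt h in \<open>auto simp: algebra_simps\<close>)
      finally show ?thesis by (simp add: algebra_simps)
    qed
  qed
  have "ic_at \<gamma> t" for t
  proof -
    define k where "k = \<lfloor>t/h\<rfloor>"
    have "real_of_int k \<le> t/h" "t/h < real_of_int k + 1" unfolding k_def by linarith+
    then have "h * k \<le> t" "t < h * (k + 1)" using h by (auto simp: field_simps)
    then have t: "t \<in> {h * (k - 1)<..<h * (k + 1)}" using h by (auto simp: algebra_simps)
    have "ic_at (l (xs (k - 1))) (- h * (k - 1) + t)"
      by (rule l(2)[OF xp]) (use t h in \<open>auto simp: algebra_simps\<close>)
    then have "ic_at (\<lambda>t. l (xs (k - 1)) (- h * (k - 1) + t)) t" by (rule ic_at_shift)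
    then show ?thesis
      by (rule ic_at_transform[OF _ open_greaterThanLessThan t]) (use local[of k] in \<open>auto simp: algebra_simps\<close>)
  qed
  moreover have "\<gamma> 0 = x0" using l(1)[OF x0] by (simp add: \<gamma>_def xs_def)
  ultimately show ?thesis by (auto simp: integral_curve_iff)
qed

lemma flow_unique:
  assumes "integral_curve M X \<gamma>" shows "flow M X t (\<gamma> 0) = \<gamma> t"
proof -
  have "\<gamma>' = \<gamma>" if "integral_curve M X \<gamma>' \<and> \<gamma>' 0 = \<gamma> 0" for \<gamma>'
    using ic_unique[of UNIV 0 \<gamma>' \<gamma>] that assms by (auto simp: integral_curve_iff)
  then have "(THE \<gamma>'. integral_curve M X \<gamma>' \<and> \<gamma>' 0 = \<gamma> 0) = \<gamma>" using assms by blast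
  then show ?thesis by (simp add: flow_def)
qed

lemma flow_integral_curve:
  assumes "x \<in> pts M" shows "integral_curve M X (\<lambda>t. flow M X t x)" and flow_0: "flow M X 0 x = x"
proof -
  obtain \<gamma> where g: "integral_curve M X \<gamma>" "\<gamma> 0 = x" using integral_curve_exists[OF assms] by blast
  then have "(\<lambda>t. flow M X t x) = \<gamma>" using flow_unique[OF g(1)] by auto
  then show "integral_curve M X (\<lambda>t. flow M X t x)" "flow M X 0 x = x" using g by auto
qed

lemma flow_ic_at: "x \<in> pts M \<Longrightarrow> ic_at (\<lambda>t. flow M X t x) t"
  using flow_integral_curve integral_curve_iff by blast

lemma flow_pts: "x \<in> pts M \<Longrightarrow> flow M X t x \<in> pts M"
  using ic_at_pts[OF flow_ic_at] .

lemma flow_add: assumes "x \<in> pts M" shows "flow M X (s + t) x = flow M X t (flow M X s x)"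
proof -
  have "integral_curve M X (\<lambda>t. flow M X (s + t) x)"
    using flow_ic_at[OF assms] ic_at_shift[of "\<lambda>t. flow M X t x"] by (auto simp: integral_curve_iff)
  from flow_unique[OF this, of t] show ?thesis by simp
qed

lemma flow_in_chart:
  assumes fc: "flow_chart c z r k C L B \<tau>" and x: "x \<in> fst c" "snd c x \<in> cball z r" and t: "\<bar>t\<bar> < \<tau>"
  shows "flow M X t x \<in> fst c" "snd c (flow M X t x) \<in> cball z (2*r)"
    "((\<lambda>t. snd c (flow M X t x)) has_vector_derivative X c (flow M X t x)) (at t)"
proof -
  have c: "c \<in> atlas M" using fc by (auto simp: flow_chart_def good_ball_def)
  have xp: "x \<in> pts M" by (rule chart_dom_pts[OF c x(1)])
  obtain \<gamma> where g: "\<gamma> 0 = x" "\<And>t. t\<in>{-\<tau><..<\<tau>} \<Longrightarrow> ic_at \<gamma> t \<and> \<gamma> t \<in> fst c \<and> snd c (\<gamma> t) \<in> cball z (2*r)"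
    using local_solution[OF fc x] by blast
  have "flow M X t x = \<gamma> t"
    by (rule ic_unique[where J = "{-\<tau><..<\<tau>}" and ?t0.0 = 0])
      (use g t flow_ic_at[OF xp] flow_0[OF xp] in auto)
  moreover have "t \<in> {-\<tau><..<\<tau>}" using t by auto
  ultimately show 1: "flow M X t x \<in> fst c" "snd c (flow M X t x) \<in> cball z (2*r)" using g(2)[of t] by auto
  show "((\<lambda>t. snd c (flow M X t x)) has_vector_derivative X c (flow M X t x)) (at t)"
    using flow_ic_at[OF xp, of t] c 1 by (auto simp: ic_at_def o_def)
qed

text \<open>Points at distance less than \<open>r0\<close> lie in a common flow chart, where \<open>ode_close\<close> applies to the difference of
  their orbits; for other pairs the bounds on the diameter and on the speed suffice. The speed along an orbit is
  bounded by applying \<open>ode_close\<close> to the displacement, with the initial speed as inhomogeneity.\<close>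

lemma short_time_estimates:
  obtains \<sigma> K A where "\<sigma> > 0" "K \<ge> 1" "A > 0"
    "\<And>x y s. x \<in> pts M \<Longrightarrow> y \<in> pts M \<Longrightarrow> \<bar>s\<bar> \<le> \<sigma> \<Longrightarrow> mdist M (flow M X s x) (flow M X s y) \<le> K * mdist M x y"
    "\<And>x s. x \<in> pts M \<Longrightarrow> \<bar>s\<bar> \<le> \<sigma> \<Longrightarrow> V (flow M X s x) \<le> K * V x"
    "\<And>x s. x \<in> pts M \<Longrightarrow> \<bar>s\<bar> \<le> \<sigma> \<Longrightarrow> mdist M x (flow M X s x) \<le> A * \<bar>s\<bar> * V x"
    "\<And>x y. x \<in> pts M \<Longrightarrow> y \<in> pts M \<Longrightarrow> V y \<le> A * (V x + mdist M x y)"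
proof -
  obtain F r0 k C L B \<tau> where F: "r0 > 0"
    "\<And>c z r. (c, z, r) \<in> F \<Longrightarrow> flow_chart c z r k C L B \<tau>"
    "\<And>x. x \<in> pts M \<Longrightarrow> \<exists>c z r. (c, z, r) \<in> F \<and> x \<in> fst c \<and> snd c x \<in> cball z r \<and>
       (\<forall>y\<in>pts M. mdist M x y < r0 \<longrightarrow> y \<in> fst c \<and> snd c y \<in> cball z r \<and>
          k * norm (snd c y - snd c x) \<le> mdist M x y)"
    by (rule flow_charts) (rule that, assumption+)
  obtain c0 z0 rr where "(c0, z0, rr) \<in> F" using F(3) pts_nonempty by blast
  from F(2)[OF this] have pos: "0 < k" "0 < C" "0 < L" "0 < B" "0 < \<tau>" "L * \<tau> \<le> 1/2"
    by (auto simp: flow_chart_def good_ball_def)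
  obtain D where D: "D > 0" "\<And>x y. x \<in> pts M \<Longrightarrow> y \<in> pts M \<Longrightarrow> mdist M x y \<le> D" by (rule diameter_bound) (rule that, assumption+)
  define \<sigma> where "\<sigma> = \<tau> / 2"
  have \<sigma>: "\<sigma> > 0" "\<sigma> < \<tau>" "L * \<sigma> \<le> 1/2" "L * (2 * \<sigma>) \<le> 1" using pos by (auto simp: \<sigma>_def)
  define K where "K = 2 * C / k + D / r0 + 1"
  define A where "A = 2 * C / k + C * L / k + C * B / r0 + 1"
  have fcD: "c \<in> atlas M" "r > 0" "\<And>x. x \<in> cball z r \<Longrightarrow> x \<in> cball z (2*r)"
    "\<And>w v. w \<in> fst c \<Longrightarrow> snd c w \<in> cball z r \<Longrightarrow> k * norm v \<le> sqrt (riem M c w v v)"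
    "\<And>w v. w \<in> fst c \<Longrightarrow> snd c w \<in> cball z (2*r) \<Longrightarrow> sqrt (riem M c w v v) \<le> C * norm v"
    "\<And>w v. w \<in> fst c \<Longrightarrow> v \<in> fst c \<Longrightarrow> snd c w \<in> cball z (2*r) \<Longrightarrow> snd c v \<in> cball z (2*r) \<Longrightarrow> mdist M w v \<le> C * norm (snd c v - snd c w)"
    "\<And>w v. w \<in> fst c \<Longrightarrow> v \<in> fst c \<Longrightarrow> snd c w \<in> cball z (2*r) \<Longrightarrow> snd c v \<in> cball z (2*r) \<Longrightarrow>
       norm (X c w - X c v) \<le> L * norm (snd c w - snd c v)"
    "\<And>w. w \<in> fst c \<Longrightarrow> snd c w \<in> cball z (2*r) \<Longrightarrow> norm (X c w) \<le> B"
    if f: "(c, z, r) \<in> F" for c z r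
  proof -
    note fc = F(2)[OF f]
    show c: "c \<in> atlas M" and r: "r > 0" using fc by (auto simp: flow_chart_def good_ball_def)
    then show "x \<in> cball z (2*r)" if "x \<in> cball z r" for x using that by auto
    obtain k' where k': "good_ball c z (2*r) k' C" using fc by (auto simp: flow_chart_def)
    show "k * norm v \<le> sqrt (riem M c w v v)" if "w \<in> fst c" "snd c w \<in> cball z r" for w v
      using fc that chart_inv_left[OF c that(1)] unfolding flow_chart_def good_ball_def by metis
    show "sqrt (riem M c w v v) \<le> C * norm v" if "w \<in> fst c" "snd c w \<in> cball z (2*r)" for w v
      using k' that chart_inv_left[OF c that(1)] unfolding good_ball_def by metis
    show "mdist M w v \<le> C * norm (snd c v - snd c w)"
      if "w \<in> fst c" "v \<in> fst c" "snd c w \<in> cball z (2*r)" "snd c v \<in> cball z (2*r)" for w v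
      by (rule mdist_le_chart[OF k' that])
    show "norm (X c w - X c v) \<le> L * norm (snd c w - snd c v)"
      if "w \<in> fst c" "v \<in> fst c" "snd c w \<in> cball z (2*r)" "snd c v \<in> cball z (2*r)" for w v
      using fc that chart_inv_left[OF c that(1)] chart_inv_left[OF c that(2)] unfolding flow_chart_def by metis
    show "norm (X c w) \<le> B" if "w \<in> fst c" "snd c w \<in> cball z (2*r)" for w
      using fc that chart_inv_left[OF c that(1)] unfolding flow_chart_def by metis
  qed
  have q: "2 * C / k \<ge> 0" "C * L / k \<ge> 0" "C * B / r0 \<ge> 0" "D / r0 \<ge> 0" using pos F(1) D by auto
  show thesis
  proof (rule that[of \<sigma> K A])
    show "K \<ge> 1" "A > 0" using q by (auto simp: K_def A_def)
    fix x assume x: "x \<in> pts M"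
    obtain c z r where f: "(c, z, r) \<in> F" "x \<in> fst c" "snd c x \<in> cball z r"
      and near: "\<And>y. y\<in>pts M \<Longrightarrow> mdist M x y < r0 \<Longrightarrow> y \<in> fst c \<and> snd c y \<in> cball z r \<and>
          k * norm (snd c y - snd c x) \<le> mdist M x y" using F(3)[OF x] by blast
    note fc = F(2)[OF f(1)] and fD = fcD[OF f(1)]
    note fx = flow_in_chart[OF fc f(2,3)]
    have kV: "k * norm (X c x) \<le> V x" "V w \<le> C * norm (X c w)"
      if "w \<in> fst c" "snd c w \<in> cball z (2*r)" for w
      using fD(4)[OF f(2,3), of "X c x"] fD(5)[OF that, of "X c w"] vf_norm_chart[OF fD(1) f(2)] vf_norm_chart[OF fD(1) that(1)]
      by auto
    note kV1 = kV(1)[OF f(2) fD(3)[OF f(3)]]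
    have a: "norm (X c x) \<le> V x / k" using kV1 pos by (simp add: field_simps)
    {
      fix y s assume y: "y \<in> pts M" and s: "\<bar>s\<bar> \<le> \<sigma>"
      show "mdist M (flow M X s x) (flow M X s y) \<le> K * mdist M x y"
      proof (cases "mdist M x y < r0")
        case True
        note ny = near[OF y True]
        then have ny': "y \<in> fst c" "snd c y \<in> cball z r" by auto
        note fy = flow_in_chart[OF fc ny']
        let ?u = "\<lambda>s. snd c (flow M X s y) - snd c (flow M X s x)"
        have "norm (?u s) \<le> 2 * norm (?u 0) + 2 * 0 * \<sigma>"
        proof (rule ode_close[where L = L])
          fix t assume "t \<in> {-\<sigma>..\<sigma>}"
          then have t: "\<bar>t\<bar> < \<tau>" using \<sigma> by auto
          show "(?u has_vector_derivative X c (flow M X t y) - X c (flow M X t x)) (at t within {-\<sigma>..\<sigma>})"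
            by (rule has_vector_derivative_at_within[OF has_vector_derivative_diff[OF fy(3)[OF t] fx(3)[OF t]]])
          show "norm (X c (flow M X t y) - X c (flow M X t x)) \<le> L * norm (?u t) + 0"
            using fD(7) fx(1,2)[OF t] fy(1,2)[OF t] by simp
        qed (use \<sigma> pos s in auto)
        also have "\<dots> \<le> 2 * (mdist M x y / k)"
          using ny flow_0[OF x] flow_0[OF y] pos by (simp add: field_simps)
        finally have n: "norm (?u s) \<le> 2 * (mdist M x y / k)" .
        have st: "\<bar>s\<bar> < \<tau>" using s \<sigma> by auto
        have "mdist M (flow M X s x) (flow M X s y) \<le> C * norm (?u s)"
          by (rule fD(6)) (use fx(1,2)[OF st] fy(1,2)[OF st] in auto)
        also have "\<dots> \<le> C * (2 * (mdist M x y / k))" using n pos by (intro mult_left_mono) auto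
        also have "\<dots> = (2 * C / k) * mdist M x y" by simp
        also have "\<dots> \<le> K * mdist M x y" using mdist_nonneg[OF x y] q by (intro mult_right_mono) (auto simp: K_def)
        finally show ?thesis .
      next
        case False
        have "mdist M (flow M X s x) (flow M X s y) \<le> D" by (intro D flow_pts x y)
        also have "\<dots> \<le> (D / r0) * mdist M x y"
          using False F(1) D(1) mult_left_mono[of r0 "mdist M x y" "D / r0"] by simp
        also have "\<dots> \<le> K * mdist M x y" using mdist_nonneg[OF x y] q by (intro mult_right_mono) (auto simp: K_def)
        finally show ?thesis .
      qed
    }
    {
      fix y assume y: "y \<in> pts M"
      have V0: "0 \<le> V x" "0 \<le> mdist M x y" using vf_norm_nonneg[OF x] mdist_nonneg[OF x y] by auto
      show "V y \<le> A * (V x + mdist M x y)"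
      proof (cases "mdist M x y < r0")
        case True
        note ny = near[OF y True]
        have "norm (X c y - X c x) \<le> L * norm (snd c y - snd c x)" by (intro fD(7) fD(3)) (use ny f in auto)
        also have "\<dots> \<le> L * (mdist M x y / k)" using ny pos by (intro mult_left_mono) (auto simp: field_simps)
        finally have "norm (X c y) \<le> V x / k + L * (mdist M x y / k)"
          using a norm_triangle_sub[of "X c y" "X c x"] by linarith
        moreover have "V y \<le> C * norm (X c y)" using ny by (intro kV(2) fD(3)) auto
        ultimately have "V y \<le> C * (V x / k + L * (mdist M x y / k))"
          using mult_left_mono[of "norm (X c y)" _ C] pos by (meson less_imp_le order_trans)
        also have "\<dots> = (C / k) * V x + (C * L / k) * mdist M x y" by (simp add: algebra_simps)
        also have "\<dots> \<le> A * V x + A * mdist M x y"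
        proof (intro add_mono mult_right_mono V0)
          have "C / k \<le> 2 * C / k" using pos by (simp add: divide_right_mono)
          then show "C / k \<le> A" using q unfolding A_def by linarith
          show "C * L / k \<le> A" using q unfolding A_def by linarith
        qed
        finally show ?thesis by (simp add: algebra_simps)
      next
        case False
        obtain c' z' r' where f': "(c', z', r') \<in> F" "y \<in> fst c'" "snd c' y \<in> cball z' r'" using F(3)[OF y] by blast
        note fD' = fcD[OF f'(1)]
        have y2: "snd c' y \<in> cball z' (2 * r')" by (rule fD'(3)[OF f'(3)])
        have "V y \<le> C * norm (X c' y)"
          using fD'(5)[OF f'(2) y2] vf_norm_chart[OF fD'(1) f'(2)] by simp
        also have "\<dots> \<le> C * B" using fD'(8)[OF f'(2) y2] pos by (intro mult_left_mono) auto
        also have "\<dots> \<le> (C * B / r0) * mdist M x y"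
          using False F(1) pos mult_left_mono[of r0 "mdist M x y" "C * B / r0"] by simp
        also have "\<dots> \<le> A * mdist M x y" using V0 q by (intro mult_right_mono) (auto simp: A_def)
        also have "\<dots> \<le> A * (V x + mdist M x y)" using V0 q by (intro mult_left_mono) (auto simp: A_def)
        finally show ?thesis .
      qed
    }
    have speed: "norm (X c (flow M X s x)) \<le> 2 * (V x / k)" if s: "s \<in> {-\<sigma>..\<sigma>}" for s
    proof -
      let ?u = "\<lambda>s. snd c (flow M X s x) - snd c x"
      let ?a = "norm (X c x)"
      have Xs: "norm (X c (flow M X t x)) \<le> L * norm (?u t) + ?a" if "t \<in> {-\<sigma>..\<sigma>}" for t
      proof -
        have t: "\<bar>t\<bar> < \<tau>" using \<sigma> that by auto
        have "norm (X c (flow M X t x) - X c x) \<le> L * norm (?u t)"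
          by (rule fD(7)) (use fx(1,2)[OF t] f fD(3) in auto)
        then show ?thesis using norm_triangle_sub[of "X c (flow M X t x)" "X c x"] by linarith
      qed
      have "norm (?u s) \<le> 2 * norm (?u 0) + 2 * ?a * \<sigma>"
      proof (rule ode_close[where L = L])
        fix t assume t': "t \<in> {-\<sigma>..\<sigma>}"
        then have t: "\<bar>t\<bar> < \<tau>" using \<sigma> by auto
        show "(?u has_vector_derivative X c (flow M X t x)) (at t within {-\<sigma>..\<sigma>})"
          using has_vector_derivative_at_within[OF fx(3)[OF t]] by (auto intro!: derivative_eq_intros)
        show "norm (X c (flow M X t x)) \<le> L * norm (?u t) + ?a" by (rule Xs[OF t'])
      qed (use \<sigma> pos s in auto)
      then have "norm (?u s) \<le> 2 * ?a * \<sigma>" using flow_0[OF x] by simp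
      then have "L * norm (?u s) \<le> L * (2 * ?a * \<sigma>)" using pos by (intro mult_left_mono) auto
      also have "\<dots> = (L * (2 * \<sigma>)) * ?a" by simp
      also have "\<dots> \<le> 1 * ?a" by (rule mult_right_mono[OF \<sigma>(4)]) simp
      finally have "norm (X c (flow M X s x)) \<le> 2 * ?a" using Xs[OF s] by simp
      then show ?thesis using a by simp
    qed
    fix s assume s: "\<bar>s\<bar> \<le> \<sigma>"
    then have s': "s \<in> {-\<sigma>..\<sigma>}" "\<bar>s\<bar> < \<tau>" using \<sigma> by auto
    have V0: "0 \<le> V x" using vf_norm_nonneg[OF x] .
    have "V (flow M X s x) \<le> C * norm (X c (flow M X s x))" by (rule kV(2)[OF fx(1,2)[OF s'(2)]])
    also have "\<dots> \<le> C * (2 * (V x / k))" using speed[OF s'(1)] pos by (intro mult_left_mono) auto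
    also have "\<dots> = (2 * C / k) * V x" by simp
    also have "\<dots> \<le> K * V x" using V0 q by (intro mult_right_mono) (auto simp: K_def)
    finally show "V (flow M X s x) \<le> K * V x" .
    have "norm (snd c (flow M X s x) - snd c (flow M X 0 x)) \<le> (2 * (V x / k)) * \<bar>s - 0\<bar>"
    proof (rule vector_derivative_bound[of "-\<sigma>" \<sigma>])
      fix t assume "t \<in> {-\<sigma>..\<sigma>}"
      then have t: "\<bar>t\<bar> < \<tau>" using \<sigma> by auto
      show "((\<lambda>t. snd c (flow M X t x)) has_vector_derivative X c (flow M X t x)) (at t within {-\<sigma>..\<sigma>})"
        by (rule has_vector_derivative_at_within[OF fx(3)[OF t]])
    qed (use speed s' \<sigma> in auto)
    then have n: "norm (snd c (flow M X s x) - snd c x) \<le> (2 * (V x / k)) * \<bar>s\<bar>" using flow_0[OF x] by simp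
    have "mdist M x (flow M X s x) \<le> C * norm (snd c (flow M X s x) - snd c x)"
      by (rule fD(6)) (use fx(1,2)[OF s'(2)] f fD(3) in auto)
    also have "\<dots> \<le> C * ((2 * (V x / k)) * \<bar>s\<bar>)" using n pos by (intro mult_left_mono) auto
    also have "\<dots> = (2 * C / k) * (\<bar>s\<bar> * V x)" by simp
    also have "\<dots> \<le> A * (\<bar>s\<bar> * V x)" using V0 q by (intro mult_right_mono) (auto simp: A_def)
    finally show "mdist M x (flow M X s x) \<le> A * \<bar>s\<bar> * V x" by (simp add: mult.assoc)
  qed (use \<sigma> in auto)
qed

end

section \<open>Regular flows and exponential rates\<close>

lemma (in closed_rmanifold) mdist_zero:
  assumes x: "x \<in> pts M" and y: "y \<in> pts M" and d: "mdist M x y = 0" shows "x = y"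
proof -
  obtain c r k C where gb: "good_ball c (snd c x) r k C" "x \<in> fst c" using good_ball_at[OF x] by blast
  then have p: "c \<in> atlas M" "r > 0" "k > 0" by (auto simp: good_ball_def)
  have l: "mdist M x y < k * r" using d p by simp
  from chart_le_mdist[OF gb p(2) order_refl y l] have "y \<in> fst c" "snd c y = snd c x" using d p by (auto simp: mult_le_0_iff)
  then show ?thesis using chart_inj[OF p(1)] gb(2) by (auto dest: inj_onD)
qed

lemma (in closed_rmanifold_field) fixed_imp_zero:
  assumes x: "x \<in> pts M" and f: "\<And>s. flow M X s x = x" shows "V x = 0"
proof -
  obtain c where c: "c \<in> atlas M" "x \<in> fst c" using chart_at[OF x] by blast
  have "((snd c \<circ> (\<lambda>s. flow M X s x)) has_vector_derivative X c x) (at 0)"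
    using flow_ic_at[OF x, of 0] c f by (auto simp: ic_at_def)
  then have "((\<lambda>s. snd c x) has_vector_derivative X c x) (at (0::real))" by (simp add: o_def f)
  moreover have "((\<lambda>s. snd c x) has_vector_derivative 0) (at (0::real))" by (rule has_vector_derivative_const)
  ultimately have "X c x = 0" using vector_derivative_unique_at by blast
  then show ?thesis using vf_norm_zero_iff[OF c] by simp
qed

text \<open>The dynamical arguments do not see charts. They use the following consequences of compactness and
  smoothness, with constants whose values do not matter: the entropies are limits for radius tending to zero.
  Time is restricted to \<open>\<bar>s\<bar> \<le> 1\<close>; longer times are reached by iteration.\<close>

locale regular_flow =
  fixes M :: "('a, 'e::euclidean_space) riem_manifold" and X :: "('a, 'e) vector_field"
    and K A B :: real and n :: nat
  assumes compact_pts: "compact_space (mtop M)" and pts_ne: "pts M \<noteq> {}"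
    and K: "1 \<le> K" and A: "0 < A" and B: "0 < B"
    and d_self: "\<And>x. x \<in> pts M \<Longrightarrow> mdist M x x = 0"
    and d_zero: "\<And>x y. x \<in> pts M \<Longrightarrow> y \<in> pts M \<Longrightarrow> mdist M x y = 0 \<Longrightarrow> x = y"
    and d_nonneg: "\<And>x y. x \<in> pts M \<Longrightarrow> y \<in> pts M \<Longrightarrow> 0 \<le> mdist M x y"
    and d_sym: "\<And>x y. x \<in> pts M \<Longrightarrow> y \<in> pts M \<Longrightarrow> mdist M x y = mdist M y x"
    and d_tri: "\<And>x y z. x \<in> pts M \<Longrightarrow> y \<in> pts M \<Longrightarrow> z \<in> pts M \<Longrightarrow> mdist M x z \<le> mdist M x y + mdist M y z"
    and fl_pts: "\<And>x t. x \<in> pts M \<Longrightarrow> flow M X t x \<in> pts M"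
    and fl_0: "\<And>x. x \<in> pts M \<Longrightarrow> flow M X 0 x = x"
    and fl_add: "\<And>x s t. x \<in> pts M \<Longrightarrow> flow M X (s + t) x = flow M X t (flow M X s x)"
    and fl_lip: "\<And>x y s. x \<in> pts M \<Longrightarrow> y \<in> pts M \<Longrightarrow> \<bar>s\<bar> \<le> 1 \<Longrightarrow> mdist M (flow M X s x) (flow M X s y) \<le> K * mdist M x y"
    and fl_speed: "\<And>x s. x \<in> pts M \<Longrightarrow> \<bar>s\<bar> \<le> 1 \<Longrightarrow> vf_norm M X (flow M X s x) \<le> K * vf_norm M X x"
    and fl_disp: "\<And>x s. x \<in> pts M \<Longrightarrow> \<bar>s\<bar> \<le> 1 \<Longrightarrow> mdist M x (flow M X s x) \<le> A * \<bar>s\<bar> * vf_norm M X x"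
    and V_lip: "\<And>x y. x \<in> pts M \<Longrightarrow> y \<in> pts M \<Longrightarrow> vf_norm M X y \<le> A * (vf_norm M X x + mdist M x y)"
    and V_cont: "continuous_map (mtop M) euclideanreal (vf_norm M X)"
    and V_nonneg: "\<And>x. x \<in> pts M \<Longrightarrow> 0 \<le> vf_norm M X x"
    and V_Sing: "\<And>x. x \<in> pts M \<Longrightarrow> x \<in> Sing M X \<longleftrightarrow> vf_norm M X x = 0"
    and fixed_V: "\<And>x. x \<in> pts M \<Longrightarrow> (\<And>s. flow M X s x = x) \<Longrightarrow> vf_norm M X x = 0"
    and cover: "\<And>\<eta>. 0 < \<eta> \<Longrightarrow> \<eta> \<le> 1 \<Longrightarrow> \<exists>P. P \<subseteq> pts M \<and> finite P \<and>
     real (card P) \<le> B * (1/\<eta>) ^ n \<and> (\<forall>x\<in>pts M. \<exists>y\<in>P. mdist M x y < \<eta>)"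

text \<open>The short-time estimates, iterated over steps of length at most \<open>\<sigma>\<close>.\<close>

lemma (in closed_rmanifold_field) regular_flow_exists: "\<exists>K A B n. regular_flow M X K A B n"
proof -
  obtain \<sigma> K A where E: "\<sigma> > 0" "K \<ge> 1" "A > 0"
    "\<And>x y s. x \<in> pts M \<Longrightarrow> y \<in> pts M \<Longrightarrow> \<bar>s\<bar> \<le> \<sigma> \<Longrightarrow> mdist M (flow M X s x) (flow M X s y) \<le> K * mdist M x y"
    "\<And>x s. x \<in> pts M \<Longrightarrow> \<bar>s\<bar> \<le> \<sigma> \<Longrightarrow> V (flow M X s x) \<le> K * V x"
    "\<And>x s. x \<in> pts M \<Longrightarrow> \<bar>s\<bar> \<le> \<sigma> \<Longrightarrow> mdist M x (flow M X s x) \<le> A * \<bar>s\<bar> * V x"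
    "\<And>x y. x \<in> pts M \<Longrightarrow> y \<in> pts M \<Longrightarrow> V y \<le> A * (V x + mdist M x y)"
    by (rule short_time_estimates) (rule that, assumption+)
  have it: "(\<forall>x\<in>pts M. \<forall>y\<in>pts M. mdist M (flow M X s x) (flow M X s y) \<le> K ^ j * mdist M x y) \<and>
    (\<forall>x\<in>pts M. V (flow M X s x) \<le> K ^ j * V x \<and> mdist M x (flow M X s x) \<le> A * K ^ j * \<bar>s\<bar> * V x)"
    if "\<bar>s\<bar> \<le> real j * \<sigma>" for s j
    using that
  proof (induction j arbitrary: s)
    case 0
    then have "s = 0" by simp
    then show ?case by (simp add: flow_0 mdist_self)
  next
    case (Suc j)
    define s1 where "s1 = s * (j / (j + 1))"
    define s2 where "s2 = s / (j + 1)"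
    have id: "a = a * (j / (j + 1)) + a / (j + 1)" for a :: real
    proof -
      have "a * (j / (j + 1)) + a / (j + 1) = (a * (real j + 1)) / (real j + 1)"
        by (simp only: of_nat_add of_nat_1 add_divide_distrib distrib_left times_divide_eq_right mult_1_right)
      then show ?thesis by simp
    qed
    have s: "s = s1 + s2" unfolding s1_def s2_def by (rule id)
    have ab: "\<bar>s\<bar> = \<bar>s1\<bar> + \<bar>s2\<bar>" using id[of "\<bar>s\<bar>"] by (simp add: s1_def s2_def abs_mult)
    have b1: "\<bar>s2\<bar> \<le> \<sigma>" using Suc.prems by (simp add: s2_def field_simps)
    have "\<bar>s1\<bar> = \<bar>s\<bar> * (j / (j + 1))" by (simp add: s1_def abs_mult)
    also have "\<dots> \<le> (real (Suc j) * \<sigma>) * (j / (j + 1))" using Suc.prems by (intro mult_right_mono) auto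
    also have "\<dots> = j * \<sigma>" by (simp add: field_simps)
    finally have b2: "\<bar>s1\<bar> \<le> j * \<sigma>" .
    note IH = Suc.IH[OF b2]
    have Kj: "K ^ j \<ge> 1" "K ^ j \<le> K ^ Suc j" using E(2) by (auto simp: one_le_power mult_left_mono)
    show ?case
    proof (intro conjI ballI)
      fix x y assume x: "x \<in> pts M" and y: "y \<in> pts M"
      have "mdist M (flow M X s x) (flow M X s y) \<le> K * mdist M (flow M X s1 x) (flow M X s1 y)"
        unfolding s using x y by (simp add: flow_add E(4) b1 flow_pts)
      also have "\<dots> \<le> K * (K ^ j * mdist M x y)" using IH x y E(2) by (intro mult_left_mono) auto
      finally show "mdist M (flow M X s x) (flow M X s y) \<le> K ^ Suc j * mdist M x y" by simp
    next
      fix x assume x: "x \<in> pts M"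
      have "V (flow M X s x) \<le> K * V (flow M X s1 x)" unfolding s using x by (simp add: flow_add E(5) b1 flow_pts)
      also have "\<dots> \<le> K * (K ^ j * V x)" using IH x E(2) by (intro mult_left_mono) auto
      finally show "V (flow M X s x) \<le> K ^ Suc j * V x" by simp
      let ?y = "flow M X s1 x"
      have "mdist M x (flow M X s x) \<le> mdist M x ?y + mdist M ?y (flow M X s2 ?y)"
        unfolding s using x by (simp add: flow_add mdist_triangle flow_pts)
      also have "\<dots> \<le> A * K ^ j * \<bar>s1\<bar> * V x + A * \<bar>s2\<bar> * (K ^ j * V x)"
      proof (intro add_mono)
        show "mdist M x ?y \<le> A * K ^ j * \<bar>s1\<bar> * V x" using IH x by auto
        have "mdist M ?y (flow M X s2 ?y) \<le> A * \<bar>s2\<bar> * V ?y" by (rule E(6)[OF flow_pts[OF x] b1])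
        also have "\<dots> \<le> A * \<bar>s2\<bar> * (K ^ j * V x)" using IH x E(3) by (intro mult_left_mono) auto
        finally show "mdist M ?y (flow M X s2 ?y) \<le> A * \<bar>s2\<bar> * (K ^ j * V x)" .
      qed
      also have "\<dots> = (A * \<bar>s\<bar> * V x) * K ^ j" unfolding ab by (simp add: algebra_simps)
      also have "\<dots> \<le> (A * \<bar>s\<bar> * V x) * K ^ Suc j" using Kj E(3) vf_norm_nonneg[OF x] by (intro mult_left_mono) auto
      finally show "mdist M x (flow M X s x) \<le> A * K ^ Suc j * \<bar>s\<bar> * V x" by (simp add: algebra_simps)
    qed
  qed
  obtain N :: nat where "1 / \<sigma> < N" using reals_Archimedean2 by blast
  then have N: "\<bar>s\<bar> \<le> N * \<sigma>" if "\<bar>s\<bar> \<le> 1" for s using that E(1) by (simp add: field_simps)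
  obtain B where B: "B > 0" "\<And>\<eta>. 0 < \<eta> \<Longrightarrow> \<eta> \<le> 1 \<Longrightarrow> \<exists>P. P \<subseteq> pts M \<and> finite P \<and>
     real (card P) \<le> B * (1/\<eta>) ^ DIM('e) \<and> (\<forall>x\<in>pts M. \<exists>y\<in>P. mdist M x y < \<eta>)"
    by (rule covering_number) (rule that, assumption+)
  have K1: "K ^ N \<ge> 1" using E(2) by (simp add: one_le_power)
  have VL: "V y \<le> A * K ^ N * (V x + mdist M x y)" if xy: "x \<in> pts M" "y \<in> pts M" for x y
  proof -
    have "A \<le> A * K ^ N" using K1 E(3) by simp
    then have "A * (V x + mdist M x y) \<le> A * K ^ N * (V x + mdist M x y)"
      using xy vf_norm_nonneg mdist_nonneg by (intro mult_right_mono) auto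
    then show ?thesis using E(7)[OF xy] by linarith
  qed
  have "regular_flow M X (K ^ N) (A * K ^ N) B (DIM('e))"
    by (unfold_locales; (fact compact_M pts_nonempty K1 B VL mdist_self mdist_zero mdist_nonneg mdist_sym mdist_triangle
        flow_pts flow_0 flow_add vf_norm_nonneg vf_norm_continuous Sing_iff fixed_imp_zero |
        use it[OF N] K1 E(3) in auto))
  then show ?thesis by blast
qed

text \<open>All limits in the definitions of the entropies are of this kind.\<close>

lemma Lim_antimono_SUP:
  fixes g :: "real \<Rightarrow> ereal"
  assumes g: "\<And>a b. 0 < a \<Longrightarrow> a \<le> b \<Longrightarrow> g b \<le> g a"
  shows "Lim (at_right 0) g = (SUP e\<in>{0<..}. g e)"
proof (rule tendsto_Lim)
  show "(g \<longlongrightarrow> (SUP e\<in>{0<..}. g e)) (at_right 0)"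
  proof (rule order_tendstoI)
    fix a assume "a < (SUP e\<in>{0<..}. g e)"
    then obtain e where e: "e > 0" "a < g e" by (auto simp: less_SUP_iff)
    have "a < g x" if "x \<in> {0<..<e}" for x using g[of x e] that e by (auto intro: less_le_trans)
    then show "eventually (\<lambda>x. a < g x) (at_right 0)"
      using eventually_at_right_less[of 0] e(1) unfolding eventually_at_right[OF e(1)] by (metis greaterThanLessThan_iff)
  next
    fix a assume a: "(SUP e\<in>{0<..}. g e) < a"
    have "g x < a" if "x > 0" for x using a that by (meson SUP_upper greaterThan_iff le_less_trans)
    then show "eventually (\<lambda>x. g x < a) (at_right 0)"
      using eventually_at_right_less[of 0] by (auto elim: eventually_mono)
  qed
qed simp

lemma ereal_le_if_real_gt:
  fixes a b :: ereal
  assumes "\<And>h::real. b < ereal h \<Longrightarrow> a \<le> ereal h" shows "a \<le> b"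
proof (rule dense_ge)
  fix z assume "b < z"
  then obtain w where w: "b < w" "w < z" using dense by blast
  then obtain h where "w = ereal h" by (cases w) auto
  then show "a \<le> z" using assms[of h] w by auto
qed

lemma elog_mono: "m \<le> n \<Longrightarrow> elog m \<le> elog n"
  by (cases m; cases n) (auto simp: elog_def)

text \<open>These two facts translate between exponential rates and bounds for large times. The factor \<open>\<tau> i + 1\<close> leaves
  room for the linear factors that sums over times produce.\<close>

lemma rate_le:
  assumes F: "F \<noteq> bot" and \<tau>: "filterlim \<tau> at_top F" and C: "0 < C"
    and ev: "eventually (\<lambda>i. \<exists>k. R i \<le> enat k \<and> real k \<le> C * (\<tau> i + 1) * exp (h * \<tau> i)) F"
  shows "Limsup F (\<lambda>i. elog (R i) / ereal (\<tau> i)) \<le> ereal h"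
proof -
  let ?f = "\<lambda>t. (ln C + ln (t + 1) + h * t) / t"
  have "(?f \<longlongrightarrow> h) at_top" by real_asymp
  then have lim: "((\<lambda>i. ereal (?f (\<tau> i))) \<longlongrightarrow> ereal h) F"
    using filterlim_compose[OF _ \<tau>] by (intro tendsto_intros) blast
  have "eventually (\<lambda>i. \<tau> i > 0) F" using \<tau> by (simp add: filterlim_at_top_dense)
  then have "eventually (\<lambda>i. elog (R i) / ereal (\<tau> i) \<le> ereal (?f (\<tau> i))) F"
    using ev
  proof eventually_elim
    case (elim i)
    then obtain k where k: "R i \<le> enat k" "real k \<le> C * (\<tau> i + 1) * exp (h * \<tau> i)" by blast
    have "elog (enat k) \<le> ereal (ln C + ln (\<tau> i + 1) + h * \<tau> i)"
    proof (cases "k = 0")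
      case False
      then have "ln (real k) \<le> ln (C * (\<tau> i + 1) * exp (h * \<tau> i))" using k by (subst ln_le_cancel_iff) auto
      also have "\<dots> = ln C + ln (\<tau> i + 1) + h * \<tau> i" using C elim by (simp add: ln_mult)
      finally show ?thesis using False by (simp add: elog_def)
    qed (simp add: elog_def)
    then have "elog (R i) \<le> ereal (ln C + ln (\<tau> i + 1) + h * \<tau> i)" using elog_mono[OF k(1)] order_trans by blast
    then have "elog (R i) / ereal (\<tau> i) \<le> ereal (ln C + ln (\<tau> i + 1) + h * \<tau> i) / ereal (\<tau> i)"
      using elim by (intro ereal_divide_right_mono) auto
    then show ?case using elim by simp
  qed
  then have "Limsup F (\<lambda>i. elog (R i) / ereal (\<tau> i)) \<le> Limsup F (\<lambda>i. ereal (?f (\<tau> i)))" by (rule Limsup_mono)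
  also have "\<dots> = ereal h" by (rule lim_imp_Limsup[OF F lim])
  finally show ?thesis .
qed

lemma rate_less:
  assumes \<tau>: "filterlim \<tau> at_top F" and l: "Limsup F (\<lambda>i. elog (R i) / ereal (\<tau> i)) < ereal h"
  shows "eventually (\<lambda>i. \<exists>k. R i = enat k \<and> real k \<le> exp (h * \<tau> i)) F"
proof -
  have "eventually (\<lambda>i. \<tau> i > 0) F" using \<tau> by (simp add: filterlim_at_top_dense)
  then show ?thesis using Limsup_lessD[OF l]
  proof eventually_elim
    case (elim i)
    show ?case
    proof (cases "R i")
      case (enat k)
      have "real k \<le> exp (h * \<tau> i)"
      proof (cases "k = 0")
        case False
        then have "ln (real k) / \<tau> i < h" using elim enat by (simp add: elog_def)
        then have "ln (real k) < h * \<tau> i" using elim by (simp add: field_simps)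
        then show ?thesis using False by (metis exp_less_cancel_iff exp_ln less_imp_le of_nat_0_less_iff not_gr_zero)
      qed simp
      then show ?thesis using enat by blast
    next
      case infinity
      then show ?thesis using elim by (simp add: elog_def)
    qed
  qed
qed

lemma Limsup_rate_mono:
  fixes R R' :: "real \<Rightarrow> enat"
  assumes "\<And>t. 0 \<le> t \<Longrightarrow> R t \<le> R' t"
  shows "Limsup at_top (\<lambda>t::real. elog (R t) / ereal t) \<le> Limsup at_top (\<lambda>t::real. elog (R' t) / ereal t)"
proof (rule Limsup_mono)
  show "\<forall>\<^sub>F t in at_top. elog (R t) / ereal t \<le> elog (R' t) / ereal t"
    using eventually_gt_at_top[of 0]
    by eventually_elim (auto intro!: ereal_divide_right_mono elog_mono assms)
qed

abbreviation "rescaled_rate M X e \<equiv> Limsup at_top (\<lambda>t::real. elog (rspan_number M X t e) / ereal t)"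

lemma rspan_number_antimono: "a \<le> b \<Longrightarrow> rspan_number M X t b \<le> rspan_number M X t a"
  unfolding rspan_number_def
proof (rule INF_superset_mono)
  assume "a \<le> b"
  then show "{F. rescaled_spanning M X t a F} \<subseteq> {F. rescaled_spanning M X t b F}"
  proof (intro subsetI CollectI)
    fix F assume F: "F \<in> {F. rescaled_spanning M X t a F}"
    have "rball M X x t a \<subseteq> rball M X x t b" for x using \<open>a \<le> b\<close> by (auto simp: rball_def)
    moreover have "{x \<in> pts M. vf_norm M X x \<ge> b} \<subseteq> {x \<in> pts M. vf_norm M X x \<ge> a}" using \<open>a \<le> b\<close> by auto
    ultimately show "rescaled_spanning M X t b F" using F unfolding rescaled_spanning_def by blast
  qed
qed simp

lemma rescaled_entropy_SUP: "rescaled_entropy M X = (SUP e\<in>{0<..}. rescaled_rate M X e)"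
  unfolding rescaled_entropy_def
  by (rule Lim_antimono_SUP, rule Limsup_rate_mono, rule rspan_number_antimono)

lemma rescaled_rate_le_entropy: "0 < e \<Longrightarrow> rescaled_rate M X e \<le> rescaled_entropy M X"
  unfolding rescaled_entropy_SUP by (rule SUP_upper) simp

lemma INF_ecard_attained:
  assumes "(INF F\<in>\<F>. ecard F) \<le> enat k" obtains F where "F \<in> \<F>" "finite F" "card F \<le> k"
proof -
  have "(INF F\<in>\<F>. ecard F) < enat (Suc k)" using assms by (rule le_less_trans) simp
  then obtain F where F: "F \<in> \<F>" "ecard F < enat (Suc k)" by (auto simp: INF_less_iff)
  then show thesis using that by (auto simp: ecard_def split: if_splits)
qed

lemma INF_ecard_le: "F \<in> \<F> \<Longrightarrow> finite F \<Longrightarrow> (INF F\<in>\<F>. ecard F) \<le> enat (card F)"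
  by (rule INF_lower2) (auto simp: ecard_def)

lemma span_number_antimono: "a \<le> b \<Longrightarrow> span_number S d f n b \<le> span_number S d f n a"
  unfolding span_number_def by (rule INF_superset_mono) (auto, meson less_le_trans)

abbreviation "span_rate S d f e \<equiv> limsup (\<lambda>n. elog (span_number S d f n e) / ereal (real n))"

lemma top_entropy_SUP: "top_entropy S d f = (SUP e\<in>{0<..}. span_rate S d f e)"
  unfolding top_entropy_def
proof (rule Lim_antimono_SUP, rule Limsup_mono)
  fix a b :: real assume ab: "a \<le> b"
  show "\<forall>\<^sub>F n in sequentially. elog (span_number S d f n b) / ereal (real n) \<le> elog (span_number S d f n a) / ereal (real n)"
    using eventually_gt_at_top[of "0::nat"]
    by eventually_elim (use ab in \<open>auto intro!: ereal_divide_right_mono elog_mono span_number_antimono\<close>)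
qed

text \<open>One representative for each value of \<open>code\<close> forms a spanning set.\<close>

lemma span_number_code:
  assumes K: "finite K" "code ` S \<subseteq> K"
    and close: "\<And>x y i. x \<in> S \<Longrightarrow> y \<in> S \<Longrightarrow> code x = code y \<Longrightarrow> i < n \<Longrightarrow> d ((f ^^ i) x) ((f ^^ i) y) < e"
  shows "span_number S d f n e \<le> enat (card K)"
proof -
  obtain F where F: "F \<subseteq> S" "finite F" "card F \<le> card K" "\<And>x. x \<in> S \<Longrightarrow> \<exists>y\<in>F. code y = code x"
    by (rule few_codes[OF K]) (rule that, assumption+)
  have "\<forall>y\<in>S. \<exists>x\<in>F. \<forall>i<n. d ((f ^^ i) x) ((f ^^ i) y) < e" using F(1,4) close by (meson subsetD)
  then have "span_number S d f n e \<le> enat (card F)"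
    unfolding span_number_def using F by (intro INF_ecard_le) auto
  then show ?thesis using F(3) by (meson enat_ord_simps(1) order_trans)
qed

section \<open>Finiteness, metric entropy, and the nonsingular case\<close>

context regular_flow
begin

abbreviation "V \<equiv> vf_norm M X"
abbreviation "\<phi> \<equiv> flow M X"

lemma regular_iff: "x \<in> regular_pts M X \<longleftrightarrow> x \<in> pts M \<and> 0 < V x"
  using V_Sing V_nonneg by (auto simp: regular_pts_def order_less_le)

text \<open>The bounds for unit time, iterated. Singular points are fixed because the displacement is bounded by the
  speed.\<close>

lemma fl_iterate:
  assumes "\<bar>s\<bar> \<le> real j"
  shows "x \<in> pts M \<Longrightarrow> y \<in> pts M \<Longrightarrow> mdist M (\<phi> s x) (\<phi> s y) \<le> K ^ j * mdist M x y"
    and "x \<in> pts M \<Longrightarrow> V (\<phi> s x) \<le> K ^ j * V x"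
    and "x \<in> pts M \<Longrightarrow> V x = 0 \<Longrightarrow> \<phi> s x = x"
proof -
  have "(\<forall>x\<in>pts M. \<forall>y\<in>pts M. mdist M (\<phi> s x) (\<phi> s y) \<le> K ^ j * mdist M x y) \<and>
    (\<forall>x\<in>pts M. V (\<phi> s x) \<le> K ^ j * V x \<and> (V x = 0 \<longrightarrow> \<phi> s x = x))"
    using assms
  proof (induction j arbitrary: s)
    case 0
    then have "s = 0" by simp
    then show ?case by (simp add: fl_0)
  next
    case (Suc j)
    define s2 where "s2 = max (-1) (min 1 s)"
    define s1 where "s1 = s - s2"
    have s: "s = s1 + s2" "\<bar>s2\<bar> \<le> 1" "\<bar>s1\<bar> \<le> real j"
      using Suc.prems by (auto simp: s1_def s2_def)
    note IH = Suc.IH[OF s(3)]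
    show ?case
    proof (intro conjI ballI impI)
      fix x y assume x: "x \<in> pts M" and y: "y \<in> pts M"
      have "mdist M (\<phi> s x) (\<phi> s y) \<le> K * mdist M (\<phi> s1 x) (\<phi> s1 y)"
        unfolding s(1) using x y by (simp add: fl_add fl_lip s(2) fl_pts)
      also have "\<dots> \<le> K * (K ^ j * mdist M x y)" using IH x y K by (intro mult_left_mono) auto
      finally show "mdist M (\<phi> s x) (\<phi> s y) \<le> K ^ Suc j * mdist M x y" by simp
    next
      fix x assume x: "x \<in> pts M"
      have "V (\<phi> s x) \<le> K * V (\<phi> s1 x)" unfolding s(1) using x by (simp add: fl_add fl_speed s(2) fl_pts)
      also have "\<dots> \<le> K * (K ^ j * V x)" using IH x K by (intro mult_left_mono) auto
      finally show "V (\<phi> s x) \<le> K ^ Suc j * V x" by simp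
    next
      fix x assume x: "x \<in> pts M" and v: "V x = 0"
      have "mdist M x (\<phi> s2 x) \<le> 0" using fl_disp[OF x s(2)] v by simp
      then have "\<phi> s2 x = x" using d_zero[OF x fl_pts[OF x]] d_nonneg[OF x fl_pts[OF x]] by (metis order_antisym)
      then show "\<phi> s x = x" unfolding s(1) using fl_add[OF x] IH x v by simp
    qed
  qed
  then show "x \<in> pts M \<Longrightarrow> y \<in> pts M \<Longrightarrow> mdist M (\<phi> s x) (\<phi> s y) \<le> K ^ j * mdist M x y"
    "x \<in> pts M \<Longrightarrow> V (\<phi> s x) \<le> K ^ j * V x" "x \<in> pts M \<Longrightarrow> V x = 0 \<Longrightarrow> \<phi> s x = x" by auto
qed

lemma singular_iff_fixed: "x \<in> pts M \<Longrightarrow> V x = 0 \<longleftrightarrow> (\<forall>s. \<phi> s x = x)"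
  using fixed_V[of x] fl_iterate(3)[OF real_nat_ceiling_ge] by blast

lemma speed_lower: "x \<in> pts M \<Longrightarrow> \<bar>s\<bar> \<le> real j \<Longrightarrow> V x \<le> K ^ j * V (\<phi> s x)"
  using fl_iterate(2)[of "-s" j "\<phi> s x"] fl_add[of x s "-s"] by (simp add: fl_0 fl_pts)

lemma regular_flow_pts: assumes "x \<in> regular_pts M X" shows "0 < V (\<phi> s x)"
proof -
  have x: "x \<in> pts M" "0 < V x" using assms regular_iff by auto
  have "V x \<le> K ^ nat \<lceil>\<bar>s\<bar>\<rceil> * V (\<phi> s x)" by (rule speed_lower[OF x(1) real_nat_ceiling_ge])
  moreover have "0 < K ^ nat \<lceil>\<bar>s\<bar>\<rceil>" using K by simp
  ultimately show ?thesis using x by (smt (verit) mult_pos_pos zero_less_mult_pos)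
qed

text \<open>The supremum in \<open>rdist\<close> is over a bounded set of reals because distances grow, and speeds decay, at most
  exponentially; only then does it dominate its members.\<close>

lemma rdist_lessD:
  assumes x: "x \<in> regular_pts M X" and y: "y \<in> pts M" and s: "0 \<le> s" "s \<le> t" and r: "rdist M X t x y < e"
  shows "mdist M (\<phi> s x) (\<phi> s y) < e * V (\<phi> s x)"
proof -
  let ?q = "\<lambda>s. mdist M (\<phi> s x) (\<phi> s y) / V (\<phi> s x)"
  let ?m = "nat \<lceil>t\<rceil>"
  have xp: "x \<in> pts M" "0 < V x" using x regular_iff by auto
  have "?q u \<le> (K ^ ?m * mdist M x y) / (V x / K ^ ?m)" if u: "u \<in> {0..t}" for u
  proof (rule frac_le)
    have m: "\<bar>u\<bar> \<le> real ?m" using u real_nat_ceiling_ge[of t] unfolding atLeastAtMost_iff by linarith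
    show "mdist M (\<phi> u x) (\<phi> u y) \<le> K ^ ?m * mdist M x y" by (rule fl_iterate(1)[OF m xp(1) y])
    have "V x \<le> K ^ ?m * V (\<phi> u x)" by (rule speed_lower[OF xp(1) m])
    then show "V x / K ^ ?m \<le> V (\<phi> u x)" using K by (simp add: field_simps)
  qed (use xp K y d_nonneg[OF xp(1) y] in auto)
  then have "bdd_above (?q ` {0..t})" by (rule bdd_aboveI2)
  then have "?q s \<le> rdist M X t x y" unfolding rdist_def by (rule cSUP_upper[rotated]) (use s in auto)
  then have "?q s < e" using r by simp
  then show ?thesis using regular_flow_pts[OF x, of s] by (simp add: field_simps)
qed

lemma rdist_leI:
  assumes x: "x \<in> regular_pts M X" and t: "0 \<le> t"
    and le: "\<And>s. 0 \<le> s \<Longrightarrow> s \<le> t \<Longrightarrow> mdist M (\<phi> s x) (\<phi> s y) \<le> e * V (\<phi> s x)"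
  shows "rdist M X t x y \<le> e"
  unfolding rdist_def
  by (rule cSUP_least) (use t le regular_flow_pts[OF x] in \<open>auto simp: field_simps\<close>)

lemma subset_net:
  assumes S: "S \<subseteq> pts M" and \<eta>: "0 < \<eta>" "\<eta> \<le> 1"
  obtains P where "P \<subseteq> S" "finite P" "real (card P) \<le> B * (2/\<eta>) ^ n" "\<And>x. x \<in> S \<Longrightarrow> \<exists>y\<in>P. mdist M y x < \<eta>"
proof -
  obtain Q where Q: "Q \<subseteq> pts M" "finite Q" "real (card Q) \<le> B * (1/(\<eta>/2)) ^ n" "\<forall>x\<in>pts M. \<exists>y\<in>Q. mdist M x y < \<eta>/2"
    using cover[of "\<eta>/2"] \<eta> by auto
  then obtain code where c: "\<And>x. x \<in> pts M \<Longrightarrow> code x \<in> Q \<and> mdist M x (code x) < \<eta>/2" by metis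
  have sub: "code ` S \<subseteq> Q" using c S by auto
  obtain P where P: "P \<subseteq> S" "finite P" "card P \<le> card Q" "\<And>x. x \<in> S \<Longrightarrow> \<exists>y\<in>P. code y = code x"
    by (rule few_codes[OF Q(2) sub]) (rule that, assumption+)
  show thesis
  proof (rule that[OF P(1,2)])
    show "real (card P) \<le> B * (2/\<eta>) ^ n" using P(3) Q(3) by simp
    fix x assume x: "x \<in> S"
    then obtain y where y: "y \<in> P" "code y = code x" using P(4) by blast
    have p: "x \<in> pts M" "y \<in> pts M" "code x \<in> pts M" using x y P(1) S Q(1) c by auto
    have "mdist M y x \<le> mdist M y (code x) + mdist M (code x) x" by (rule d_tri[OF p(2,3,1)])
    also have "\<dots> < \<eta>/2 + \<eta>/2" using c[OF p(1)] c[OF p(2)] y d_sym[OF p(3,1)] by simp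
    finally show "\<exists>y\<in>P. mdist M y x < \<eta>" using y by auto
  qed
qed

lemma rspan_attained:
  assumes "rspan_number M X t e \<le> enat k"
  obtains F where "rescaled_spanning M X t e F" "finite F" "card F \<le> k"
  by (rule INF_ecard_attained[OF assms[unfolded rspan_number_def]]) (rule that, auto)

lemma rspan_le: "rescaled_spanning M X t e F \<Longrightarrow> finite F \<Longrightarrow> rspan_number M X t e \<le> enat (card F)"
  unfolding rspan_number_def by (rule INF_ecard_le) auto

text \<open>The flow expands distances, and shrinks speeds, at most exponentially: a net at an exponentially fine
  scale is rescaled spanning.\<close>

lemma rspan_number_bound:
  assumes e: "0 < e" "e \<le> 1" and t: "0 \<le> t"
  shows "\<exists>k. rspan_number M X t e \<le> enat k \<and> real k \<le> (B * (8/e\<^sup>2) ^ n * K ^ (2*n)) * exp (2 * n * ln K * t)"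
proof -
  let ?m = "nat \<lceil>t\<rceil>"
  \<comment> \<open>One factor \<open>K ^ ?m\<close> pays for the growth of the distance, the other one for the decay of the speed.\<close>
  define \<eta> where "\<eta> = e\<^sup>2 / (4 * K ^ (2 * ?m))"
  have K1: "1 \<le> K ^ (2 * ?m)" using K by (simp add: one_le_power)
  have "e\<^sup>2 \<le> 1" using e by (simp add: power_le_one)
  then have \<eta>: "0 < \<eta>" "\<eta> \<le> 1" using e K1 by (auto simp: \<eta>_def field_simps)
  let ?S = "{x \<in> pts M. V x \<ge> e}"
  obtain P where P: "P \<subseteq> ?S" "finite P" "real (card P) \<le> B * (2/\<eta>) ^ n" "\<And>x. x \<in> ?S \<Longrightarrow> \<exists>y\<in>P. mdist M y x < \<eta>"
    by (rule subset_net[OF _ \<eta>, of ?S]) (auto intro: that)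
  have reg: "y \<in> regular_pts M X" if "y \<in> P" for y using that P(1) e regular_iff by auto
  have "?S \<subseteq> (\<Union>x\<in>P. rball M X x t e)"
  proof
    fix x assume x: "x \<in> ?S"
    then obtain y where y: "y \<in> P" "mdist M y x < \<eta>" using P(4) by blast
    have p: "x \<in> pts M" "y \<in> pts M" "e \<le> V y" using x y P(1) by auto
    have "rdist M X t y x \<le> e / 2"
    proof (rule rdist_leI[OF reg[OF y(1)] t])
      fix s assume s: "0 \<le> s" "s \<le> t"
      have m: "\<bar>s\<bar> \<le> real ?m" using s real_nat_ceiling_ge[of t] by linarith
      have "mdist M (\<phi> s y) (\<phi> s x) \<le> K ^ ?m * mdist M y x" by (rule fl_iterate(1)[OF m p(2,1)])
      also have "\<dots> \<le> K ^ ?m * \<eta>" using y K by (intro mult_left_mono) auto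
      also have "\<dots> \<le> (e/2) * (e / K ^ ?m)"
      proof -
        define a where "a = K ^ ?m"
        have a: "a > 0" using K by (simp add: a_def)
        have "\<eta> = (e * e) / (4 * (a * a))" by (simp only: \<eta>_def a_def power2_eq_square mult_2 power_add)
        then have "a * \<eta> = (e * e) / (4 * a)" using a by simp
        also have "\<dots> \<le> (e * e) / (2 * a)" using a by (intro divide_left_mono) auto
        finally show ?thesis by (simp add: a_def)
      qed
      also have "\<dots> \<le> (e/2) * V (\<phi> s y)"
      proof (rule mult_left_mono)
        have "e \<le> K ^ ?m * V (\<phi> s y)" using speed_lower[OF p(2) m] p(3) by simp
        then show "e / K ^ ?m \<le> V (\<phi> s y)" using K by (simp add: field_simps)
      qed (use e in auto)
      finally show "mdist M (\<phi> s y) (\<phi> s x) \<le> (e/2) * V (\<phi> s y)" .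
    qed
    then show "x \<in> (\<Union>x\<in>P. rball M X x t e)" using y p e by (auto simp: rball_def intro!: bexI[of _ y])
  qed
  then have "rescaled_spanning M X t e P" using reg by (auto simp: rescaled_spanning_def)
  then have r: "rspan_number M X t e \<le> enat (card P)" using P(2) by (rule rspan_le)
  have "2 / \<eta> = (8/e\<^sup>2) * K ^ (2 * ?m)" using e K by (simp add: \<eta>_def field_simps)
  then have "real (card P) \<le> B * ((8/e\<^sup>2) * K ^ (2 * ?m)) ^ n" using P(3) by simp
  also have "\<dots> = (B * (8/e\<^sup>2) ^ n) * K ^ (2 * n * ?m)"
  proof -
    have "2 * n * ?m = 2 * ?m * n" by simp
    then show ?thesis by (simp only: power_mult_distrib power_mult mult.assoc)
  qed
  also have "\<dots> \<le> (B * (8/e\<^sup>2) ^ n) * (K ^ (2*n) * exp (2 * n * ln K * t))"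
  proof (rule mult_left_mono)
    have "real ?m \<le> t + 1" using t by linarith
    then have "2 * n * ln K * ?m \<le> 2 * n * ln K * (t + 1)" using K by (intro mult_left_mono) auto
    also have "\<dots> = 2 * n * ln K + 2 * n * ln K * t" by (simp add: algebra_simps)
    finally have "exp (2 * n * ln K * ?m) \<le> exp (2 * n * ln K) * exp (2 * n * ln K * t)" by (simp add: exp_add[symmetric])
    moreover have pw: "K ^ j = exp (real j * ln K)" for j using K by (simp add: exp_of_nat_mult)
    ultimately show "K ^ (2 * n * ?m) \<le> K ^ (2*n) * exp (2 * n * ln K * t)"
      by (simp only: pw of_nat_mult of_nat_numeral) (simp add: mult.commute mult.left_commute)
  qed (use B e in auto)
  finally show ?thesis using r by (auto simp: mult.assoc)
qed

lemma rescaled_rate_bound: assumes e: "0 < e" shows "rescaled_rate M X e \<le> ereal (2 * n * ln K)"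
proof -
  let ?e = "min e 1"
  have e': "0 < ?e" "?e \<le> 1" using e by auto
  have "rescaled_rate M X e \<le> rescaled_rate M X ?e"
    by (rule Limsup_rate_mono[OF rspan_number_antimono]) simp
  also have "\<dots> \<le> ereal (2 * n * ln K)"
  proof (rule rate_le)
    let ?C = "B * (8/?e\<^sup>2) ^ n * K ^ (2*n)"
    show C: "0 < ?C" using B K e' by (auto intro!: mult_pos_pos)
    show "\<forall>\<^sub>F t in at_top. \<exists>k. rspan_number M X t ?e \<le> enat k \<and> real k \<le> ?C * (t + 1) * exp (2 * n * ln K * t)"
      using eventually_ge_at_top[of 0]
    proof eventually_elim
      case (elim t)
      obtain k where k: "rspan_number M X t ?e \<le> enat k" "real k \<le> ?C * exp (2 * n * ln K * t)"
        using rspan_number_bound[OF e' elim] by blast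
      have "?C * 1 \<le> ?C * (t + 1)" using C elim by (intro mult_left_mono) auto
      then have "?C * exp (2 * n * ln K * t) \<le> ?C * (t + 1) * exp (2 * n * ln K * t)"
        by (intro mult_right_mono) auto
      then show ?case using k by (intro exI[of _ k]) linarith
    qed
  qed (auto simp: filterlim_ident)
  finally show ?thesis .
qed

lemma rescaled_rate_nonneg:
  assumes "x \<in> pts M" "e \<le> V x" shows "0 \<le> rescaled_rate M X e"
proof -
  have one: "1 \<le> rspan_number M X t e" for t
    unfolding rspan_number_def
  proof (rule INF_greatest)
    fix F assume "F \<in> {F. rescaled_spanning M X t e F}"
    then have "F \<noteq> {}" using assms by (auto simp: rescaled_spanning_def)
    then show "1 \<le> ecard F" by (cases "finite F") (auto simp: ecard_def one_enat_def Suc_le_eq card_gt_0_iff)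
  qed
  have "elog 1 = 0" by (simp add: elog_def one_enat_def)
  then have el: "0 \<le> elog (rspan_number M X t e)" for t using elog_mono[OF one[of t]] by simp
  have "(0::ereal) = Limsup at_top (\<lambda>t::real. 0)" by (simp add: Limsup_const)
  also have "\<dots> \<le> rescaled_rate M X e"
  proof (rule Limsup_mono)
    show "\<forall>\<^sub>F t in at_top. 0 \<le> elog (rspan_number M X t e) / ereal t"
      using eventually_gt_at_top[of "0::real"] 
    proof eventually_elim
      case (elim t)
      have "0 / ereal t \<le> elog (rspan_number M X t e) / ereal t"
        by (rule ereal_divide_right_mono[OF el]) (use elim in auto)
      then show ?case by simp
    qed
  qed
  finally show ?thesis .
qed

lemma rescaled_entropy_real:
  assumes "nonzero_field M X" shows "\<exists>r::real. 0 \<le> r \<and> rescaled_entropy M X = ereal r"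
proof -
  obtain x where x: "x \<in> pts M" "x \<notin> Sing M X" using assms by (auto simp: nonzero_field_def)
  then have "0 < V x" using V_Sing V_nonneg by (auto simp: order_less_le)
  then have "0 \<le> rescaled_entropy M X"
    using rescaled_rate_nonneg[OF x(1) order_refl] rescaled_rate_le_entropy order_trans by blast
  moreover have "rescaled_entropy M X \<le> ereal (2 * n * ln K)"
    unfolding rescaled_entropy_SUP by (rule SUP_least) (use rescaled_rate_bound in auto)
  ultimately show ?thesis by (cases "rescaled_entropy M X") auto
qed

text \<open>The regions of speed at least \<open>1 / (k + 1)\<close> exhaust the regular points, so one of them has measure above
  \<open>1 - \<delta>\<close>; for smaller \<open>e\<close> every rescaled spanning set is a cover in the sense of the metric entropy.\<close>

lemma metric_entropy_le:
  assumes \<mu>: "borel_prob (mtop M) \<mu>" and S: "measure \<mu> (Sing M X) = 0"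
  shows "rescaled_metric_entropy M X \<mu> \<le> rescaled_entropy M X"
proof -
  interpret prob_space \<mu> using \<mu> by (simp add: borel_prob_def)
  have sp: "space \<mu> = pts M" and opn: "openin (mtop M) U \<Longrightarrow> U \<in> sets \<mu>" for U
    using \<mu> by (auto simp: borel_prob_def intro: sigma_sets.Basic)
  have Msets: "{x \<in> pts M. V x \<ge> e} \<in> sets \<mu>" for e
  proof -
    have "closedin (mtop M) {x \<in> pts M. V x \<in> {e..}}"
      by (rule closedin_continuous_map_preimage[OF V_cont]) auto
    then have "pts M - {x \<in> pts M. V x \<in> {e..}} \<in> sets \<mu>" by (auto simp: closedin_def intro: opn)
    then have "space \<mu> - (pts M - {x \<in> pts M. V x \<in> {e..}}) \<in> sets \<mu>" by (rule sets.compl_sets)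
    moreover have "space \<mu> - (pts M - {x \<in> pts M. V x \<in> {e..}}) = {x \<in> pts M. V x \<ge> e}" by (auto simp: sp)
    ultimately show ?thesis by simp
  qed
  define E where "E k = {x \<in> pts M. V x \<ge> 1 / real (Suc k)}" for k
  have un: "(\<Union>k. E k) = pts M - Sing M X"
  proof (intro equalityI subsetI)
    fix x assume x: "x \<in> pts M - Sing M X"
    then have "0 < V x" using V_Sing V_nonneg by (auto simp: order_less_le)
    then obtain k where "inverse (real (Suc k)) < V x" using reals_Archimedean by blast
    then show "x \<in> (\<Union>k. E k)" using x by (auto simp: E_def inverse_eq_divide intro!: exI[of _ k])
  next
    fix x assume "x \<in> (\<Union>k. E k)"
    then obtain k where k: "x \<in> pts M" "1 / real (Suc k) \<le> V x" by (auto simp: E_def)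
    have "0 < 1 / real (Suc k)" by simp
    then have "V x \<noteq> 0" using k(2) by linarith
    then show "x \<in> pts M - Sing M X" using V_Sing k by auto
  qed
  have "incseq E"
    unfolding incseq_Suc_iff
  proof
    fix k
    have "1 / real (Suc (Suc k)) \<le> 1 / real (Suc k)" by (rule divide_left_mono) auto
    then show "E k \<le> E (Suc k)" by (auto simp: E_def simp del: of_nat_Suc)
  qed
  then have lim: "(\<lambda>k. measure \<mu> (E k)) \<longlonglongrightarrow> measure \<mu> (\<Union>k. E k)"
    using Msets by (intro finite_Lim_measure_incseq) (auto simp: E_def[abs_def])
  have Ssets: "Sing M X \<in> sets \<mu>"
  proof -
    have "(\<Union>k. E k) \<in> sets \<mu>" by (auto simp: E_def Msets)
    then have "space \<mu> - (\<Union>k. E k) \<in> sets \<mu>" by (rule sets.compl_sets)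
    moreover have "space \<mu> - (\<Union>k. E k) = Sing M X" unfolding un sp by (auto simp: Sing_def)
    ultimately show ?thesis by simp
  qed
  then have "measure \<mu> (\<Union>k. E k) = 1" using prob_compl[OF Ssets] S un sp by simp
  then have lim1: "(\<lambda>k. measure \<mu> (E k)) \<longlonglongrightarrow> 1" using lim by simp
  let ?g = "\<lambda>\<delta> e. Limsup at_top (\<lambda>t::real. elog (rcover_number M X \<mu> t e \<delta>) / ereal t)"
  have anti: "rcover_number M X \<mu> t b \<delta>' \<le> rcover_number M X \<mu> t a \<delta>" if "a \<le> b" "\<delta> \<le> \<delta>'" for t a b \<delta> \<delta>'
    unfolding rcover_number_def
  proof (rule INF_superset_mono)
    have rb: "rball M X x t a \<subseteq> rball M X x t b" for x using \<open>a \<le> b\<close> by (auto simp: rball_def)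
    show "{F. F \<subseteq> regular_pts M X \<and> (\<exists>A\<in>sets \<mu>. A \<subseteq> (\<Union>x\<in>F. rball M X x t a) \<and> measure \<mu> A > 1 - \<delta>)} \<subseteq>
      {F. F \<subseteq> regular_pts M X \<and> (\<exists>A\<in>sets \<mu>. A \<subseteq> (\<Union>x\<in>F. rball M X x t b) \<and> measure \<mu> A > 1 - \<delta>')}"
    proof (rule subsetI, rule CollectI, rule conjI)
      fix F assume F: "F \<in> {F. F \<subseteq> regular_pts M X \<and> (\<exists>A\<in>sets \<mu>. A \<subseteq> (\<Union>x\<in>F. rball M X x t a) \<and> measure \<mu> A > 1 - \<delta>)}"
      then show "F \<subseteq> regular_pts M X" by blast
      from F obtain A where A: "A \<in> sets \<mu>" "A \<subseteq> (\<Union>x\<in>F. rball M X x t a)" "measure \<mu> A > 1 - \<delta>" by blast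
      show "\<exists>A\<in>sets \<mu>. A \<subseteq> (\<Union>x\<in>F. rball M X x t b) \<and> measure \<mu> A > 1 - \<delta>'"
      proof (intro bexI[of _ A] conjI A(1))
        show "A \<subseteq> (\<Union>x\<in>F. rball M X x t b)" using A(2) rb by blast
        show "measure \<mu> A > 1 - \<delta>'" using A(3) that(2) by linarith
      qed
    qed
  qed simp
  have inner: "Lim (at_right 0) (?g \<delta>) = (SUP e\<in>{0<..}. ?g \<delta> e)" for \<delta>
    by (rule Lim_antimono_SUP, rule Limsup_rate_mono, rule anti) auto
  have "rescaled_metric_entropy M X \<mu> = (SUP \<delta>\<in>{0<..}. SUP e\<in>{0<..}. ?g \<delta> e)"
    unfolding rescaled_metric_entropy_def inner
    by (rule Lim_antimono_SUP, rule SUP_subset_mono[OF order_refl], rule Limsup_rate_mono, rule anti) auto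
  also have "\<dots> \<le> rescaled_entropy M X"
  proof (intro SUP_least)
    fix \<delta> e :: real assume \<delta>: "\<delta> \<in> {0<..}" and e: "e \<in> {0<..}"
    have "\<forall>\<^sub>F k in sequentially. 1 - \<delta> < measure \<mu> (E k)" by (rule order_tendstoD[OF lim1]) (use \<delta> in auto)
    then obtain k where k: "1 - \<delta> < measure \<mu> (E k)" by (auto dest: eventually_happens)
    define a where "a = min e (1 / real (Suc k))"
    have a: "0 < a" "a \<le> e" using e by (auto simp: a_def)
    have "E k \<subseteq> {x \<in> pts M. V x \<ge> a}" by (auto simp: E_def a_def)
    then have "measure \<mu> (E k) \<le> measure \<mu> {x \<in> pts M. V x \<ge> a}" by (intro finite_measure_mono Msets)
    then have ma: "1 - \<delta> < measure \<mu> {x \<in> pts M. V x \<ge> a}" using k by linarith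
    have "?g \<delta> e \<le> rescaled_rate M X a"
    proof (rule Limsup_rate_mono)
      fix t :: real
      have "rcover_number M X \<mu> t e \<delta> \<le> rcover_number M X \<mu> t a \<delta>" by (rule anti) (use a in auto)
      also have "\<dots> \<le> rspan_number M X t a"
        unfolding rcover_number_def rspan_number_def
      proof (rule INF_superset_mono)
        show "{F. rescaled_spanning M X t a F} \<subseteq> {F. F \<subseteq> regular_pts M X \<and>
          (\<exists>A\<in>sets \<mu>. A \<subseteq> (\<Union>x\<in>F. rball M X x t a) \<and> measure \<mu> A > 1 - \<delta>)}"
          using Msets ma unfolding rescaled_spanning_def by blast
      qed simp
      finally show "rcover_number M X \<mu> t e \<delta> \<le> rspan_number M X t a" .
    qed
    also have "\<dots> \<le> rescaled_entropy M X" by (rule rescaled_rate_le_entropy[OF a(1)])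
    finally show "?g \<delta> e \<le> rescaled_entropy M X" .
  qed
  finally show ?thesis .
qed

lemma fl_funpow: "x \<in> pts M \<Longrightarrow> (\<phi> 1 ^^ i) x = \<phi> (real i) x"
proof (induction i)
  case (Suc i)
  then show ?case using fl_add[of x "real i" 1] by (simp add: add.commute)
qed (simp add: fl_0)

text \<open>Without singularities the speed is bounded below, so ordinary balls of the time-one map, for a slightly
  larger number of iterates, are contained in rescaled balls.\<close>

lemma nonsingular_entropy_le:
  assumes S: "Sing M X = {}" shows "rescaled_entropy M X \<le> flow_entropy M X"
  unfolding rescaled_entropy_SUP
proof (rule SUP_least)
  fix e :: real assume e: "e \<in> {0<..}"
  have "compact (V ` pts M)"
    using image_compactin[OF compact_pts[unfolded compact_space_def] V_cont] by simp
  then obtain v where v: "v \<in> V ` pts M" "\<And>w. w \<in> V ` pts M \<Longrightarrow> v \<le> w"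
    using compact_attains_inf pts_ne by (metis image_is_empty)
  have v0: "0 < v" using v(1) S V_Sing V_nonneg by (auto simp: order_less_le)
  define \<delta> where "\<delta> = e * v / (2 * K)"
  have \<delta>: "0 < \<delta>" using e v0 K by (simp add: \<delta>_def)
  \<comment> \<open>Iterates with index below \<open>N t\<close> cover all integer times up to \<open>t\<close>.\<close>
  define N where "N t = nat \<lfloor>t\<rfloor> + 1" for t :: real
  have le: "rspan_number M X t e \<le> span_number (pts M) (mdist M) (\<phi> 1) (N t) \<delta>" if t: "0 \<le> t" for t
    unfolding rspan_number_def span_number_def
  proof (rule INF_superset_mono)
    show "{F. F \<subseteq> pts M \<and> (\<forall>y\<in>pts M. \<exists>x\<in>F. \<forall>i<N t. mdist M ((\<phi> 1 ^^ i) x) ((\<phi> 1 ^^ i) y) < \<delta>)}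
      \<subseteq> {F. rescaled_spanning M X t e F}"
    proof (intro subsetI CollectI)
      fix F assume F: "F \<in> {F. F \<subseteq> pts M \<and> (\<forall>y\<in>pts M. \<exists>x\<in>F. \<forall>i<N t. mdist M ((\<phi> 1 ^^ i) x) ((\<phi> 1 ^^ i) y) < \<delta>)}"
      have reg: "F \<subseteq> regular_pts M X" using F S by (auto simp: regular_pts_def)
      have "{x \<in> pts M. V x \<ge> e} \<subseteq> (\<Union>x\<in>F. rball M X x t e)"
      proof
        fix y assume "y \<in> {x \<in> pts M. V x \<ge> e}"
        then have y: "y \<in> pts M" by simp
        then obtain x where x: "x \<in> F" "\<And>i. i < N t \<Longrightarrow> mdist M ((\<phi> 1 ^^ i) x) ((\<phi> 1 ^^ i) y) < \<delta>"
          using F by blast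
        have xp: "x \<in> pts M" using x F by blast
        have "rdist M X t x y \<le> e/2"
        proof (rule rdist_leI[OF _ t])
          show "x \<in> regular_pts M X" using reg x by blast
          fix s assume s: "0 \<le> s" "s \<le> t"
          define i where "i = nat \<lfloor>s\<rfloor>"
          have "real i = of_int \<lfloor>s\<rfloor>" using s by (simp add: i_def)
          then have i2: "\<bar>s - real i\<bar> \<le> 1" by linarith
          have "nat \<lfloor>s\<rfloor> \<le> nat \<lfloor>t\<rfloor>" using s by (intro nat_mono floor_mono)
          then have i: "i < N t" "\<bar>s - real i\<bar> \<le> 1" using i2 by (auto simp: i_def N_def)
          have "mdist M (\<phi> s x) (\<phi> s y) = mdist M (\<phi> (s - real i) (\<phi> (real i) x)) (\<phi> (s - real i) (\<phi> (real i) y))"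
            using fl_add[OF xp, of "real i" "s - real i"] fl_add[OF y, of "real i" "s - real i"] by simp
          also have "\<dots> \<le> K * mdist M (\<phi> (real i) x) (\<phi> (real i) y)"
            by (rule fl_lip) (use fl_pts xp y i in auto)
          also have "\<dots> \<le> K * \<delta>" using x(2)[OF i(1)] fl_funpow xp y K by (intro mult_left_mono) auto
          also have "\<dots> = (e/2) * v" using K by (simp add: \<delta>_def)
          also have "\<dots> \<le> (e/2) * V (\<phi> s x)" using v(2) fl_pts[OF xp] e by (intro mult_left_mono) auto
          finally show "mdist M (\<phi> s x) (\<phi> s y) \<le> (e/2) * V (\<phi> s x)" .
        qed
        then show "y \<in> (\<Union>x\<in>F. rball M X x t e)" using x(1) y e by (auto simp: rball_def intro!: bexI[of _ x])
      qed
      then show "rescaled_spanning M X t e F" using reg by (simp add: rescaled_spanning_def)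
    qed
  qed simp
  let ?sp = "\<lambda>n. span_number (pts M) (mdist M) (\<phi> 1) n \<delta>"
  have one: "1 \<le> ?sp j" for j
    unfolding span_number_def
  proof (rule INF_greatest)
    fix F assume "F \<in> {F. F \<subseteq> pts M \<and> (\<forall>y\<in>pts M. \<exists>x\<in>F. \<forall>i<j. mdist M ((\<phi> 1 ^^ i) x) ((\<phi> 1 ^^ i) y) < \<delta>)}"
    then have "F \<noteq> {}" using pts_ne by auto
    then show "1 \<le> ecard F" by (cases "finite F") (auto simp: ecard_def one_enat_def Suc_le_eq card_gt_0_iff)
  qed
  have "rescaled_rate M X e \<le> span_rate (pts M) (mdist M) (\<phi> 1) \<delta>"
  proof (rule ereal_le_if_real_gt)
    fix h assume h: "span_rate (pts M) (mdist M) (\<phi> 1) \<delta> < ereal h"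
    have ev: "\<forall>\<^sub>F j in sequentially. \<exists>k. ?sp j = enat k \<and> real k \<le> exp (h * real j)"
      by (rule rate_less[OF filterlim_real_sequentially h])
    have h0: "0 \<le> h"
    proof -
      obtain j where j: "0 < j" "\<exists>k. ?sp j = enat k \<and> real k \<le> exp (h * real j)"
        using eventually_happens[OF eventually_conj[OF eventually_gt_at_top[of "0::nat"] ev]] by auto
      then obtain k where "?sp j = enat k" "real k \<le> exp (h * real j)" by blast
      moreover then have "1 \<le> real k" using one[of j] by (simp add: one_enat_def)
      ultimately have "1 \<le> exp (h * real j)" by linarith
      then show ?thesis using j(1) by (simp add: zero_le_mult_iff)
    qed
    have Nlim: "filterlim N sequentially at_top"
      unfolding N_def filterlim_at_top
    proof
      fix Z :: nat
      show "\<forall>\<^sub>F t::real in at_top. Z \<le> nat \<lfloor>t\<rfloor> + 1"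
        using eventually_ge_at_top[of "real Z"] by eventually_elim linarith
    qed
    have "\<forall>\<^sub>F t in at_top. \<exists>k. ?sp (N t) = enat k \<and> real k \<le> exp (h * real (N t))"
      using ev Nlim unfolding filterlim_iff by blast
    then show "rescaled_rate M X e \<le> ereal h"
    proof (intro rate_le[where C = "exp h"])
      assume "\<forall>\<^sub>F t in at_top. \<exists>k. ?sp (N t) = enat k \<and> real k \<le> exp (h * real (N t))"
      then show "\<forall>\<^sub>F t in at_top. \<exists>k. rspan_number M X t e \<le> enat k \<and> real k \<le> exp h * (t + 1) * exp (h * t)"
        using eventually_ge_at_top[of "0::real"]
      proof eventually_elim
        case (elim t)
        then obtain k where k: "?sp (N t) = enat k" "real k \<le> exp (h * real (N t))" by blast
        have "real (N t) \<le> t + 1" using elim by (simp add: N_def)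
        then have "h * real (N t) \<le> h + h * t" using mult_left_mono[OF _ h0] by (fastforce simp: algebra_simps)
        then have "exp (h * real (N t)) \<le> exp h * exp (h * t)" by (simp add: exp_add[symmetric])
        also have "\<dots> \<le> exp h * (t + 1) * exp (h * t)" using elim by (intro mult_right_mono) auto
        finally show ?case using k le[of t] elim by (intro exI[of _ k]) auto
      qed
    qed (auto simp: filterlim_ident)
  qed
  also have "\<dots> \<le> flow_entropy M X"
    unfolding flow_entropy_def top_entropy_SUP by (rule SUP_upper) (use \<delta> in auto)
  finally show "rescaled_rate M X e \<le> flow_entropy M X" .
qed

end

section \<open>Topological entropy, periodic orbits, and conjugacy\<close>

context regular_flow
begin

lemma orbit_shift: assumes x: "x \<in> pts M" shows "range (\<lambda>s. \<phi> s (\<phi> r x)) = range (\<lambda>s. \<phi> s x)"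
proof (intro equalityI subsetI)
  fix w assume "w \<in> range (\<lambda>s. \<phi> s (\<phi> r x))"
  then obtain s where "w = \<phi> s (\<phi> r x)" by blast
  then have "w = \<phi> (r + s) x" using fl_add[OF x, of r s] by simp
  then show "w \<in> range (\<lambda>s. \<phi> s x)" by blast
next
  fix w assume "w \<in> range (\<lambda>s. \<phi> s x)"
  then obtain s where "w = \<phi> s x" by blast
  then have "w = \<phi> (s - r) (\<phi> r x)" using fl_add[OF x, of r "s - r"] by simp
  then show "w \<in> range (\<lambda>s. \<phi> s (\<phi> r x))" by blast
qed

lemma V_bounded: obtains W where "0 < W" "\<And>x. x \<in> pts M \<Longrightarrow> V x \<le> W"
proof -
  have "compact (V ` pts M)"
    using image_compactin[OF compact_pts[unfolded compact_space_def] V_cont] by simp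
  then obtain w where w: "w \<in> V ` pts M" "\<And>v. v \<in> V ` pts M \<Longrightarrow> v \<le> w"
    using compact_attains_sup pts_ne by (metis image_is_empty)
  show thesis by (rule that[of "max w 1"]) (use w in force)+
qed

text \<open>The rate bounds the spanning numbers for large times only; the constant \<open>C\<close> absorbs the finitely many
  remaining integer times, for which the numbers are finite.\<close>

lemma spanning_all_times:
  assumes e: "0 < e" "e \<le> 1" and h: "rescaled_rate M X e < ereal h" "0 \<le> h"
  obtains C where "1 \<le> C" "\<And>m::nat. \<exists>F. rescaled_spanning M X (real m) e F \<and> finite F \<and> real (card F) \<le> C * exp (h * real m)"
proof -
  have "\<forall>\<^sub>F t in at_top. \<exists>k. rspan_number M X t e = enat k \<and> real k \<le> exp (h * t)"
    using rate_less[OF filterlim_ident h(1)] .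
  then obtain t0 where t0: "\<And>t. t0 \<le> t \<Longrightarrow> \<exists>k. rspan_number M X t e = enat k \<and> real k \<le> exp (h * t)"
    unfolding eventually_at_top_linorder by blast
  have "\<exists>F. rescaled_spanning M X (real m) e F \<and> finite F" for m :: nat
  proof -
    obtain k where "rspan_number M X (real m) e \<le> enat k" using rspan_number_bound[OF e, of "real m"] by auto
    then show ?thesis by (rule rspan_attained) blast
  qed
  then obtain G where G: "\<And>m::nat. rescaled_spanning M X (real m) e (G m) \<and> finite (G m)" by metis
  obtain C where C: "0 < C" "\<forall>m\<in>{..nat \<lceil>t0\<rceil>}. real (card (G m)) \<le> C"
    using finite_bound[of "{..nat \<lceil>t0\<rceil>}" "\<lambda>m. real (card (G m))"] by auto
  show thesis
  proof (rule that[of "max 1 C"])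
    fix m :: nat
    have ex: "1 \<le> exp (h * real m)" using h(2) by simp
    show "\<exists>F. rescaled_spanning M X (real m) e F \<and> finite F \<and> real (card F) \<le> max 1 C * exp (h * real m)"
    proof (cases "m \<le> nat \<lceil>t0\<rceil>")
      case True
      then have "real (card (G m)) \<le> max 1 C" using C(2) by (auto simp: le_max_iff_disj)
      also have "\<dots> \<le> max 1 C * exp (h * real m)" using ex mult_left_mono[OF ex, of "max 1 C"] by simp
      finally show ?thesis using G by blast
    next
      case False
      then have "t0 \<le> real m" by linarith
      then obtain k where k: "rspan_number M X (real m) e = enat k" "real k \<le> exp (h * real m)" using t0 by blast
      obtain F where F: "rescaled_spanning M X (real m) e F" "finite F" "card F \<le> k"
        by (rule rspan_attained[OF eq_refl[OF k(1)]]) (rule that, assumption+)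
      have "real (card F) \<le> 1 * exp (h * real m)" using F(3) k(2) by simp
      also have "\<dots> \<le> max 1 C * exp (h * real m)" by (intro mult_right_mono) auto
      finally show ?thesis using F by blast
    qed
  qed simp
qed

text \<open>An orbit piece of length \<open>n\<close> is slow until some time \<open>k\<close>, when it first meets the region where the speed
  is at least \<open>e\<close>. The slow part is determined, up to a fixed error, by its positions at the multiples of a
  large \<open>T\<close>, and the rest by a rescaled spanning set of length \<open>n - k\<close>. Summing over \<open>k\<close> costs only a linear
  factor. This replaces the variational principle.\<close>

lemma entropy_le_rescaled: assumes "nonzero_field M X" shows "flow_entropy M X \<le> rescaled_entropy M X"
  unfolding flow_entropy_def top_entropy_SUP
proof (rule SUP_least, rule ereal_le_if_real_gt)
  fix \<rho> h :: real assume \<rho>: "\<rho> \<in> {0<..}" and h: "rescaled_entropy M X < ereal h"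
  have h0: "0 < h" using rescaled_entropy_real[OF assms] h by auto
  obtain W where W: "0 < W" "\<And>x. x \<in> pts M \<Longrightarrow> V x \<le> W" by (rule V_bounded) (rule that, assumption+)
  define \<eta> where "\<eta> = min 1 (\<rho>/8)"
  have \<eta>: "0 < \<eta>" "\<eta> \<le> 1" "\<eta> \<le> \<rho>/8" using \<rho> by (auto simp: \<eta>_def)
  obtain P where P: "P \<subseteq> pts M" "finite P" "\<And>x. x \<in> pts M \<Longrightarrow> \<exists>y\<in>P. mdist M y x < \<eta>"
    by (rule subset_net[OF order_refl \<eta>(1,2)]) (rule that, assumption+)
  \<comment> \<open>\<open>T\<close> is so large that recording one of \<open>card P\<close> positions every \<open>T\<close> units of time costs a rate of at most
    \<open>h\<close>.\<close>
  obtain T :: nat where "ln (real (card P) + 1) / h < T" using reals_Archimedean2 by blast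
  then have T1: "ln (real (card P) + 1) \<le> h * T" using h0 by (simp add: field_simps)
  have T0: "0 < T"
  proof (rule ccontr)
    assume "\<not> 0 < T"
    moreover have "0 < card P" using P pts_ne by (fastforce simp: card_gt_0_iff)
    ultimately show False using T1 ln_gt_zero[of "real (card P) + 1"] by simp
  qed
  have "real (card P) \<le> exp (ln (real (card P) + 1))" by simp
  also have "\<dots> \<le> exp (h * T)" using T1 by (simp only: exp_le_cancel_iff)
  finally have PT: "real (card P) \<le> exp (h * T)" .
  \<comment> \<open>A slow point moves less than \<open>\<rho>/8\<close> in time \<open>T\<close>, and a rescaled ball of radius \<open>e\<close> has ordinary radius at
    most \<open>\<rho>/2\<close>.\<close>
  define e where "e = min 1 (min (\<rho> / (8 * A * T)) (\<rho> / (2 * W)))"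
  have e: "0 < e" "e \<le> 1" using \<rho> A T0 W by (auto simp: e_def)
  have "e \<le> \<rho> / (8 * A * T)" by (simp add: e_def)
  then have e1: "T * (A * e) \<le> \<rho>/8" using A T0 by (simp add: field_simps)
  have "e \<le> \<rho> / (2 * W)" by (simp add: e_def)
  then have e2: "e * W \<le> \<rho>/2" using W by (simp add: field_simps)
  have he: "rescaled_rate M X e < ereal h" using rescaled_rate_le_entropy[OF e(1)] h by (rule le_less_trans)
  obtain C where C: "1 \<le> C" "\<And>m::nat. \<exists>F. rescaled_spanning M X (real m) e F \<and> finite F \<and> real (card F) \<le> C * exp (h * real m)"
    by (rule spanning_all_times[OF e he less_imp_le[OF h0]]) (rule that, assumption+)
  then obtain F where F: "\<And>m::nat. rescaled_spanning M X (real m) e (F m)" "\<And>m. finite (F m)"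
    "\<And>m. real (card (F m)) \<le> C * exp (h * real m)" by metis
  obtain net where net: "\<And>x. x \<in> pts M \<Longrightarrow> net x \<in> P \<and> mdist M (net x) x < \<eta>" using P(3) by metis
  have "\<forall>m x. \<exists>z. x \<in> pts M \<and> e \<le> V x \<longrightarrow> z \<in> F m \<and> x \<in> rball M X z (real m) e"
    using F(1) unfolding rescaled_spanning_def by blast
  then obtain ctr where ctr: "\<And>m x. x \<in> pts M \<Longrightarrow> e \<le> V x \<Longrightarrow> ctr m x \<in> F m \<and> x \<in> rball M X (ctr m x) (real m) e"
    by metis
  have bound: "\<exists>c. span_number (pts M) (mdist M) (\<phi> 1) n \<rho> \<le> enat c \<and>
      real c \<le> (exp (h * T) * (2 * C)) * (real n + 1) * exp (h * n)" for n :: nat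
  proof -
    define k where "k x = (LEAST k. k = n \<or> e \<le> V (\<phi> (real k) x))" for x
    have k: "k x = n \<or> e \<le> V (\<phi> (real (k x)) x)" for x unfolding k_def by (rule LeastI[of _ n]) simp
    have slow: "V (\<phi> (real i) x) < e" if "i < k x" for i x
      using not_less_Least[OF that[unfolded k_def]] by auto
    have kn: "k x \<le> n" for x unfolding k_def by (rule Least_le) simp
    define code where "code x = (k x, map (\<lambda>j. net (\<phi> (real (T * j)) x)) [0..<k x div T + 1],
        if e \<le> V (\<phi> (real (k x)) x) then Some (ctr (n - k x) (\<phi> (real (k x)) x)) else None)" for x
    let ?K = "SIGMA k:{..n}. {xs. set xs \<subseteq> P \<and> length xs = k div T + 1} \<times> insert None (Some ` F (n - k))"
    have finK: "finite ?K"
      by (intro finite_SigmaI finite_cartesian_product finite_lists_length_eq P(2)) (auto simp: F(2))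
    have sub: "code ` pts M \<subseteq> ?K"
    proof
      fix q assume "q \<in> code ` pts M"
      then obtain x where x: "x \<in> pts M" "q = code x" by blast
      have "set (map (\<lambda>j. net (\<phi> (real (T * j)) x)) [0..<k x div T + 1]) \<subseteq> P" using net fl_pts x by auto
      moreover have "ctr (n - k x) (\<phi> (real (k x)) x) \<in> F (n - k x)" if "e \<le> V (\<phi> (real (k x)) x)"
        using ctr[OF fl_pts[OF x(1)] that] by blast
      ultimately show "q \<in> ?K" using kn[of x] unfolding x(2) code_def by auto
    qed
    have step: "mdist M (\<phi> (real (T * j)) x) (\<phi> (real (T * j + r)) x) \<le> r * (A * e)"
      if x: "x \<in> pts M" and r: "T * j + r \<le> k x" for x j r
      using r
    proof (induction r)
      case 0
      then show ?case using d_self fl_pts x by simp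
    next
      case (Suc r)
      let ?y = "\<phi> (real (T * j + r)) x"
      have y: "?y \<in> pts M" by (rule fl_pts[OF x])
      have eq: "\<phi> (real (T * j + Suc r)) x = \<phi> 1 ?y" using fl_add[OF x, of "real (T * j + r)" 1] by (simp add: algebra_simps)
      have "mdist M ?y (\<phi> 1 ?y) \<le> A * \<bar>1\<bar> * V ?y" by (rule fl_disp[OF y]) simp
      also have "\<dots> \<le> A * e" using slow[of "T * j + r" x] Suc.prems A by simp
      finally have "mdist M (\<phi> (real (T * j)) x) (\<phi> 1 ?y) \<le> r * (A * e) + A * e"
        using d_tri[OF fl_pts[OF x] y fl_pts[OF y], of "real (T * j)" 1] Suc by linarith
      then show ?case unfolding eq by (simp add: algebra_simps)
    qed
    have near: "mdist M (net (\<phi> (real (T * (i div T))) x)) (\<phi> (real i) x) < \<rho>/4"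
      if x: "x \<in> pts M" and i: "i < k x" for x i
    proof -
      let ?y = "\<phi> (real (T * (i div T))) x"
      have y: "?y \<in> pts M" "net ?y \<in> pts M" using fl_pts[OF x] net P(1) by blast+
      have "mdist M ?y (\<phi> (real (T * (i div T) + i mod T)) x) \<le> (i mod T) * (A * e)"
        by (rule step[OF x]) (use i in simp)
      also have "\<dots> \<le> T * (A * e)" using T0 A e by (intro mult_right_mono) (auto intro: less_imp_le)
      finally have "mdist M ?y (\<phi> (real i) x) \<le> \<rho>/8" using e1 by simp
      moreover have "mdist M (net ?y) ?y < \<rho>/8" using net[OF y(1)] \<eta>(3) by linarith
      ultimately show ?thesis using d_tri[OF y(2,1) fl_pts[OF x], of "real i"] by linarith
    qed
    have close: "mdist M ((\<phi> 1 ^^ i) x) ((\<phi> 1 ^^ i) y) < \<rho>"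
      if x: "x \<in> pts M" and y: "y \<in> pts M" and c: "code x = code y" and i: "i < n" for x y i
    proof -
      have kk: "k x = k y" using c by (simp add: code_def)
      have xi: "\<phi> (real i) x \<in> pts M" "\<phi> (real i) y \<in> pts M" using fl_pts x y by auto
      have "mdist M (\<phi> (real i) x) (\<phi> (real i) y) < \<rho>"
      proof (cases "i < k x")
        case True
        let ?j = "i div T"
        have j: "?j < k x div T + 1" using True by (simp add: div_le_mono less_Suc_eq_le)
        have "map (\<lambda>j. net (\<phi> (real (T * j)) x)) [0..<k x div T + 1] ! ?j =
              map (\<lambda>j. net (\<phi> (real (T * j)) y)) [0..<k y div T + 1] ! ?j"
        proof -
          have "fst (snd (code x)) ! ?j = fst (snd (code y)) ! ?j" using c by simp
          then show ?thesis by (simp only: code_def fst_conv snd_conv)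
        qed
        then have ne: "net (\<phi> (real (T * ?j)) x) = net (\<phi> (real (T * ?j)) y)"
          using j kk by (simp del: upt_Suc)
        have np: "net (\<phi> (real (T * ?j)) x) \<in> pts M" using net fl_pts[OF x] P(1) by blast
        show ?thesis
          using near[OF x True] near[OF y, of i] True kk ne d_tri[OF xi(1) np xi(2)] d_sym[OF xi(1) np] \<rho> by auto
      next
        case False
        then have kn': "k x < n" "k x \<le> i" using i by auto
        then have ex: "e \<le> V (\<phi> (real (k x)) x)" "e \<le> V (\<phi> (real (k x)) y)" using k[of x] k[of y] kk by auto
        let ?m = "n - k x"
        let ?x = "\<phi> (real (k x)) x" and ?y = "\<phi> (real (k x)) y"
        let ?z = "ctr ?m ?x"
        have z: "?z \<in> F ?m" "?x \<in> rball M X ?z (real ?m) e" using ctr[OF fl_pts[OF x] ex(1)] by auto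
        have "?z = ctr ?m ?y" using c kk ex by (simp add: code_def)
        then have zy: "?y \<in> rball M X ?z (real ?m) e" using ctr[OF fl_pts[OF y] ex(2), of ?m] by auto
        have zr: "?z \<in> regular_pts M X" using F(1)[of ?m] z(1) by (auto simp: rescaled_spanning_def)
        then have zp: "?z \<in> pts M" by (simp add: regular_iff)
        let ?s = "real (i - k x)"
        have s: "0 \<le> ?s" "?s \<le> real ?m" using i by auto
        have fs: "\<phi> ?s ?x = \<phi> (real i) x" "\<phi> ?s ?y = \<phi> (real i) y"
          using fl_add[OF x, of "real (k x)" ?s] fl_add[OF y, of "real (k x)" ?s] kn' by (auto simp: of_nat_diff)
        have "mdist M (\<phi> ?s ?z) (\<phi> ?s w) < \<rho>/2" if w: "w \<in> rball M X ?z (real ?m) e" for w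
        proof -
          have "mdist M (\<phi> ?s ?z) (\<phi> ?s w) < e * V (\<phi> ?s ?z)"
            by (rule rdist_lessD[OF zr _ s]) (use w in \<open>auto simp: rball_def\<close>)
          also have "\<dots> \<le> e * W" using W(2)[OF fl_pts[OF zp]] e by (intro mult_left_mono) auto
          finally show ?thesis using e2 by linarith
        qed
        from this[OF z(2)] this[OF zy] have "mdist M (\<phi> ?s ?z) (\<phi> (real i) x) < \<rho>/2" "mdist M (\<phi> ?s ?z) (\<phi> (real i) y) < \<rho>/2"
          by (simp_all only: fs)
        then show ?thesis
          using d_tri[OF xi(1) fl_pts[OF zp] xi(2), of ?s] d_sym[OF xi(1) fl_pts[OF zp], of ?s] by linarith
      qed
      then show ?thesis using fl_funpow x y by simp
    qed
    have span: "span_number (pts M) (mdist M) (\<phi> 1) n \<rho> \<le> enat (card ?K)"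
      by (rule span_number_code[OF finK sub]) (rule close)
    have "card ?K = (\<Sum>k\<le>n. card ({xs. set xs \<subseteq> P \<and> length xs = k div T + 1} \<times> insert None (Some ` F (n - k))))"
      by (rule card_SigmaI) (auto intro!: finite_cartesian_product finite_lists_length_eq P(2) F(2))
    then have "real (card ?K) = (\<Sum>k\<le>n. real (card ({xs. set xs \<subseteq> P \<and> length xs = k div T + 1} \<times> insert None (Some ` F (n - k)))))"
      by simp
    also have "\<dots> \<le> (\<Sum>k\<le>n. (exp (h * T) * (2 * C)) * exp (h * n))"
    proof (rule sum_mono)
      fix k assume k: "k \<in> {..n}"
      have "card {xs. set xs \<subseteq> P \<and> length xs = k div T + 1} = card P ^ (k div T + 1)"
        by (rule card_lists_length_eq[OF P(2)])
      then have "real (card {xs. set xs \<subseteq> P \<and> length xs = k div T + 1}) = real (card P) ^ (k div T + 1)" by simp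
      also have "\<dots> \<le> exp (h * T) ^ (k div T + 1)" by (rule power_mono[OF PT]) simp
      also have "\<dots> = exp (h * T) * exp (h * real (T * (k div T)))"
        by (simp add: exp_of_nat_mult[symmetric] mult.commute mult.left_commute)
      also have "\<dots> \<le> exp (h * T) * exp (h * real k)"
      proof -
        have "T * (k div T) \<le> k" by simp
        then have "real (T * (k div T)) \<le> real k" by (rule of_nat_mono)
        then have "h * real (T * (k div T)) \<le> h * real k" using h0 by (intro mult_left_mono) auto
        then show ?thesis by simp
      qed
      finally have c1: "real (card {xs. set xs \<subseteq> P \<and> length xs = k div T + 1}) \<le> exp (h * T) * exp (h * real k)" .
      have "card (insert None (Some ` F (n - k))) \<le> card (F (n - k)) + 1"
        using card_image_le[OF F(2)[of "n - k"], of Some] by (simp add: card_insert_if F(2))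
      then have "real (card (insert None (Some ` F (n - k)))) \<le> real (card (F (n - k))) + 1" by linarith
      also have "\<dots> \<le> C * exp (h * real (n - k)) + C * exp (h * real (n - k))"
      proof (rule add_mono[OF F(3)])
        have "1 * 1 \<le> C * exp (h * real (n - k))" using C(1) h0 by (intro mult_mono) auto
        then show "1 \<le> C * exp (h * real (n - k))" by simp
      qed
      finally have c2: "real (card (insert None (Some ` F (n - k)))) \<le> 2 * C * exp (h * real (n - k))" by simp
      have "real (card ({xs. set xs \<subseteq> P \<and> length xs = k div T + 1} \<times> insert None (Some ` F (n - k)))) \<le>
        (exp (h * T) * exp (h * real k)) * (2 * C * exp (h * real (n - k)))"
        unfolding card_cartesian_product of_nat_mult by (rule mult_mono[OF c1 c2]) auto
      also have "\<dots> = (exp (h * T) * (2 * C)) * (exp (h * real k) * exp (h * real (n - k)))" by (simp only: mult_ac)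
      also have "exp (h * real k) * exp (h * real (n - k)) = exp (h * n)"
        using k by (simp add: exp_add[symmetric] distrib_left[symmetric] of_nat_diff)
      finally show "real (card ({xs. set xs \<subseteq> P \<and> length xs = k div T + 1} \<times> insert None (Some ` F (n - k)))) \<le>
        (exp (h * T) * (2 * C)) * exp (h * n)" .
    qed
    also have "\<dots> = (exp (h * T) * (2 * C)) * (real n + 1) * exp (h * n)" by simp
    finally show ?thesis using span by blast
  qed
  show "span_rate (pts M) (mdist M) (\<phi> 1) \<rho> \<le> ereal h"
  proof (rule rate_le[OF sequentially_bot filterlim_real_sequentially])
    show "0 < exp (h * T) * (2 * C)" using C by (intro mult_pos_pos) auto
  qed (use bound in simp)
qed

text \<open>Periodic orbits cannot lie in the isolating neighbourhood of the singularities, so each has a point where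
  the speed is bounded below. If two of them share a rescaled ball and their periods are almost equal,
  expansivity identifies them.\<close>

lemma periodic_orbit_growth:
  assumes exp: "rescaling_expansive M X" and iso: "dynamically_isolated_Sing M X"
  shows "Limsup at_top (\<lambda>t::real. elog (ecard (periodic_orbits_upto M X t)) / ereal t) \<le> rescaled_entropy M X"
proof -
  obtain \<delta> where \<delta>: "0 < \<delta>" "\<And>x y h. x \<in> pts M \<Longrightarrow> y \<in> pts M \<Longrightarrow> strict_mono h \<Longrightarrow> (\<exists>k. homeomorphism UNIV UNIV h k) \<Longrightarrow>
      (\<And>s. mdist M (\<phi> s x) (\<phi> (h s) y) \<le> \<delta> * V (\<phi> s x)) \<Longrightarrow> \<exists>s\<in>{-1..1}. \<phi> (h 0) y = \<phi> s x"
    using exp unfolding rescaling_expansive_def by (metis zero_less_one)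
  obtain U O' where U: "openin (mtop M) O'" "Sing M X \<subseteq> O'" "O' \<subseteq> U" "U \<subseteq> pts M" "(\<Inter>t. \<phi> t ` U) = Sing M X"
    using iso unfolding dynamically_isolated_Sing_def by blast
  obtain v where v: "0 < v" "\<And>x. x \<in> pts M - O' \<Longrightarrow> v \<le> V x"
  proof (cases "pts M - O' = {}")
    case False
    have "compactin (mtop M) (pts M - O')"
      by (rule closedin_compact_space[OF compact_pts]) (use U(1) in auto)
    then have "compact (V ` (pts M - O'))" using image_compactin[OF _ V_cont] by simp
    then obtain w where w: "w \<in> V ` (pts M - O')" "\<And>u. u \<in> V ` (pts M - O') \<Longrightarrow> w \<le> u"
      using compact_attains_inf False by (metis image_is_empty)
    then obtain x where x: "x \<in> pts M" "x \<notin> O'" "w = V x" by blast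
    then have "0 < w" using U(2) V_Sing[OF x(1)] V_nonneg[OF x(1)] by (auto simp: order_less_le)
    then show thesis using that w by blast
  qed (rule that[of 1], auto)
  \<comment> \<open>Inside one ball speeds agree up to the factor \<open>2 * A\<close>, so two of its points stay within \<open>4 * A * e\<close> times
    the speed of each other; \<open>e\<close> and \<open>\<eta>\<close> make this and the time shift cost at most \<open>\<delta>/2\<close> each.\<close>
  define e where "e = min (min 1 v) (min (1/(2*A)) (\<delta>/(8*A)))"
  define \<eta> where "\<eta> = min 1 (\<delta>/(6*A*A))"
  have e: "0 < e" "e \<le> v" "e \<le> 1/(2*A)" "e \<le> \<delta>/(8*A)" "e \<le> 1" using v \<delta> A by (auto simp: e_def)
  have \<eta>: "0 < \<eta>" "\<eta> \<le> 1" "\<eta> \<le> \<delta>/(6*A*A)" using \<delta> A by (auto simp: \<eta>_def)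
  have Ae: "A * e \<le> 1/2" "4 * (A * e) \<le> \<delta>/2" using e A by (simp_all add: field_simps)
  have A\<eta>: "3 * A * A * \<eta> \<le> \<delta>/2" using \<eta> A by (simp add: field_simps)
  have per: "\<phi> (of_int q * \<tau>) x = x" if x: "x \<in> pts M" and p: "\<phi> \<tau> x = x" for q :: int and \<tau> x
  proof -
    have nat: "\<phi> (real j * \<tau>) x = x" for j
    proof (induction j)
      case (Suc j)
      then show ?case using fl_add[OF x, of "real j * \<tau>" \<tau>] p by (simp add: algebra_simps)
    qed (simp add: fl_0[OF x])
    have neg: "\<phi> (- (real j * \<tau>)) x = x" for j
      using fl_add[OF x, of "real j * \<tau>" "- (real j * \<tau>)"] nat[of j] fl_0[OF x] by simp
    show ?thesis using nat[of "nat q"] neg[of "nat (-q)"] by (cases "q \<ge> 0") auto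
  qed
  \<comment> \<open>The linear map \<open>h\<close> that takes one period to the other stays within \<open>\<eta>\<close> of the identity over one period, so
    closeness on \<open>{0..\<tau>}\<close> survives the reparametrization; periodicity extends it to all times, where
    expansivity applies.\<close>
  have same: "range (\<lambda>s. \<phi> s x) = range (\<lambda>s. \<phi> s y)"
    if z: "z \<in> regular_pts M X" and xy: "x \<in> rball M X z t e" "y \<in> rball M X z t e"
      and \<tau>: "0 < \<tau>" "\<tau> \<le> t" "\<phi> \<tau> x = x" and \<tau>': "0 < \<tau>'" "\<tau>' \<le> t" "\<phi> \<tau>' y = y" and c: "\<bar>\<tau> - \<tau>'\<bar> < \<eta>"
    for x y z t \<tau> \<tau>'
  proof -
    have x: "x \<in> pts M" and y: "y \<in> pts M" using xy by (auto simp: rball_def)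
    have zp: "z \<in> pts M" using z regular_iff by auto
    define h where "h s = s * (\<tau>'/\<tau>)" for s
    have base: "mdist M (\<phi> s x) (\<phi> (h s) y) \<le> \<delta> * V (\<phi> s x)" if s: "0 \<le> s" "s \<le> \<tau>" for s
    proof -
      let ?x = "\<phi> s x" and ?y = "\<phi> s y" and ?z = "\<phi> s z"
      have p: "?x \<in> pts M" "?y \<in> pts M" "?z \<in> pts M" "\<phi> (h s) y \<in> pts M" using fl_pts x y zp by auto
      have st: "0 \<le> s" "s \<le> t" using s \<tau> by auto
      have zx: "mdist M ?z ?x < e * V ?z" by (rule rdist_lessD[OF z x st]) (use xy in \<open>auto simp: rball_def\<close>)
      have zy: "mdist M ?z ?y < e * V ?z" by (rule rdist_lessD[OF z y st]) (use xy in \<open>auto simp: rball_def\<close>)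
      have Vp: "0 \<le> V ?x" "0 \<le> V ?z" using V_nonneg p by auto
      have "V ?z \<le> A * (V ?x + mdist M ?x ?z)" by (rule V_lip[OF p(1,3)])
      also have "\<dots> \<le> A * (V ?x + e * V ?z)" using zx d_sym[OF p(1,3)] A by (intro mult_left_mono) auto
      also have "\<dots> = A * V ?x + (A * e) * V ?z" by (simp add: algebra_simps)
      also have "\<dots> \<le> A * V ?x + 1/2 * V ?z" by (intro add_left_mono mult_right_mono Ae Vp)
      finally have Vz: "V ?z \<le> 2 * A * V ?x" by simp
      have "mdist M ?x ?y \<le> mdist M ?x ?z + mdist M ?z ?y" by (rule d_tri[OF p(1,3,2)])
      also have "\<dots> \<le> 2 * e * V ?z" using zx zy d_sym[OF p(1,3)] by simp
      also have "\<dots> \<le> 2 * e * (2 * A * V ?x)" using Vz e by (intro mult_left_mono) auto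
      finally have d1: "mdist M ?x ?y \<le> 4 * (A * e) * V ?x" by (simp add: algebra_simps)
      have "V ?y \<le> A * (V ?x + mdist M ?x ?y)" by (rule V_lip[OF p(1,2)])
      also have "\<dots> \<le> A * (V ?x + 4 * (A * e) * V ?x)" using d1 A by (intro mult_left_mono) auto
      also have "\<dots> \<le> A * (V ?x + 2 * V ?x)"
      proof -
        have "4 * (A * e) * V ?x \<le> 2 * V ?x" by (rule mult_right_mono) (use Ae Vp in auto)
        then show ?thesis using A by (intro mult_left_mono) auto
      qed
      finally have Vy: "V ?y \<le> 3 * A * V ?x" by simp
      have "h s - s = (s/\<tau>) * (\<tau>' - \<tau>)" using \<tau> by (simp add: h_def field_simps)
      then have "\<bar>h s - s\<bar> = (s/\<tau>) * \<bar>\<tau>' - \<tau>\<bar>" using s \<tau> by (simp add: abs_mult)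
      also have "\<dots> \<le> 1 * \<bar>\<tau>' - \<tau>\<bar>" using s \<tau> by (intro mult_right_mono) auto
      finally have hs: "\<bar>h s - s\<bar> \<le> \<eta>" using c by simp
      have "mdist M ?y (\<phi> (h s - s) ?y) \<le> A * \<bar>h s - s\<bar> * V ?y" by (rule fl_disp[OF p(2)]) (use hs \<eta> in auto)
      also have "\<dots> \<le> A * \<eta> * (3 * A * V ?x)" using hs Vy A V_nonneg[OF p(2)] \<eta> by (intro mult_mono) auto
      also have "\<phi> (h s - s) ?y = \<phi> (h s) y" using fl_add[OF y, of s "h s - s"] by simp
      finally have d2: "mdist M ?y (\<phi> (h s) y) \<le> (3 * A * A * \<eta>) * V ?x" by (simp add: algebra_simps)
      have "mdist M ?x (\<phi> (h s) y) \<le> 4 * (A * e) * V ?x + (3 * A * A * \<eta>) * V ?x"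
        using d_tri[OF p(1,2,4)] d1 d2 by linarith
      also have "\<dots> \<le> \<delta>/2 * V ?x + \<delta>/2 * V ?x" by (intro add_mono mult_right_mono Ae A\<eta> Vp)
      finally show ?thesis by simp
    qed
    have all: "mdist M (\<phi> s x) (\<phi> (h s) y) \<le> \<delta> * V (\<phi> s x)" for s
    proof -
      define q where "q = \<lfloor>s/\<tau>\<rfloor>"
      define s0 where "s0 = s - of_int q * \<tau>"
      have "of_int q \<le> s/\<tau>" "s/\<tau> < of_int q + 1" unfolding q_def by linarith+
      then have s0: "0 \<le> s0" "s0 \<le> \<tau>" using \<tau> by (auto simp: s0_def field_simps)
      have "\<phi> s x = \<phi> s0 x" using fl_add[OF x, of "of_int q * \<tau>" s0] per[OF x \<tau>(3)] by (simp add: s0_def)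
      moreover have "h s = of_int q * \<tau>' + h s0" using \<tau> by (simp add: h_def s0_def field_simps)
      then have "\<phi> (h s) y = \<phi> (h s0) y" using fl_add[OF y, of "of_int q * \<tau>'" "h s0"] per[OF y \<tau>'(3)] by simp
      ultimately show ?thesis using base[OF s0] by simp
    qed
    have hp: "0 < \<tau>'/\<tau>" using \<tau> \<tau>' by simp
    have "strict_mono h" using mult_strict_right_mono[OF _ hp] by (auto simp only: strict_mono_def h_def)
    moreover have "homeomorphism UNIV UNIV h (\<lambda>s. s / (\<tau>'/\<tau>))"
      unfolding homeomorphism_def
    proof (intro conjI ballI)
      show "h s / (\<tau>'/\<tau>) = s" "h (s / (\<tau>'/\<tau>)) = s" for s using \<tau> \<tau>' by (auto simp: h_def)
      have "s = h (s / (\<tau>'/\<tau>))" "s = h s / (\<tau>'/\<tau>)" for s using \<tau> \<tau>' by (simp_all add: h_def)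
      then have "s \<in> range h" "s \<in> range (\<lambda>s. s / (\<tau>'/\<tau>))" for s by (blast intro: range_eqI)+
      then show "range h = UNIV" "range (\<lambda>s. s / (\<tau>'/\<tau>)) = UNIV" by auto
      show "continuous_on UNIV h" "continuous_on UNIV (\<lambda>s. s / (\<tau>'/\<tau>))"
        using \<tau> \<tau>' by (auto simp: h_def[abs_def] intro!: continuous_intros)
    qed
    ultimately obtain r where "\<phi> (h 0) y = \<phi> r x" using \<delta>(2)[OF x y _ _ all] by blast
    then have yr: "y = \<phi> r x" by (simp add: h_def fl_0[OF y])
    show ?thesis unfolding yr by (rule orbit_shift[OF x, symmetric])
  qed
  have pick: "\<exists>x \<tau>. x \<in> pts M \<and> e \<le> V x \<and> 0 < \<tau> \<and> \<tau> \<le> t \<and> \<phi> \<tau> x = x \<and> Q = range (\<lambda>s. \<phi> s x)"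
    if Q: "Q \<in> periodic_orbits_upto M X t" for Q t
  proof -
    obtain x \<tau> where x: "x \<in> pts M" "Q = range (\<lambda>s. \<phi> s x)" "\<tau> \<le> t" "has_period M X x \<tau>"
      using Q by (auto simp: periodic_orbits_upto_def)
    then have \<tau>: "0 < \<tau>" "\<phi> \<tau> x = x" "\<And>s. 0 < s \<Longrightarrow> s < \<tau> \<Longrightarrow> \<phi> s x \<noteq> x" by (auto simp: has_period_def)
    have "\<exists>s. \<phi> s x \<notin> U"
    proof (rule ccontr)
      assume a: "\<not> (\<exists>s. \<phi> s x \<notin> U)"
      have "x \<in> \<phi> t ` U" for t
        using a fl_add[OF x(1), of "-t" t] fl_0[OF x(1)] by (intro image_eqI[of _ _ "\<phi> (-t) x"]) auto
      then have "x \<in> Sing M X" using U(5) by blast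
      then have "\<phi> (\<tau>/2) x = x" using V_Sing singular_iff_fixed x(1) by blast
      then show False using \<tau>(1) \<tau>(3)[of "\<tau>/2"] by simp
    qed
    then obtain s where s: "\<phi> s x \<notin> U" by blast
    let ?y = "\<phi> s x"
    have y: "?y \<in> pts M" by (rule fl_pts[OF x(1)])
    have "?y \<in> pts M - O'" using s y U(3) by blast
    from v(2)[OF this] have "e \<le> V ?y" using e(2) by linarith
    moreover have "\<phi> \<tau> ?y = ?y" using fl_add[OF x(1), of s \<tau>] fl_add[OF x(1), of \<tau> s] \<tau>(2) by (simp add: add.commute)
    moreover have "Q = range (\<lambda>r. \<phi> r ?y)"
      unfolding x(2) by (rule orbit_shift[OF x(1), symmetric])
    ultimately show ?thesis using y \<tau>(1) x(3) by blast
  qed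
  have count: "\<exists>k. ecard (periodic_orbits_upto M X t) \<le> enat k \<and> real k \<le> real m * (t/\<eta> + 1)"
    if t: "0 \<le> t" and m: "rspan_number M X t e \<le> enat m" for t m
  proof -
    obtain F where F: "rescaled_spanning M X t e F" "finite F" "card F \<le> m"
      by (rule rspan_attained[OF m]) (rule that, assumption+)
    have "\<forall>Q. \<exists>x \<tau> z. Q \<in> periodic_orbits_upto M X t \<longrightarrow>
      0 < \<tau> \<and> \<tau> \<le> t \<and> \<phi> \<tau> x = x \<and> Q = range (\<lambda>s. \<phi> s x) \<and> z \<in> F \<and> x \<in> rball M X z t e"
    proof
      fix Q
      show "\<exists>x \<tau> z. Q \<in> periodic_orbits_upto M X t \<longrightarrow>
        0 < \<tau> \<and> \<tau> \<le> t \<and> \<phi> \<tau> x = x \<and> Q = range (\<lambda>s. \<phi> s x) \<and> z \<in> F \<and> x \<in> rball M X z t e"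
      proof (cases "Q \<in> periodic_orbits_upto M X t")
        case True
        from pick[OF this] obtain x \<tau> where x: "x \<in> pts M" "e \<le> V x" "0 < \<tau>" "\<tau> \<le> t" "\<phi> \<tau> x = x" "Q = range (\<lambda>s. \<phi> s x)"
          by blast
        then have "x \<in> (\<Union>z\<in>F. rball M X z t e)" using F(1) unfolding rescaled_spanning_def by blast
        then show ?thesis using x by blast
      qed blast
    qed
    then obtain px p\<tau> pz where p: "\<And>Q. Q \<in> periodic_orbits_upto M X t \<Longrightarrow>
      0 < p\<tau> Q \<and> p\<tau> Q \<le> t \<and> \<phi> (p\<tau> Q) (px Q) = px Q \<and> Q = range (\<lambda>s. \<phi> s (px Q)) \<and> pz Q \<in> F \<and> px Q \<in> rball M X (pz Q) t e"
      by metis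
    \<comment> \<open>An orbit is determined by the ball that contains a chosen point of it and by the window of length \<open>\<eta>\<close>
      that contains its period.\<close>
    define code where "code Q = (pz Q, nat \<lfloor>p\<tau> Q / \<eta>\<rfloor>)" for Q
    let ?K = "F \<times> {..nat \<lfloor>t/\<eta>\<rfloor>}"
    have inj: "inj_on code (periodic_orbits_upto M X t)"
    proof (rule inj_onI)
      fix Q Q' assume Q: "Q \<in> periodic_orbits_upto M X t" "Q' \<in> periodic_orbits_upto M X t" "code Q = code Q'"
      note q = p[OF Q(1)] and q' = p[OF Q(2)]
      have "0 \<le> p\<tau> Q / \<eta>" "0 \<le> p\<tau> Q' / \<eta>" using q q' \<eta> by auto
      then have "\<lfloor>p\<tau> Q / \<eta>\<rfloor> = \<lfloor>p\<tau> Q' / \<eta>\<rfloor>" using Q(3) by (auto simp: code_def eq_nat_nat_iff)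
      then have "\<bar>p\<tau> Q / \<eta> - p\<tau> Q' / \<eta>\<bar> < 1" by linarith
      then have "\<bar>(p\<tau> Q - p\<tau> Q') / \<eta>\<bar> < 1" by (simp add: diff_divide_distrib)
      then have c: "\<bar>p\<tau> Q - p\<tau> Q'\<bar> < \<eta>" using \<eta> by (simp add: abs_divide)
      have z: "pz Q \<in> regular_pts M X" using F(1) q by (auto simp: rescaled_spanning_def)
      have "px Q' \<in> rball M X (pz Q) t e" using q' Q(3) by (simp add: code_def)
      then show "Q = Q'" using same[OF z _ _ _ _ _ _ _ _ c] q q' by blast
    qed
    have sub: "code ` periodic_orbits_upto M X t \<subseteq> ?K"
    proof
      fix w assume "w \<in> code ` periodic_orbits_upto M X t"
      then obtain Q where Q: "Q \<in> periodic_orbits_upto M X t" "w = code Q" by blast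
      have "p\<tau> Q / \<eta> \<le> t / \<eta>" using p[OF Q(1)] \<eta> by (simp add: divide_right_mono)
      then have "nat \<lfloor>p\<tau> Q / \<eta>\<rfloor> \<le> nat \<lfloor>t/\<eta>\<rfloor>" by (intro nat_mono floor_mono)
      then show "w \<in> ?K" using p[OF Q(1)] Q(2) by (auto simp: code_def)
    qed
    have fin: "finite ?K" using F(2) by simp
    have "finite (periodic_orbits_upto M X t)" using inj_on_finite[OF inj sub fin] .
    moreover have "card (periodic_orbits_upto M X t) \<le> card ?K" by (rule card_inj_on_le[OF inj sub fin])
    moreover have "real (card ?K) \<le> real m * (t/\<eta> + 1)"
    proof -
      have "real (card ?K) = real (card F) * (real (nat \<lfloor>t/\<eta>\<rfloor>) + 1)" by (simp add: card_cartesian_product distrib_left)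
      also have "\<dots> \<le> real m * (t/\<eta> + 1)"
        using F(3) t \<eta> by (intro mult_mono) auto
      finally show ?thesis .
    qed
    ultimately show ?thesis by (intro exI[of _ "card ?K"]) (auto simp: ecard_def)
  qed
  have "Limsup at_top (\<lambda>t::real. elog (ecard (periodic_orbits_upto M X t)) / ereal t) \<le> rescaled_rate M X e"
  proof (rule ereal_le_if_real_gt)
    fix h assume h: "rescaled_rate M X e < ereal h"
    show "Limsup at_top (\<lambda>t::real. elog (ecard (periodic_orbits_upto M X t)) / ereal t) \<le> ereal h"
    proof (rule rate_le[where C = "1/\<eta>"])
      show "\<forall>\<^sub>F t in at_top. \<exists>k. ecard (periodic_orbits_upto M X t) \<le> enat k \<and> real k \<le> (1/\<eta>) * (t + 1) * exp (h * t)"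
        using rate_less[OF filterlim_ident h] eventually_ge_at_top[of "0::real"]
      proof eventually_elim
        case (elim t)
        then obtain m where m: "rspan_number M X t e = enat m" "real m \<le> exp (h * t)" by blast
        obtain k where k: "ecard (periodic_orbits_upto M X t) \<le> enat k" "real k \<le> real m * (t/\<eta> + 1)"
          using count[OF elim(2)] m by auto
        have "1 \<le> 1/\<eta>" using \<eta> by simp
        then have "t/\<eta> + 1 \<le> (1/\<eta>) * (t + 1)" by (simp add: algebra_simps add_divide_distrib)
        then have "real m * (t/\<eta> + 1) \<le> exp (h * t) * ((1/\<eta>) * (t + 1))"
          using m(2) elim(2) \<eta> by (intro mult_mono) auto
        then show ?case using k by (intro exI[of _ k]) (simp add: mult.commute)
      qed
    qed (use \<eta> in \<open>auto simp: filterlim_ident\<close>)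
  qed
  also have "\<dots> \<le> rescaled_entropy M X" by (rule rescaled_rate_le_entropy[OF e(1)])
  finally show ?thesis .
qed

end

text \<open>One half of conjugacy invariance. Rescaled continuity says nothing at singularities, but on the region of
  speed at least \<open>e\<close> it is uniform, so finitely many points show that \<open>g\<close> keeps this region away from the
  singularities. The image under \<open>h\<close> of a spanning set is then spanning.\<close>

lemma conjugate_entropy_le:
  fixes M :: "('a, 'e::euclidean_space) riem_manifold" and N :: "('b, 'f::euclidean_space) riem_manifold"
  assumes M: "regular_flow M X K A B n" and N: "regular_flow N Y K' A' B' n'"
    and hN: "\<And>y. y \<in> pts N \<Longrightarrow> h y \<in> pts M" and gM: "\<And>x. x \<in> pts M \<Longrightarrow> g x \<in> pts N"
    and hg: "\<And>x. x \<in> pts M \<Longrightarrow> h (g x) = x" and gh: "\<And>y. y \<in> pts N \<Longrightarrow> g (h y) = y"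
    and conj: "\<And>t y. y \<in> pts N \<Longrightarrow> flow M X t (h y) = h (flow N Y t y)"
    and hc: "rescaled_continuous N Y M X h" and gc: "rescaled_continuous M X N Y g"
  shows "rescaled_entropy M X \<le> rescaled_entropy N Y"
proof -
  interpret M: regular_flow M X K A B n by (rule M)
  interpret N: regular_flow N Y K' A' B' n' by (rule N)
  have reg: "h y \<in> regular_pts M X" if y: "y \<in> regular_pts N Y" for y
  proof -
    have yp: "y \<in> pts N" "0 < vf_norm N Y y" using y N.regular_iff by auto
    have "vf_norm M X (h y) \<noteq> 0"
    proof
      assume "vf_norm M X (h y) = 0"
      then have "flow M X s (h y) = h y" for s using M.singular_iff_fixed[OF hN[OF yp(1)]] by blast
      then have "h (flow N Y s y) = h y" for s using conj[OF yp(1)] by simp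
      then have "flow N Y s y = y" for s using gh N.fl_pts yp(1) by metis
      then show False using N.fixed_V[OF yp(1)] yp(2) by auto
    qed
    then show ?thesis using M.regular_iff M.V_nonneg hN[OF yp(1)] by (auto simp: order_less_le)
  qed
  have regg: "0 < vf_norm N Y (g x)" if x: "x \<in> pts M" "0 < vf_norm M X x" for x
  proof -
    have "vf_norm N Y (g x) \<noteq> 0"
    proof
      assume "vf_norm N Y (g x) = 0"
      then have "flow N Y s (g x) = g x" for s using N.singular_iff_fixed[OF gM[OF x(1)]] by blast
      then have "flow M X s x = x" for s using conj[OF gM[OF x(1)], of s] hg[OF x(1)] by simp
      then show False using M.fixed_V[OF x(1)] x(2) by auto
    qed
    then show ?thesis using N.V_nonneg[OF gM[OF x(1)]] by auto
  qed
  obtain \<delta>' where \<delta>': "0 < \<delta>'" "\<And>x x'. x \<in> pts M \<Longrightarrow> x' \<in> pts M \<Longrightarrow> mdist M x x' \<le> \<delta>' * vf_norm M X x \<Longrightarrow>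
      mdist N (g x) (g x') \<le> 1/(2*A') * vf_norm N Y (g x)"
    using gc N.A unfolding rescaled_continuous_def by (metis divide_pos_pos mult_pos_pos zero_less_numeral zero_less_one)
  show ?thesis
    unfolding rescaled_entropy_SUP[of M]
  proof (rule SUP_least)
    fix e :: real assume e: "e \<in> {0<..}"
    let ?S = "{x \<in> pts M. e \<le> vf_norm M X x}"
    \<comment> \<open>If \<open>p\<close> has speed at least \<open>e\<close> and \<open>x\<close> is closer than \<open>\<eta>\<close> to it, then the speed at \<open>g x\<close> is at least that at
      \<open>g p\<close> divided by \<open>2 * A'\<close>.\<close>
    define \<eta> where "\<eta> = min 1 (\<delta>' * e)"
    have \<eta>: "0 < \<eta>" "\<eta> \<le> 1" "\<eta> \<le> \<delta>' * e" using \<delta>' e by (auto simp: \<eta>_def)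
    obtain P where P: "P \<subseteq> ?S" "finite P" "\<And>x. x \<in> ?S \<Longrightarrow> \<exists>y\<in>P. mdist M y x < \<eta>"
      by (rule M.subset_net[OF _ \<eta>(1,2), of ?S]) (auto intro: that)
    obtain R where R: "0 < R" "\<forall>p\<in>P. 1 / vf_norm N Y (g p) \<le> R" using finite_bound[OF P(2), of "\<lambda>p. 1 / vf_norm N Y (g p)"] by blast
    have low: "1 / (2 * A' * R) \<le> vf_norm N Y (g x)" if x: "x \<in> ?S" for x
    proof -
      obtain p where p: "p \<in> P" "mdist M p x < \<eta>" using P(3)[OF x] by blast
      then have pp: "p \<in> pts M" "e \<le> vf_norm M X p" "x \<in> pts M" using P(1) x by auto
      have "\<delta>' * e \<le> \<delta>' * vf_norm M X p" using pp \<delta>' by (intro mult_left_mono) auto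
      then have d: "mdist N (g p) (g x) \<le> 1/(2*A') * vf_norm N Y (g p)" using \<delta>'(2)[OF pp(1,3)] p \<eta>(3) by linarith
      have gp: "0 < vf_norm N Y (g p)" using regg pp e by auto
      have "vf_norm N Y (g p) \<le> A' * (vf_norm N Y (g x) + mdist N (g x) (g p))"
        by (rule N.V_lip) (use gM pp in auto)
      also have "\<dots> \<le> A' * (vf_norm N Y (g x) + 1/(2*A') * vf_norm N Y (g p))"
        using d N.d_sym[of "g x" "g p"] gM pp N.A by (intro mult_left_mono) auto
      also have "\<dots> = A' * vf_norm N Y (g x) + 1/2 * vf_norm N Y (g p)" using N.A by (simp add: field_simps)
      finally have 1: "vf_norm N Y (g p) / (2 * A') \<le> vf_norm N Y (g x)" using N.A by (simp add: field_simps)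
      have "1 / vf_norm N Y (g p) \<le> R" using R(2) p(1) by blast
      then have "1 / R \<le> vf_norm N Y (g p)" using R(1) gp by (simp add: field_simps)
      then have "(1 / R) / (2 * A') \<le> vf_norm N Y (g p) / (2 * A')" using N.A by (intro divide_right_mono) auto
      then show ?thesis using 1 by (simp add: mult.commute)
    qed
    obtain \<delta> where \<delta>: "0 < \<delta>" "\<And>y y'. y \<in> pts N \<Longrightarrow> y' \<in> pts N \<Longrightarrow> mdist N y y' \<le> \<delta> * vf_norm N Y y \<Longrightarrow>
      mdist M (h y) (h y') \<le> e/2 * vf_norm M X (h y)"
      using hc e unfolding rescaled_continuous_def by (metis greaterThan_iff half_gt_zero)
    define e' where "e' = min \<delta> (1 / (2 * A' * R))"
    have e': "0 < e'" "e' \<le> \<delta>" "e' \<le> 1 / (2 * A' * R)" using \<delta> R N.A by (auto simp: e'_def)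
    have "rescaled_rate M X e \<le> rescaled_rate N Y e'"
    proof (rule Limsup_rate_mono)
      fix t :: real assume t: "0 \<le> t"
      show "rspan_number M X t e \<le> rspan_number N Y t e'"
      proof (cases "rspan_number N Y t e'")
        case (enat k)
        obtain F where F: "rescaled_spanning N Y t e' F" "finite F" "card F \<le> k"
          by (rule N.rspan_attained[OF eq_refl[OF enat]]) (rule that, assumption+)
        have Freg: "y \<in> regular_pts N Y" "y \<in> pts N" if "y \<in> F" for y
          using F(1) that N.regular_iff by (auto simp: rescaled_spanning_def)
        have "?S \<subseteq> (\<Union>x\<in>h ` F. rball M X x t e)"
        proof
          fix x assume x: "x \<in> ?S"
          then have xp: "x \<in> pts M" by simp
          have "g x \<in> {y \<in> pts N. e' \<le> vf_norm N Y y}" using low[OF x] e'(3) gM[OF xp] by simp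
          then obtain y where y: "y \<in> F" "g x \<in> rball N Y y t e'" using F(1) unfolding rescaled_spanning_def by blast
          note yr = Freg[OF y(1)]
          have "rdist M X t (h y) x \<le> e/2"
          proof (rule M.rdist_leI[OF reg[OF yr(1)] t])
            fix s assume s: "0 \<le> s" "s \<le> t"
            have "mdist N (flow N Y s y) (flow N Y s (g x)) < e' * vf_norm N Y (flow N Y s y)"
              by (rule N.rdist_lessD[OF yr(1) gM[OF xp] s]) (use y(2) in \<open>auto simp: rball_def\<close>)
            also have "\<dots> \<le> \<delta> * vf_norm N Y (flow N Y s y)"
              using e' N.V_nonneg[OF N.fl_pts[OF yr(2)]] by (intro mult_right_mono) auto
            finally have "mdist M (h (flow N Y s y)) (h (flow N Y s (g x))) \<le> e/2 * vf_norm M X (h (flow N Y s y))"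
              using \<delta>(2)[OF N.fl_pts[OF yr(2)] N.fl_pts[OF gM[OF xp]]] by simp
            then show "mdist M (flow M X s (h y)) (flow M X s x) \<le> e/2 * vf_norm M X (flow M X s (h y))"
              using conj[OF yr(2), of s] conj[OF gM[OF xp], of s] hg[OF xp] by simp
          qed
          then show "x \<in> (\<Union>x\<in>h ` F. rball M X x t e)" using y(1) xp e by (auto simp: rball_def intro!: bexI[of _ y])
        qed
        moreover have "h ` F \<subseteq> regular_pts M X" using reg Freg(1) by auto
        ultimately have "rescaled_spanning M X t e (h ` F)" by (simp add: rescaled_spanning_def)
        then have "rspan_number M X t e \<le> enat (card (h ` F))" by (rule M.rspan_le) (use F in simp)
        also have "\<dots> \<le> enat k" using card_image_le[OF F(2), of h] F(3) by simp
        finally show ?thesis by (simp add: enat)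
      qed simp
    qed
    also have "\<dots> \<le> rescaled_entropy N Y" by (rule rescaled_rate_le_entropy[OF e'(1)])
    finally show "rescaled_rate M X e \<le> rescaled_entropy N Y" .
  qed
qed

section \<open>The sine field on the torus\<close>

text \<open>In angular coordinates \<open>(\<theta>, y)\<close> this is the field \<open>sin \<theta>\<close> times the first coordinate vector. Its
  singularities are two circles, the one at \<open>\<theta> = \<pi>\<close> attracting.\<close>

definition sine_field :: "(complex \<times> complex, real \<times> real) vector_field" where
  "sine_field c p = (Im (fst p), 0)"

lemma Ck_on_trig: "Ck_on k (\<lambda>z::real \<times> real. (a * sin (fst z) + b * cos (fst z), 0::real)) S"
proof (induction k arbitrary: a b)
  case 0
  show ?case by (auto intro!: continuous_intros)
next
  case (Suc k)
  let ?f = "\<lambda>z::real \<times> real. (a * sin (fst z) + b * cos (fst z), 0::real)"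
  have d: "(?f has_derivative (\<lambda>v. (((- b * fst v) * sin (fst z) + (a * fst v) * cos (fst z)), 0))) (at z)" for z
    by (auto intro!: derivative_eq_intros simp: algebra_simps)
  have fd: "frechet_derivative ?f (at z) = (\<lambda>v. (((- b * fst v) * sin (fst z) + (a * fst v) * cos (fst z)), 0))" for z
    using frechet_derivative_at[OF d] by simp
  show ?case
    unfolding Ck_on.simps
  proof (intro conjI ballI allI)
    show "?f differentiable (at z)" for z unfolding differentiable_def using d by blast
    show "Ck_on k (\<lambda>z. frechet_derivative ?f (at z) v) S" for v
      unfolding fd by (rule Suc.IH)
  qed
qed

lemma sine_field_smooth: "smooth_vector_field torus sine_field"
  unfolding smooth_vector_field_def
proof (intro conjI ballI)
  show "tangent_field torus sine_field"
    unfolding tangent_field_def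
  proof (intro ballI)
    fix c d p assume "c \<in> atlas torus" "d \<in> atlas torus" "p \<in> fst c \<inter> fst d"
    then obtain a b where ab: "c = torus_chart a" "d = torus_chart b" by (auto simp: torus_def)
    have "snd c p \<in> snd c ` (fst c \<inter> fst d)" using \<open>p \<in> _\<close> by blast
    then have "coord_change c d p = id"
      unfolding coord_change_def ab by (intro frechet_derivative_at[symmetric] torus_transition(2))
    then show "sine_field d p = coord_change c d p (sine_field c p)" by (simp add: sine_field_def)
  qed
  fix c assume "c \<in> atlas torus"
  then obtain a where a: "c = torus_chart a" by (auto simp: torus_def)
  have "Ck_on k (\<lambda>z. sine_field c (chart_inv c z)) (angle_box a)" for k
  proof (rule Ck_on_cong[OF open_angle_box])
    show "Ck_on k (\<lambda>z::real \<times> real. (1 * sin (fst z) + 0 * cos (fst z), 0::real)) (angle_box a)" by (rule Ck_on_trig)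
    show "(1 * sin (fst z) + 0 * cos (fst z), 0) = sine_field c (chart_inv c z)" if "z \<in> angle_box a" for z
      unfolding a torus_chart_simps(5)[OF that] by (simp add: sine_field_def torus_param_def)
  qed
  then show "smooth_on (\<lambda>z. sine_field c (chart_inv c z)) (snd c ` fst c)"
    unfolding smooth_on_def a torus_chart_simps(1,4) by blast
qed

interpretation T: closed_rmanifold_field torus sine_field
proof
  show "closed_riem_manifold torus" by (rule closed_riem_manifold_torus)
  show "C1_vector_field torus sine_field"
    using sine_field_smooth unfolding C1_vector_field_def smooth_vector_field_def smooth_on_def by blast
qed

lemma torus_pts: "pts torus = sphere 0 1 \<times> sphere 0 1" by (simp add: torus_def)

lemma torus_param_pts: "torus_param z \<in> pts torus" by (simp add: torus_pts torus_param_def)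

lemma sine_norm: "vf_norm torus sine_field p = \<bar>Im (fst p)\<bar>"
  by (simp add: vf_norm_def tnorm_def torus_def sine_field_def)

lemma torus_chart_param:
  assumes "c \<in> atlas torus" "p \<in> fst c" shows "torus_param (snd c p) = p"
proof -
  obtain a where a: "c = torus_chart a" using assms by (auto simp: torus_def)
  then obtain z where "z \<in> angle_box a" "p = torus_param z" using assms by (auto simp: torus_chart_simps)
  then show ?thesis using a by (simp add: torus_chart_simps(2))
qed

lemma torus_param_shift:
  assumes "torus_param z = torus_param w" shows "torus_param (x + (w - z)) = torus_param x"
proof -
  have "cis (u + (r - s)) = cis u" if "cis s = cis r" for u r s :: real
  proof -
    have "cis (u + (r - s)) = cis u * (cis r / cis s)" by (simp only: cis_divide cis_mult)
    then show ?thesis using that by simp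
  qed
  then show ?thesis using assms by (simp add: torus_param_def)
qed

lemma torus_curve_deriv:
  assumes c: "c \<in> atlas torus" and d: "\<And>s. (\<theta> has_vector_derivative \<theta>' s) (at s)" "\<And>s. (y has_vector_derivative y' s) (at s)"
    and p: "torus_param (\<theta> t, y t) \<in> fst c"
  shows "((snd c \<circ> (\<lambda>s. torus_param (\<theta> s, y s))) has_vector_derivative (\<theta>' t, y' t)) (at t)"
proof -
  obtain a where a: "c = torus_chart a" using c by (auto simp: torus_def)
  then obtain w where w: "w \<in> angle_box a" "torus_param (\<theta> t, y t) = torus_param w"
    using p by (auto simp: torus_chart_simps)
  let ?l = "\<lambda>s. (\<theta> s, y s) + (w - (\<theta> t, y t))"
  have "continuous_on UNIV \<theta>" "continuous_on UNIV y"
    by (rule continuous_on_vector_derivative, rule d)+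
  then have "continuous_on UNIV ?l" by (intro continuous_intros)
  then have U: "open (?l -` angle_box a)" by (intro open_vimage open_angle_box)
  have dl: "(?l has_vector_derivative (\<theta>' t, y' t)) (at t)"
    using d[of t] by (auto intro!: derivative_eq_intros has_vector_derivative_Pair)
  show ?thesis
  proof (rule has_vector_derivative_transform_within_open[OF dl U])
    show "t \<in> ?l -` angle_box a" using w by simp
    fix s assume "s \<in> ?l -` angle_box a"
    then have "snd c (torus_param (?l s)) = ?l s" unfolding a by (intro torus_chart_simps(2)) simp
    then show "?l s = (snd c \<circ> (\<lambda>s. torus_param (\<theta> s, y s))) s" by (simp add: torus_param_shift[OF w(2)])
  qed
qed

lemma torus_curve_continuous:
  assumes "\<And>s. (\<theta> has_vector_derivative \<theta>' s) (at s)" "\<And>s. (y has_vector_derivative y' s) (at s)"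
  shows "continuous_map (top_of_set I) (mtop torus) (\<lambda>s. torus_param (\<theta> s, y s))"
proof -
  have "continuous_on UNIV \<theta>" "continuous_on UNIV y"
    by (rule continuous_on_vector_derivative, rule assms)+
  then have "continuous_on I (\<lambda>s. torus_param (\<theta> s, y s))"
    by (intro continuous_on_compose2[OF cont_torus_param[of UNIV]] continuous_on_Pair)
      (auto intro: continuous_on_subset)
  moreover have "torus_param (\<theta> s, y s) \<in> sphere 0 1 \<times> sphere 0 1" for s using torus_param_pts torus_pts by blast
  ultimately show ?thesis by (auto simp: torus_def)
qed

lemma sine_flow:
  assumes "\<And>t. (\<theta> has_vector_derivative sin (\<theta> t)) (at t)"
  shows "flow torus sine_field t (torus_param (\<theta> 0, y)) = torus_param (\<theta> t, y)"
proof -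
  have dy: "((\<lambda>_. y) has_vector_derivative 0) (at s)" for s :: real by (rule has_vector_derivative_const)
  have "integral_curve torus sine_field (\<lambda>t. torus_param (\<theta> t, y))"
    unfolding integral_curve_def
  proof (intro conjI allI ballI impI)
    show "continuous_map euclideanreal (mtop torus) (\<lambda>t. torus_param (\<theta> t, y))"
      using torus_curve_continuous[OF assms dy, of UNIV] by simp
    fix t c assume "c \<in> atlas torus" "torus_param (\<theta> t, y) \<in> fst c"
    then show "((snd c \<circ> (\<lambda>t. torus_param (\<theta> t, y))) has_vector_derivative sine_field c (torus_param (\<theta> t, y))) (at t)"
      using torus_curve_deriv[OF _ assms dy] by (simp add: sine_field_def torus_param_def)
  qed
  from T.flow_unique[OF this] show ?thesis by simp
qed

text \<open>The substitution \<open>u = tan (\<theta> / 2)\<close> turns \<open>\<theta>' = sin \<theta>\<close> into \<open>u' = u\<close>. Angles range from \<open>- \<pi>\<close>, excluded, to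
  the fixed point \<open>\<pi>\<close>, included, so that each point of the circle occurs once and the order is preserved.\<close>

definition angle_flow :: "real \<Rightarrow> real \<Rightarrow> real" where
  "angle_flow t \<theta> = (if \<theta> = pi then pi else 2 * arctan (exp t * tan (\<theta> / 2)))"

lemma sin_2_arctan: "sin (2 * arctan v) = 2 * v / (1 + v\<^sup>2)"
proof -
  have "sqrt (1 + v\<^sup>2) * sqrt (1 + v\<^sup>2) = 1 + v\<^sup>2" by simp
  then show ?thesis by (simp add: sin_double sin_arctan cos_arctan)
qed

lemma angle_flow_0: "- pi < \<theta> \<Longrightarrow> \<theta> \<le> pi \<Longrightarrow> angle_flow 0 \<theta> = \<theta>"
  using arctan_tan[of "\<theta>/2"] by (auto simp: angle_flow_def)

lemma angle_flow_range: "- pi < angle_flow t \<theta>" "angle_flow t \<theta> \<le> pi"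
  using arctan_bounded[of "exp t * tan (\<theta>/2)"] by (auto simp: angle_flow_def)

lemma angle_flow_inverse:
  assumes "- pi < \<theta>" "\<theta> \<le> pi" shows "angle_flow (-t) (angle_flow t \<theta>) = \<theta>"
proof (cases "\<theta> = pi")
  case False
  then have "\<theta> < pi" using assms by simp
  have "2 * arctan (exp t * tan (\<theta>/2)) \<noteq> pi" using arctan_ubound[of "exp t * tan (\<theta>/2)"] by simp
  then show ?thesis using False assms arctan_tan[of "\<theta>/2"] \<open>\<theta> < pi\<close>
    by (simp add: angle_flow_def tan_arctan mult.assoc[symmetric] exp_add[symmetric])
qed (simp add: angle_flow_def)

lemma angle_flow_mono:
  assumes "- pi < \<theta>" "\<theta> < \<theta>'" "\<theta>' \<le> pi" shows "angle_flow t \<theta> < angle_flow t \<theta>'"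
proof (cases "\<theta>' = pi")
  case True
  then show ?thesis using assms arctan_ubound[of "exp t * tan (\<theta>/2)"] by (simp add: angle_flow_def)
next
  case False
  have "tan (\<theta>/2) < tan (\<theta>'/2)" by (rule tan_monotone) (use assms False in auto)
  then show ?thesis using assms False by (simp add: angle_flow_def arctan_monotone)
qed

lemma sine_flow_angle:
  assumes "- pi < \<theta>" "\<theta> \<le> pi"
  shows "flow torus sine_field t (torus_param (\<theta>, y)) = torus_param (angle_flow t \<theta>, y)"
proof -
  have "((\<lambda>t. angle_flow t \<theta>) has_vector_derivative sin (angle_flow s \<theta>)) (at s)" for s
  proof (cases "\<theta> = pi")
    case False
    have "((\<lambda>t. 2 * arctan (exp t * tan (\<theta>/2))) has_real_derivative sin (2 * arctan (exp s * tan (\<theta>/2)))) (at s)"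
      unfolding sin_2_arctan by (auto intro!: derivative_eq_intros simp: divide_simps)
    then show ?thesis using False by (simp add: angle_flow_def has_real_derivative_iff_has_vector_derivative)
  qed (simp add: angle_flow_def)
  from sine_flow[OF this, of t y] show ?thesis using angle_flow_0[OF assms] by simp
qed

lemma torus_angles:
  assumes "p \<in> pts torus"
  obtains \<theta> y where "- pi < \<theta>" "\<theta> \<le> pi" "- pi < y" "y \<le> pi" "p = torus_param (\<theta>, y)"
proof -
  have "norm (fst p) = 1" "norm (snd p) = 1" using assms by (auto simp: torus_pts mem_Times_iff)
  then have "cis (Arg (fst p)) = fst p" "cis (Arg (snd p)) = snd p"
    using cis_Arg[of "fst p"] cis_Arg[of "snd p"] by (force simp: sgn_eq)+
  then show thesis using Arg_bounded[of "fst p"] Arg_bounded[of "snd p"]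
    by (intro that[of "Arg (fst p)" "Arg (snd p)"]) (auto simp: torus_param_def prod_eq_iff)
qed

lemma torus_mdist_le: "mdist torus (torus_param z) (torus_param w) \<le> norm (w - z)"
proof -
  let ?v = "w - z"
  define a where "a s = fst z + s * fst ?v" for s
  define b where "b s = snd z + s * snd ?v" for s
  have da: "(a has_vector_derivative fst ?v) (at s)" and db: "(b has_vector_derivative snd ?v) (at s)" for s
    unfolding a_def b_def by (auto intro!: derivative_eq_intros)
  let ?g = "\<lambda>s. torus_param (a s, b s)"
  have ends: "?g 0 = torus_param z" "?g 1 = torus_param w" by (simp_all add: a_def b_def)
  have D: "((snd c \<circ> ?g) has_vector_derivative ?v) (at t)" if "c \<in> atlas torus" "?g t \<in> fst c" for c t
    using torus_curve_deriv[OF that(1) da db that(2)] by (simp only: prod.collapse)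
  have cont: "continuous_map (top_of_set {0..1}) (mtop torus) ?g" by (rule torus_curve_continuous[OF da db])
  have "C1_curve_on torus 0 1 ?g"
    unfolding C1_curve_on_def
  proof (rule conjI[OF cont], rule ballI)
    fix c assume c: "c \<in> atlas torus"
    show "\<exists>D. continuous_on {t\<in>{0..1}. ?g t \<in> fst c} D \<and>
        (\<forall>t\<in>{0..1}. ?g t \<in> fst c \<longrightarrow> ((snd c \<circ> ?g) has_vector_derivative D t) (at t within {0..1}))"
      by (rule exI[of _ "\<lambda>_. ?v"]) (use has_vector_derivative_at_within[OF D[OF c]] in simp)
  qed
  then have pc: "piecewise_C1_curve torus ?g"
    unfolding piecewise_C1_curve_def by (intro exI[of _ "{0, 1}"]) auto
  have sp: "curve_speed torus ?g t = norm ?v" if t: "t \<in> {0<..<1}" for t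
  proof -
    obtain c where c: "c \<in> atlas torus" "?g t \<in> fst c" using T.chart_at[OF torus_param_pts] by blast
    show ?thesis
      using T.curve_speed_at[OF cont t c D[OF c]] by (simp add: torus_def norm_eq_sqrt_inner)
  qed
  have "curve_length torus ?g = integral {0..1} (\<lambda>_::real. norm ?v)"
    unfolding curve_length_def by (rule integral_spike[of "{0,1}"]) (auto simp: sp)
  then show ?thesis using T.mdist_le[OF pc] ends by simp
qed

text \<open>Monotone circle maps have zero entropy: \<open>n\<close> iterates are controlled by the position relative to the
  preimages of a fixed grid, of which there are at most linearly many.\<close>

lemma sine_flow_entropy: "flow_entropy torus sine_field \<le> 0"
proof -
  obtain K A B m where "regular_flow torus sine_field K A B m" using T.regular_flow_exists by blast
  then interpret R: regular_flow torus sine_field K A B m .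
  obtain ang where ang: "\<And>p. p \<in> pts torus \<Longrightarrow> - pi < fst (ang p) \<and> fst (ang p) \<le> pi \<and> - pi < snd (ang p) \<and>
      snd (ang p) \<le> pi \<and> p = torus_param (ang p)"
  proof -
    have "\<forall>p. \<exists>z. p \<in> pts torus \<longrightarrow> - pi < fst z \<and> fst z \<le> pi \<and> - pi < snd z \<and> snd z \<le> pi \<and> p = torus_param z"
      using torus_angles by (metis fst_conv snd_conv)
    then show thesis using that by metis
  qed
  show ?thesis
    unfolding flow_entropy_def top_entropy_SUP
  proof (rule SUP_least)
    fix \<rho> :: real assume \<rho>: "\<rho> \<in> {0<..}"
    obtain N :: nat where "2 / \<rho> < N" using reals_Archimedean2 by blast
    moreover have "0 < 2 / \<rho>" using \<rho> by simp
    ultimately have "0 < real N" by linarith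
    then have N: "0 < N" "2 / N < \<rho>" using \<open>2 / \<rho> < N\<close> \<rho> by (simp_all add: field_simps)
    define Z where "Z = {- 4 * int N..4 * int N}"
    have fl_Z: "\<lfloor>N * v\<rfloor> \<in> Z" if "- pi < v" "v \<le> pi" for v :: real
    proof -
      have "\<bar>v\<bar> \<le> 4" using that pi_less_4 by linarith
      then have "\<bar>real N * v\<bar> \<le> real N * 4" by (simp add: abs_mult mult_left_mono)
      then have "real N * v \<le> 4 * real N" "- (4 * real N) \<le> real N * v" by auto
      then show ?thesis unfolding Z_def by (auto simp: le_floor_iff floor_le_iff)
    qed
    have cZ: "finite Z" "card Z = 8 * N + 1" by (auto simp: Z_def)
    have bound: "span_number (pts torus) (mdist torus) (flow torus sine_field 1) n \<rho> \<le> enat ((n * (8 * N + 1) + 1) * (8 * N + 1))" for n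
    proof -
      define G where "G = insert (- pi) ((\<lambda>(i, k). angle_flow (- real i) (of_int k / N)) ` ({..<n} \<times> Z))"
      have G: "finite G" "card G \<le> n * (8 * N + 1) + 1"
      proof -
        show "finite G" using cZ by (simp add: G_def)
        have "card G \<le> Suc (card ((\<lambda>(i, k). angle_flow (- real i) (of_int k / N)) ` ({..<n} \<times> Z)))"
          unfolding G_def using cZ by (simp add: card_insert_if)
        also have "\<dots> \<le> Suc (card ({..<n} \<times> Z))" using cZ by (simp only: Suc_le_mono) (rule card_image_le, simp)
        finally show "card G \<le> n * (8 * N + 1) + 1" using cZ by (simp add: card_cartesian_product)
      qed
      define low where "low \<theta> = Max {g \<in> G. g \<le> \<theta>}" for \<theta>
      have low: "low \<theta> \<in> G" "low \<theta> \<le> \<theta>" "\<And>g. g \<in> G \<Longrightarrow> g \<le> \<theta> \<Longrightarrow> g \<le> low \<theta>" if "- pi < \<theta>" for \<theta>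
      proof -
        have "low \<theta> \<in> {g \<in> G. g \<le> \<theta>}" unfolding low_def by (rule Max_in) (use that G in \<open>auto simp: G_def intro: less_imp_le\<close>)
        then show "low \<theta> \<in> G" "low \<theta> \<le> \<theta>" by auto
        show "g \<le> low \<theta>" if "g \<in> G" "g \<le> \<theta>" for g unfolding low_def by (rule Max_ge) (use that G in auto)
      qed
      have cell: "\<lfloor>N * angle_flow i \<theta>'\<rfloor> \<le> \<lfloor>N * angle_flow i \<theta>\<rfloor>"
        if r: "- pi < \<theta>" "\<theta> \<le> pi" "- pi < \<theta>'" "\<theta>' \<le> pi" and l: "low \<theta> = low \<theta>'" and i: "i < n" for \<theta> \<theta>' and i :: nat
      proof (rule ccontr)
        assume "\<not> \<lfloor>N * angle_flow i \<theta>'\<rfloor> \<le> \<lfloor>N * angle_flow i \<theta>\<rfloor>"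
        then have lt: "\<lfloor>N * angle_flow i \<theta>\<rfloor> < \<lfloor>N * angle_flow i \<theta>'\<rfloor>" by simp
        define k where "k = \<lfloor>N * angle_flow i \<theta>'\<rfloor>"
        let ?\<gamma> = "of_int k / real N"
        have "N * angle_flow i \<theta> < of_int k" "of_int k \<le> N * angle_flow i \<theta>'"
          using lt unfolding k_def by linarith+
        then have \<gamma>: "angle_flow i \<theta> < ?\<gamma>" "?\<gamma> \<le> angle_flow i \<theta>'" using N by (auto simp: field_simps)
        have \<gamma>r: "- pi < ?\<gamma>" "?\<gamma> \<le> pi" using \<gamma> angle_flow_range[of i \<theta>] angle_flow_range[of i \<theta>'] by auto
        have g: "angle_flow (- real i) ?\<gamma> \<in> G"
          unfolding G_def using i fl_Z[OF angle_flow_range, of i \<theta>'] by (auto simp: k_def)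
        have "angle_flow (- real i) ?\<gamma> \<le> \<theta>'"
          using angle_flow_mono[OF \<gamma>r(1) _ angle_flow_range(2), of i \<theta>' "- real i"] \<gamma>(2) angle_flow_inverse[OF r(3,4), of i]
          by (cases "?\<gamma> = angle_flow i \<theta>'") auto
        then have "angle_flow (- real i) ?\<gamma> \<le> \<theta>" using low(3)[OF r(3) g] low(2)[OF r(1)] l by simp
        moreover have "\<theta> < angle_flow (- real i) ?\<gamma>"
          using angle_flow_mono[OF angle_flow_range(1) \<gamma>(1) \<gamma>r(2), of "- real i"] angle_flow_inverse[OF r(1,2), of i] by simp
        ultimately show False by simp
      qed
      define code where "code p = (low (fst (ang p)), \<lfloor>N * snd (ang p)\<rfloor>)" for p
      have "span_number (pts torus) (mdist torus) (flow torus sine_field 1) n \<rho> \<le> enat (card (G \<times> Z))"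
      proof (rule span_number_code[of "G \<times> Z" code])
        show "finite (G \<times> Z)" using G cZ by simp
        show "code ` pts torus \<subseteq> G \<times> Z" using low(1) fl_Z ang by (auto simp: code_def)
        fix p q i assume pq: "p \<in> pts torus" "q \<in> pts torus" and c: "code p = code q" and i: "i < n"
        note a = ang[OF pq(1)] and b = ang[OF pq(2)]
        have l: "low (fst (ang p)) = low (fst (ang q))" using c by (simp add: code_def)
        let ?p = "angle_flow (real i) (fst (ang p))" and ?q = "angle_flow (real i) (fst (ang q))"
        have "\<lfloor>N * ?p\<rfloor> = \<lfloor>N * ?q\<rfloor>"
          using cell[of "fst (ang p)" "fst (ang q)" i] cell[of "fst (ang q)" "fst (ang p)" i] a b l i by (simp add: order_antisym)
        then have "\<bar>N * ?q - N * ?p\<bar> < 1" by linarith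
        then have "N * \<bar>?q - ?p\<bar> < 1" by (simp add: abs_mult right_diff_distrib[symmetric])
        then have 1: "\<bar>?q - ?p\<bar> < 1 / N" using N by (simp add: field_simps)
        have "\<lfloor>N * snd (ang p)\<rfloor> = \<lfloor>N * snd (ang q)\<rfloor>" using c by (simp add: code_def)
        then have "\<bar>N * snd (ang q) - N * snd (ang p)\<bar> < 1" by linarith
        then have "N * \<bar>snd (ang q) - snd (ang p)\<bar> < 1" by (simp add: abs_mult right_diff_distrib[symmetric])
        then have 2: "\<bar>snd (ang q) - snd (ang p)\<bar> < 1 / N" using N by (simp add: field_simps)
        have fp: "(flow torus sine_field 1 ^^ i) p = torus_param (?p, snd (ang p))"
          using R.fl_funpow[OF pq(1)] sine_flow_angle[of "fst (ang p)" i "snd (ang p)"] a by simp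
        have fq: "(flow torus sine_field 1 ^^ i) q = torus_param (?q, snd (ang q))"
          using R.fl_funpow[OF pq(2)] sine_flow_angle[of "fst (ang q)" i "snd (ang q)"] b by simp
        have "mdist torus (torus_param (?p, snd (ang p))) (torus_param (?q, snd (ang q))) \<le> norm ((?q, snd (ang q)) - (?p, snd (ang p)))"
          by (rule torus_mdist_le)
        also have "\<dots> \<le> \<bar>?q - ?p\<bar> + \<bar>snd (ang q) - snd (ang p)\<bar>"
          using norm_Pair_le[of "?q - ?p" "snd (ang q) - snd (ang p)"] by simp
        also have "\<dots> < 2 / N" using 1 2 by simp
        finally show "mdist torus ((flow torus sine_field 1 ^^ i) p) ((flow torus sine_field 1 ^^ i) q) < \<rho>"
          using fp fq N by simp
      qed
      also have "\<dots> \<le> enat ((n * (8 * N + 1) + 1) * (8 * N + 1))"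
        using G cZ by (simp only: card_cartesian_product enat_ord_simps) (rule mult_right_mono, auto)
      finally show ?thesis .
    qed
    have "span_rate (pts torus) (mdist torus) (flow torus sine_field 1) \<rho> \<le> ereal 0"
    proof (rule rate_le[OF sequentially_bot filterlim_real_sequentially, of "real ((8 * N + 1) * (8 * N + 1))"])
      have "real ((n * (8 * N + 1) + 1) * (8 * N + 1)) \<le> real ((8 * N + 1) * (8 * N + 1)) * (real n + 1) * exp (0 * real n)" for n
      proof -
        have "(n * (8 * N + 1) + 1) * (8 * N + 1) \<le> ((8 * N + 1) * (n + 1)) * (8 * N + 1)" by (intro mult_right_mono) auto
        then have "real ((n * (8 * N + 1) + 1) * (8 * N + 1)) \<le> real (((8 * N + 1) * (n + 1)) * (8 * N + 1))" by (rule of_nat_mono)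
        then show ?thesis by (simp add: algebra_simps)
      qed
      then show "\<forall>\<^sub>F i in sequentially. \<exists>k. span_number (pts torus) (mdist torus) (flow torus sine_field 1) i \<rho> \<le> enat k \<and>
          real k \<le> real ((8 * N + 1) * (8 * N + 1)) * (real i + 1) * exp (0 * real i)"
        using bound by (intro always_eventually allI exI conjI)
    qed (simp only: of_nat_0_less_iff, simp)
    then show "span_rate (pts torus) (mdist torus) (flow torus sine_field 1) \<rho> \<le> 0" by (simp add: zero_ereal_def)
  qed
qed

text \<open>In charts the function \<open>Im (snd p)\<close> is the sine of a coordinate, hence Lipschitz.\<close>

lemma torus_mdist_ge:
  obtains \<kappa> where "0 < \<kappa>" "\<And>p q. p \<in> pts torus \<Longrightarrow> q \<in> pts torus \<Longrightarrow> \<kappa> * \<bar>Im (snd p) - Im (snd q)\<bar> \<le> mdist torus p q"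
proof -
  have "\<exists>c z r k C. T.good_ball c z r k C \<and> p \<in> fst c \<and> snd c p = z \<and> True" if "p \<in> pts torus" for p
    using T.good_ball_at[OF that] by blast
  from T.finite_charts[of "\<lambda>_ _ _. True", OF this]
  obtain F r0 k C where F: "finite F" "r0 > 0" "k > 0" "C > 0"
    "\<And>c z r. (c, z, r) \<in> F \<Longrightarrow> T.good_ball c z r k C \<and> True"
    "\<And>x. x \<in> pts torus \<Longrightarrow> \<exists>c z r. (c, z, r) \<in> F \<and> x \<in> fst c \<and> snd c x \<in> ball z (r/2) \<and>
       (\<forall>y\<in>pts torus. mdist torus x y < r0 \<longrightarrow> y \<in> fst c \<and> snd c y \<in> ball z r \<and>
          k * norm (snd c y - snd c x) \<le> mdist torus x y)" by metis
  have "min k (r0/2) * \<bar>Im (snd p) - Im (snd q)\<bar> \<le> mdist torus p q" if p: "p \<in> pts torus" and q: "q \<in> pts torus" for p q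
  proof (cases "mdist torus p q < r0")
    case True
    obtain c z r where c: "(c, z, r) \<in> F" "p \<in> fst c" "q \<in> fst c" "k * norm (snd c q - snd c p) \<le> mdist torus p q"
      using F(6)[OF p] q True by blast
    have ca: "c \<in> atlas torus" using F(5)[OF c(1)] by (simp add: T.good_ball_def)
    let ?v = "snd (snd c p)" and ?w = "snd (snd c q)"
    have "snd p = cis ?v" "snd q = cis ?w"
      using torus_chart_param[OF ca c(2)] torus_chart_param[OF ca c(3)] by (auto simp: torus_param_def prod_eq_iff)
    then have "Im (snd p) = sin ?v" "Im (snd q) = sin ?w" by simp_all
    then have "\<bar>Im (snd p) - Im (snd q)\<bar> = 2 * \<bar>sin ((?v - ?w)/2)\<bar> * \<bar>cos ((?v + ?w)/2)\<bar>"
      by (simp add: sin_diff_sin abs_mult)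
    also have "\<dots> \<le> 2 * \<bar>(?v - ?w)/2\<bar> * 1" by (intro mult_mono abs_sin_x_le_abs_x) auto
    also have "\<dots> = norm (snd (snd c q - snd c p))" by simp
    also have "\<dots> \<le> norm (snd c q - snd c p)" by (metis norm_snd_le prod.collapse)
    finally have "k * \<bar>Im (snd p) - Im (snd q)\<bar> \<le> k * norm (snd c q - snd c p)" using F(3) by (intro mult_left_mono) auto
    moreover have "min k (r0/2) * \<bar>Im (snd p) - Im (snd q)\<bar> \<le> k * \<bar>Im (snd p) - Im (snd q)\<bar>" by (intro mult_right_mono) auto
    ultimately show ?thesis using c(4) by linarith
  next
    case False
    have "norm (snd p) = 1" "norm (snd q) = 1" using p q by (auto simp: torus_pts mem_Times_iff)
    then have "\<bar>Im (snd p) - Im (snd q)\<bar> \<le> 2" using abs_Im_le_cmod[of "snd p"] abs_Im_le_cmod[of "snd q"] by linarith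
    then have "min k (r0/2) * \<bar>Im (snd p) - Im (snd q)\<bar> \<le> (r0/2) * 2" using F by (intro mult_mono) auto
    then show ?thesis using False by simp
  qed
  then show thesis using that[of "min k (r0/2)"] F by auto
qed

lemma sin_separated:
  fixes y y' :: real
  assumes "0 \<le> y" "y \<le> 1" "0 \<le> y'" "y' \<le> 1" shows "\<bar>y - y'\<bar> / 2 \<le> \<bar>sin y - sin y'\<bar>"
proof -
  have c: "1/2 \<le> cos x" if "0 \<le> x" "x \<le> 1" for x :: real
  proof -
    have "cos (pi/3) \<le> cos x" by (rule cos_monotone_0_pi_le) (use that pi_gt3 in auto)
    then show ?thesis by (simp add: cos_60)
  qed
  have "(v - u)/2 \<le> sin v - sin u" if uv: "0 \<le> u" "u < v" "v \<le> 1" for u v :: real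
  proof -
    obtain x where x: "u < x" "x < v" "sin v - sin u = (v - u) * cos x"
      using MVT2[of u v sin cos] uv by (auto simp: DERIV_sin)
    have "(v - u) * (1/2) \<le> (v - u) * cos x" using c[of x] x uv by (intro mult_left_mono) auto
    then show ?thesis using x by simp
  qed
  from this[of y y'] this[of y' y] show ?thesis using assms by (cases y y' rule: linorder_cases) auto
qed

text \<open>Points \<open>P j\<close> on a common circle keep their mutual distances while their speed decays like \<open>exp (- t)\<close>, so a
  number of points proportional to \<open>exp t\<close> must lie in different rescaled balls.\<close>

lemma sine_rescaled_entropy: "0 < rescaled_entropy torus sine_field"
proof (rule ccontr)
  assume "\<not> 0 < rescaled_entropy torus sine_field"
  then have e0: "rescaled_entropy torus sine_field \<le> 0" by simp
  obtain K A B m where "regular_flow torus sine_field K A B m" using T.regular_flow_exists by blast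
  then interpret R: regular_flow torus sine_field K A B m .
  obtain \<kappa> where \<kappa>: "0 < \<kappa>" "\<And>p q. p \<in> pts torus \<Longrightarrow> q \<in> pts torus \<Longrightarrow> \<kappa> * \<bar>Im (snd p) - Im (snd q)\<bar> \<le> mdist torus p q"
    by (rule torus_mdist_ge) (rule that, assumption+)
  define e where "e = min 1 (1/(2*A))"
  have e: "0 < e" "e \<le> 1" "A * e \<le> 1/2" using R.A by (auto simp: e_def min_def field_simps)
  have "rescaled_rate torus sine_field e < ereal (1/2)"
  proof -
    have "rescaled_rate torus sine_field e \<le> 0"
      using rescaled_rate_le_entropy[OF e(1), of torus sine_field] e0 by (rule order_trans)
    also have "0 < ereal (1/2)" by simp
    finally show ?thesis .
  qed
  from rate_less[OF filterlim_ident this]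
  have ev: "\<forall>\<^sub>F t in at_top. \<exists>k. rspan_number torus sine_field t e = enat k \<and> real k \<le> exp (1/2 * t)" .
  have lower: "\<kappa> * exp t / 16 - 1 \<le> exp (t/2)"
    if t: "0 \<le> t" and k: "rspan_number torus sine_field t e = enat k" "real k \<le> exp (1/2 * t)" for t k
  proof -
    define N where "N = nat \<lfloor>\<kappa> * exp t / 16\<rfloor>"
    have N: "\<kappa> * exp t / 16 - 1 \<le> real N" "real N \<le> \<kappa> * exp t / 16" 
    proof -
      have "real N = of_int \<lfloor>\<kappa> * exp t / 16\<rfloor>" using \<kappa>(1) by (simp add: N_def)
      then show "\<kappa> * exp t / 16 - 1 \<le> real N" "real N \<le> \<kappa> * exp t / 16" by linarith+
    qed
    obtain F where F: "rescaled_spanning torus sine_field t e F" "finite F" "card F \<le> k"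
      by (rule R.rspan_attained[OF eq_refl[OF k(1)]]) (rule that, assumption+)
    define P where "P j = torus_param (pi/2, real j / real N)" for j
    have Pp: "P j \<in> pts torus" for j by (simp add: P_def torus_param_pts)
    have "P j \<in> {x \<in> pts torus. e \<le> vf_norm torus sine_field x}" for j
      using Pp e by (simp add: sine_norm P_def torus_param_def)
    then have "\<forall>j. \<exists>z\<in>F. P j \<in> rball torus sine_field z t e" using F(1) unfolding rescaled_spanning_def by blast
    then obtain ctr where ctr: "\<And>j. ctr j \<in> F" "\<And>j. P j \<in> rball torus sine_field (ctr j) t e" by metis
    have fP: "flow torus sine_field t (P j) = torus_param (2 * arctan (exp t), real j / real N)" for j
      using sine_flow_angle[of "pi/2" t "real j / real N"] by (simp add: P_def angle_flow_def tan_45)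
    have VP: "vf_norm torus sine_field (flow torus sine_field t (P j)) \<le> 2 * exp (-t)" for j
    proof -
      have "\<bar>sin (2 * arctan (exp t))\<bar> = 2 * exp t / (1 + (exp t)\<^sup>2)" by (simp add: sin_2_arctan add_pos_pos)
      also have "\<dots> \<le> 2 * exp t / (exp t)\<^sup>2" by (intro divide_left_mono) (auto simp: add_pos_pos)
      also have "\<dots> = 2 * exp (-t)" by (simp add: power2_eq_square exp_minus field_simps)
      finally show ?thesis by (simp add: fP sine_norm torus_param_def)
    qed
    have inj: "inj_on ctr {..<N}"
    proof (rule inj_onI, rule ccontr)
      fix i j assume ij: "i \<in> {..<N}" "j \<in> {..<N}" "ctr i = ctr j" "i \<noteq> j"
      let ?f = "flow torus sine_field t"
      let ?z = "?f (ctr i)"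
      have zr: "ctr i \<in> regular_pts torus sine_field" using F(1) ctr(1) by (auto simp: rescaled_spanning_def)
      then have zp: "?z \<in> pts torus" using R.regular_iff R.fl_pts by blast
      have p: "?f (P i) \<in> pts torus" "?f (P j) \<in> pts torus" using R.fl_pts Pp by auto
      let ?V = "vf_norm torus sine_field"
      have di: "mdist torus ?z (?f (P i)) < e * ?V ?z" by (rule R.rdist_lessD[OF zr Pp t order_refl]) (use ctr(2)[of i] in \<open>simp add: rball_def\<close>)
      have dj: "mdist torus ?z (?f (P j)) < e * ?V ?z" by (rule R.rdist_lessD[OF zr Pp t order_refl]) (use ctr(2)[of j] ij in \<open>simp add: rball_def\<close>)
      have "?V ?z \<le> A * (?V (?f (P i)) + mdist torus (?f (P i)) ?z)" by (rule R.V_lip[OF p(1) zp])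
      also have "\<dots> \<le> A * (2 * exp (-t) + e * ?V ?z)"
        using VP[of i] di R.d_sym[OF p(1) zp] R.A by (intro mult_left_mono) auto
      also have "\<dots> = 2 * A * exp (-t) + (A * e) * ?V ?z" by (simp add: algebra_simps)
      also have "\<dots> \<le> 2 * A * exp (-t) + 1/2 * ?V ?z" using R.V_nonneg[OF zp] e(3) by (intro add_left_mono mult_right_mono)
      finally have Vz: "?V ?z \<le> 4 * A * exp (-t)" by simp
      have "mdist torus (?f (P i)) (?f (P j)) < 2 * e * ?V ?z"
        using R.d_tri[OF p(1) zp p(2)] di dj R.d_sym[OF p(1) zp] by linarith
      also have "\<dots> \<le> 2 * e * (4 * A * exp (-t))" using Vz e by (intro mult_left_mono) auto
      also have "\<dots> = 8 * (A * e) * exp (-t)" by simp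
      also have "\<dots> \<le> 4 * exp (-t)" using e(3) by (intro mult_right_mono) auto
      finally have up: "mdist torus (?f (P i)) (?f (P j)) < 4 * exp (-t)" .
      have N0: "0 < real N" using ij by auto
      have "1 \<le> \<bar>real i - real j\<bar>" using ij(4) by linarith
      then have "1 / real N \<le> \<bar>real i / real N - real j / real N\<bar>"
        using N0 by (simp add: diff_divide_distrib[symmetric] abs_divide divide_right_mono)
      also have "\<dots> / 2 \<le> \<bar>sin (real i / real N) - sin (real j / real N)\<bar>"
        by (rule sin_separated) (use ij N0 in auto)
      finally have "1 / (2 * real N) \<le> \<bar>sin (real i / real N) - sin (real j / real N)\<bar>" by simp
      then have "\<kappa> * (1 / (2 * real N)) \<le> \<kappa> * \<bar>Im (snd (?f (P i))) - Im (snd (?f (P j)))\<bar>"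
        using \<kappa> by (intro mult_left_mono) (auto simp: fP torus_param_def)
      also have "\<dots> \<le> mdist torus (?f (P i)) (?f (P j))" by (rule \<kappa>(2)[OF p])
      finally have "\<kappa> / (2 * real N) < 4 * exp (-t)" using up by simp
      then have "\<kappa> < 8 * real N * exp (-t)" using N0 by (simp add: field_simps)
      also have "\<dots> \<le> 8 * (\<kappa> * exp t / 16) * exp (-t)" using N by (intro mult_right_mono mult_left_mono) auto
      also have "\<dots> = \<kappa> / 2" by (simp add: exp_minus field_simps)
      finally show False using \<kappa> by simp
    qed
    have "N = card (ctr ` {..<N})" using card_image[OF inj] by simp
    also have "\<dots> \<le> card F" by (rule card_mono[OF F(2)]) (use ctr in auto)
    finally have "real N \<le> real k" using F(3) by simp
    then show ?thesis using N(1) k(2) by simp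
  qed
  have "\<forall>\<^sub>F t in at_top. exp (t/2) < \<kappa> * exp t / 16 - 1"
    using \<kappa>(1) by real_asymp
  with ev eventually_ge_at_top[of "0::real"] have "\<forall>\<^sub>F t::real in at_top. False"
    by eventually_elim (use lower in force)
  then show False by simp
qed

lemma sine_nonzero: "nonzero_field torus sine_field"
proof -
  have "torus_param (pi/2, 0) \<in> pts torus" by (rule torus_param_pts)
  moreover then have "torus_param (pi/2, 0) \<notin> Sing torus sine_field"
    using T.Sing_iff by (simp add: sine_norm torus_param_def)
  ultimately show ?thesis unfolding nonzero_field_def by blast
qed

section \<open>Properties of the rescaled entropy\<close>

theorem mainTheorem1:
  fixes M :: "('a, 'e::euclidean_space) riem_manifold"
    and X :: "('a, 'e) vector_field"
  assumes "closed_riem_manifold M"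
    and "C1_vector_field M X"
    and "nonzero_field M X"
  shows "(\<exists>r::real. 0 \<le> r \<and> rescaled_entropy M X = ereal r)
    \<and> (\<forall>\<mu>::'a measure. borel_prob (mtop M) \<mu> \<and> measure \<mu> (Sing M X) = 0 \<longrightarrow>
          rescaled_metric_entropy M X \<mu> \<le> rescaled_entropy M X)
    \<and> flow_entropy M X \<le> rescaled_entropy M X
    \<and> (Sing M X = {} \<longrightarrow> flow_entropy M X = rescaled_entropy M X)
    \<and> (\<exists>Z. smooth_vector_field torus Z \<and> nonzero_field torus Z \<and>
          rescaled_entropy torus Z > 0 \<and> flow_entropy torus Z \<noteq> rescaled_entropy torus Z)
    \<and> (\<forall>(N :: ('b, 'f::euclidean_space) riem_manifold) (Y :: ('b, 'f) vector_field).
          closed_riem_manifold N \<and> C1_vector_field N Y \<and> nonzero_field N Y \<and>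
          rescaled_conjugate M X N Y \<longrightarrow> rescaled_entropy M X = rescaled_entropy N Y)
    \<and> (rescaling_expansive M X \<and> dynamically_isolated_Sing M X \<longrightarrow>
          Limsup at_top (\<lambda>t::real. elog (ecard (periodic_orbits_upto M X t)) / ereal t)
            \<le> rescaled_entropy M X)"
proof -
  interpret F: closed_rmanifold_field M X by unfold_locales (fact assms)+
  obtain K A B n where R: "regular_flow M X K A B n" using F.regular_flow_exists by blast
  then interpret R: regular_flow M X K A B n .
  have torus: "\<exists>Z. smooth_vector_field torus Z \<and> nonzero_field torus Z \<and>
          rescaled_entropy torus Z > 0 \<and> flow_entropy torus Z \<noteq> rescaled_entropy torus Z"
    using sine_field_smooth sine_nonzero sine_rescaled_entropy sine_flow_entropy
    by (intro exI[of _ sine_field]) auto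
  have conj: "rescaled_entropy M X = rescaled_entropy N Y"
    if N: "closed_riem_manifold N" "C1_vector_field N Y" and c: "rescaled_conjugate M X N Y"
    for N :: "('b, 'f::euclidean_space) riem_manifold" and Y :: "('b, 'f) vector_field"
  proof -
    interpret G: closed_rmanifold_field N Y by unfold_locales (fact N)+
    obtain K' A' B' n' where S: "regular_flow N Y K' A' B' n'" using G.regular_flow_exists by blast
    obtain h where h: "bij_betw h (pts N) (pts M)" "rescaled_continuous N Y M X h"
      "rescaled_continuous M X N Y (inv_into (pts N) h)" "\<And>t y. y \<in> pts N \<Longrightarrow> flow M X t (h y) = h (flow N Y t y)"
      using c unfolding rescaled_conjugate_def rescaled_homeomorphism_def by blast
    let ?g = "inv_into (pts N) h"
    have hN: "h y \<in> pts M" if "y \<in> pts N" for y using h(1) that by (auto simp: bij_betw_def)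
    have gM: "?g x \<in> pts N" and hg: "h (?g x) = x" if "x \<in> pts M" for x
      using h(1) that by (auto simp: bij_betw_def intro: inv_into_into f_inv_into_f)
    have gh: "?g (h y) = y" if "y \<in> pts N" for y using h(1) that by (auto simp: bij_betw_def)
    have cj: "flow N Y t (?g x) = ?g (flow M X t x)" if x: "x \<in> pts M" for t x
    proof -
      have "flow M X t x = h (flow N Y t (?g x))" using h(4)[OF gM[OF x], of t] hg[OF x] by simp
      then show ?thesis using gh[OF G.flow_pts[OF gM[OF x]]] by simp
    qed
    show ?thesis
    proof (rule order_antisym)
      show "rescaled_entropy M X \<le> rescaled_entropy N Y"
        by (rule conjugate_entropy_le[OF R S hN gM hg gh h(4,2,3)])
      show "rescaled_entropy N Y \<le> rescaled_entropy M X"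
        by (rule conjugate_entropy_le[OF S R gM hN gh hg cj h(3,2)])
    qed
  qed
  show ?thesis
    using R.rescaled_entropy_real[OF assms(3)] R.metric_entropy_le R.entropy_le_rescaled[OF assms(3)]
      R.nonsingular_entropy_le torus conj R.periodic_orbit_growth
    by (intro conjI allI impI) (auto intro: order_antisym)
qed

end
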